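(* For every commutative semiring $\mathcal{R}$, the problem $\mathrm{SAT}(\mathcal{R})$ (given a $\bigoplus$BF $\alpha$ over $\mathcal{R}$, compute $\llbracket\alpha\rrbracket_{\mathcal{R}}(\emptyset)$) is $\mathrm{NP}_\infty(\mathcal{R})$-complete with respect to Karp s-reductions; that is, $\mathrm{SAT}(\mathcal{R})\in\mathrm{NP}_\infty(\mathcal{R})$ and every function in $\mathrm{NP}_\infty(\mathcal{R})$ is Karp s-reducible to $\mathrm{SAT}(\mathcal{R})$.
   Context: **Semirings.** A semiring $\mathcal{R}=(R,\oplus,\otimes,e_\oplus,e_\otimes)$ consists of a commutative monoid $(R,\oplus,e_\oplus)$ and a monoid $(R,\otimes,e_\otimes)$ with $e_\oplus\neq e_\otimes$, such that $\otimes$ distributes over $\oplus$ on both sides and $e_\oplus$ is annihilating for $\otimes$; it is commutative if $\otimes$ is. **Weighted quantified Boolean formulas.** Let $\mathcal{V}$ be a countable set of propositional variables. Weighted QBFs over $\mathcal{R}$ are given by $\alpha::=k\mid v\mid\neg v\mid\alpha\oplus\alpha\mid\alpha\otimes\alpha\mid\bigoplus v\,\alpha\mid\bigotimes v\,\alpha$ with $k\in R$, $v\in\mathcal{V}$. For an interpretation $\mathcal{I}$ (a set of literals $v$, $\neg v$), put $\mathcal{I}_v=(\mathcal{I}\setminus\{\neg v\})\cup\{v\}$ and $\mathcal{I}_{\neg v}=(\mathcal{I}\setminus\{v\})\cup\{\neg v\}$. The semantics is: $\llbracket k\rrbracket_{\mathcal{R}}(\mathcal{I})=k$; for a literal $l\in\{v,\neg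 v\}$, $\llbracket l\rrbracket_{\mathcal{R}}(\mathcal{I})=e_\otimes$ if $l\in\mathcal{I}$ and $e_\oplus$ otherwise; $\llbracket\alpha_1\oplus\alpha_2\rrbracket=\llbracket\alpha_1\rrbracket\oplus\llbracket\alpha_2\rrbracket$; $\llbracket\alpha_1\otimes\alpha_2\rrbracket=\llbracket\alpha_1\rrbracket\otimes\llbracket\alpha_2\rrbracket$ (at the same $\mathcal{I}$); $\llbracket\bigoplus v\,\alpha\rrbracket(\mathcal{I})=\llbracket\alpha\rrbracket(\mathcal{I}_v)\oplus\llbracket\alpha\rrbracket(\mathcal{I}_{\neg v})$; $\llbracket\bigotimes v\,\alpha\rrbracket(\mathcal{I})=\llbracket\alpha\rrbracket(\mathcal{I}_v)\otimes\llbracket\alpha\rrbracket(\mathcal{I}_{\neg v})$. A $\bigoplus$BF is a weighted QBF without free variables whose only quantifiers are sum quantifiers $\bigoplus v$. $\mathrm{SAT}(\mathcal{R})$ is viewed as a function $(\Sigma\cup R)^*\to R$ under a standard encoding of formulas as strings, in which connectives, parentheses and (indexed) variables are written over a fixed finite alphabet $\Sigma$ and each semiring constant $k$ is written as the single symbol $k\in R$; strings that do not encode a $\bigoplus$BF are mapped to $e_\oplus$. **Semiring Turing machines.** Alphabets are finite and their letters are regarded as distinct from elements of $R$. A Semiring Turing Machine (SRTM) over $\mathcal{R}$ is $M=(R',Q,\Sigma_I,\Sigma,\iota,\mathcal{X},\sqcup,\delta)$ with $R'\subseteq R$ finite, $Q$ a finite set of states, $\Sigma_I\subseteq\Sigma$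 finite (input and tape alphabet), $\iota\in Q$ the initial state, $\sqcup\in\Sigma\setminus\Sigma_I$ the blank, $\mathcal{X}\in\Sigma\setminus\Sigma_I$ the semiring placeholder, and $\delta\subseteq (Q\times\Sigma)\times(Q\times\Sigma)\times\{-1,1\}\times(R'\cup\{\mathcal{X}\})$. Tape cells are indexed by $\mathbb{Z}$; each cell $i$ holds a symbol $x_i^\Sigma\in\Sigma$ and a (read-only) semiring value $x_i^R\in R$. A configuration is $c=(q,x,n)$ with state $q$, tape content $x$, head position $n$. A transition $((q,\sigma),(q',\sigma'),d,r)\in\delta$ is applicable to $c$ if $\sigma=x_n^\Sigma$; it leads to $(q',x[x_n^\Sigma/\sigma'],n+d)$ (the symbol in cell $n$ is replaced by $\sigma'$) and has weight $\mathrm{wt}(r,c)=r$ if $r\in R'$ and $\mathrm{wt}(r,c)=x_n^R$ if $r=\mathcal{X}$. For $s\in(\Sigma_I\cup R)^*$ (positions $0,\dots,|s|-1$), the initial tape $x(s)$ has: $x(s)^\Sigma_i=s_i$ and $x(s)^R_i=e_\oplus$ if $s_i\in\Sigma_I$; $x(s)^\Sigma_i=\mathcal{X}$ and $x(s)^R_i=s_i$ if $s_i\in R$; and $x(s)^\Sigma_i=\sqcup$, $x(s)^R_i=e_\oplus$ for cells outside the input. $M$ is terminating if there is $\ell:(\Sigma_I\cup R)^*\to\mathbb{N}$ such that every computation path of $M$ on $s$ has length at most $\ell(s)$. For terminating $M$, $\mathrm{val}(c)=\bigoplus \mathrm{wt}(r,c)\otimes\mathrm{val}(q',x[x_n^\Sigma/\sigma'],n+d)$,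 the sum ranging over all $((q,\sigma),(q',\sigma'),d,r)\in\delta$ applicable to $c$, and $\mathrm{val}(c)=e_\otimes$ if none is applicable. The output function is $\lVert M\rVert(s)=\mathrm{val}(\iota,x(s),0)$. $\mathrm{NP}_\infty(\mathcal{R})$ is the class of functions $f:(\Sigma_I\cup R)^*\to R$ ($\Sigma_I$ a finite alphabet) with $f=\lVert M\rVert$ for some terminating SRTM $M$ over $\mathcal{R}$ for which $\ell(s)$ is polynomially bounded in $|s|$. **Karp s-reductions.** For a finite alphabet $\Sigma$ with $S,V,E\notin\Sigma$ let $s_{S,V,E}(\Sigma)=(\Sigma\cup\{SV^nE\mid n\in\mathbb{N}\})^*$. For $\sigma:\mathbb{N}\to R$ and $x\in s_{S,V,E}(\Sigma)$, $\sigma(x)\in(\Sigma\cup R)^*$ is obtained by replacing every occurrence of $SV^nE$ by $\sigma(n)$. A Karp s-reduction from $f_1:(\Sigma_1\cup R)^*\to R$ to $f_2:(\Sigma_2\cup R)^*\to R$ is a polynomial-time computable $T:s_{S,V,E}(\Sigma_1)\to s_{S,V,E}(\Sigma_2)$ together with a finite set $\{r_1,\dots,r_k\}\subseteq R$, $k\ge0$, such that $f_1(\sigma(x))=f_2(\sigma(T(x)))$ for all $x\in s_{S,V,E}(\Sigma_1)$ and all $\sigma:\mathbb{N}\to R$ with $\sigma(i-1)=r_i$ for $1\le i\le k$. *)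

theory Defs
  imports "HOL-Computational_Algebra.Polynomial"
begin

text \<open>
  The classes \<^class>\<open>semiring_1\<close> and \<^class>\<open>comm_semiring_1\<close> are exactly the semirings, resp.
  commutative semirings, with \<open>0 \<noteq> 1\<close>; the carrier is the whole type.
  Alphabet letters are natural numbers, and the sum type keeps them distinct from semiring values.
\<close>

type_synonym 'r word = "(nat + 'r) list"

definition words_over :: "nat set \<Rightarrow> 'r word set" where
  "words_over \<Sigma> = lists (Inl ` \<Sigma> \<union> range Inr)"


section \<open>Weighted quantified Boolean formulas\<close>

datatype literal = PosLit nat | NegLit nat

datatype 'r wqbf =
    Const 'r
  | Lit literal
  | Plus "'r wqbf" "'r wqbf"
  | Times "'r wqbf" "'r wqbf"
  | SumQ nat "'r wqbf"
  | ProdQ nat "'r wqbf"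

fun set_lit :: "literal \<Rightarrow> literal set \<Rightarrow> literal set" where
  "set_lit (PosLit v) I = insert (PosLit v) (I - {NegLit v})"
| "set_lit (NegLit v) I = insert (NegLit v) (I - {PosLit v})"

fun sem :: "'r::semiring_1 wqbf \<Rightarrow> literal set \<Rightarrow> 'r" where
  "sem (Const k) I = k"
| "sem (Lit l) I = (if l \<in> I then 1 else 0)"
| "sem (Plus \<alpha> \<beta>) I = sem \<alpha> I + sem \<beta> I"
| "sem (Times \<alpha> \<beta>) I = sem \<alpha> I * sem \<beta> I"
| "sem (SumQ v \<alpha>) I = sem \<alpha> (set_lit (PosLit v) I) + sem \<alpha> (set_lit (NegLit v) I)"
| "sem (ProdQ v \<alpha>) I = sem \<alpha> (set_lit (PosLit v) I) * sem \<alpha> (set_lit (NegLit v) I)"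

fun free_vars :: "'r wqbf \<Rightarrow> nat set" where
  "free_vars (Const k) = {}"
| "free_vars (Lit (PosLit v)) = {v}"
| "free_vars (Lit (NegLit v)) = {v}"
| "free_vars (Plus \<alpha> \<beta>) = free_vars \<alpha> \<union> free_vars \<beta>"
| "free_vars (Times \<alpha> \<beta>) = free_vars \<alpha> \<union> free_vars \<beta>"
| "free_vars (SumQ v \<alpha>) = free_vars \<alpha> - {v}"
| "free_vars (ProdQ v \<alpha>) = free_vars \<alpha> - {v}"

fun only_sum_quantifiers :: "'r wqbf \<Rightarrow> bool" where
  "only_sum_quantifiers (Const k) = True"
| "only_sum_quantifiers (Lit l) = True"
| "only_sum_quantifiers (Plus \<alpha> \<beta>) = (only_sum_quantifiers \<alpha> \<and> only_sum_quantifiers \<beta>)"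
| "only_sum_quantifiers (Times \<alpha> \<beta>) = (only_sum_quantifiers \<alpha> \<and> only_sum_quantifiers \<beta>)"
| "only_sum_quantifiers (SumQ v \<alpha>) = only_sum_quantifiers \<alpha>"
| "only_sum_quantifiers (ProdQ v \<alpha>) = False"

definition sum_BF :: "'r wqbf \<Rightarrow> bool" where
  "sum_BF \<alpha> \<longleftrightarrow> free_vars \<alpha> = {} \<and> only_sum_quantifiers \<alpha>"


subsection \<open>Formulas as strings\<close>

datatype token =
  LPar | RPar | PlusTok | TimesTok | SumTok | ProdTok | NegTok | VarTok | Bit0 | Bit1

fun letter :: "token \<Rightarrow> nat" where
  "letter LPar = 0"
| "letter RPar = 1"
| "letter PlusTok = 2"
| "letter TimesTok = 3"
| "letter SumTok = 4"
| "letter ProdTok = 5"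
| "letter NegTok = 6"
| "letter VarTok = 7"
| "letter Bit0 = 8"
| "letter Bit1 = 9"

definition sat_alphabet :: "nat set" where
  "sat_alphabet = range letter"

abbreviation tok :: "token \<Rightarrow> nat + 'r" where
  "tok t \<equiv> Inl (letter t)"

text \<open>Variable indices are written in binary, most significant bit first.\<close>

fun binary :: "nat \<Rightarrow> token list" where
  "binary n =
     (if n < 2 then [] else binary (n div 2)) @ [if even n then Bit0 else Bit1]"

declare binary.simps [simp del]

definition encode_var :: "nat \<Rightarrow> 'r word" where
  "encode_var v = tok VarTok # map tok (binary v)"

fun encode :: "'r wqbf \<Rightarrow> 'r word" where
  "encode (Const k) = [Inr k]"
| "encode (Lit (PosLit v)) = encode_var v"
| "encode (Lit (NegLit v)) = tok NegTok # encode_var v"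
| "encode (Plus \<alpha> \<beta>) = [tok LPar] @ encode \<alpha> @ [tok PlusTok] @ encode \<beta> @ [tok RPar]"
| "encode (Times \<alpha> \<beta>) = [tok LPar] @ encode \<alpha> @ [tok TimesTok] @ encode \<beta> @ [tok RPar]"
| "encode (SumQ v \<alpha>) = [tok SumTok] @ encode_var v @ encode \<alpha>"
| "encode (ProdQ v \<alpha>) = [tok ProdTok] @ encode_var v @ encode \<alpha>"

definition SAT :: "'r::semiring_1 word \<Rightarrow> 'r" where
  "SAT w = (if \<exists>\<alpha>. sum_BF \<alpha> \<and> encode \<alpha> = w
            then sem (THE \<alpha>. sum_BF \<alpha> \<and> encode \<alpha> = w) {}
            else 0)"

lemma letter_eq_iff [simp]: "letter s = letter t \<longleftrightarrow> s = t"
  by (cases s; cases t) simp_all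

lemma binary_bits: "set (binary n) \<subseteq> {Bit0, Bit1}"
proof (induction n rule: binary.induct)
  case (1 n)
  then show ?case by (subst binary.simps) auto
qed

lemma binary_not_Nil: "binary n \<noteq> []"
  by (subst binary.simps) simp

lemma binary_inj: "binary m = binary n \<Longrightarrow> m = n"
proof (induction m arbitrary: n rule: binary.induct)
  case (1 m)
  let ?pre = "\<lambda>k. if k < 2 then [] else binary (k div 2)"
  have eq: "?pre m = ?pre n" "even m = even n"
    using 1(2) by (auto simp: binary.simps[of m] binary.simps[of n] split: if_splits)
  show ?case
  proof (cases "m < 2")
    case True
    then have "n < 2" using eq(1) binary_not_Nil[of "m div 2"] binary_not_Nil[of "n div 2"]
      by (auto split: if_splits)
    with True eq(2) show ?thesis by (auto simp: less_2_cases_iff)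
  next
    case False
    then have n: "\<not> n < 2" using eq(1) binary_not_Nil[of "m div 2"] binary_not_Nil[of "n div 2"]
      by (auto split: if_splits)
    with False eq(1) have "m div 2 = n div 2" using 1(1)[OF False, of "n div 2"] by simp
    with eq(2) show ?thesis
      by (metis bit_eq_rec)
  qed
qed

definition no_bit :: "'r word \<Rightarrow> bool" where
  "no_bit xs \<longleftrightarrow> (xs = [] \<or> hd xs \<notin> {tok Bit0, tok Bit1})"

lemma bits_append_inject:
  assumes "map tok bs @ xs = map tok cs @ ys"
    and "set bs \<subseteq> {Bit0, Bit1}" "set cs \<subseteq> {Bit0, Bit1}" "no_bit xs" "no_bit ys"
  shows "bs = cs \<and> xs = ys"
  using assms
proof (induction bs arbitrary: cs)
  case Nil
  then show ?case by (cases cs) (auto simp: no_bit_def)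
next
  case (Cons b bs)
  then show ?case by (cases cs) (auto simp: no_bit_def)
qed

lemma encode_var_append_inject:
  assumes "encode_var v @ xs = encode_var w @ ys" "no_bit xs" "no_bit ys"
  shows "v = w \<and> xs = ys"
  using assms bits_append_inject[OF _ binary_bits binary_bits, of v xs w ys] binary_inj
  by (auto simp: encode_var_def)

lemma no_bit_Cons [simp]: "no_bit (x # xs) \<longleftrightarrow> x \<notin> {tok Bit0, tok Bit1}"
  by (simp add: no_bit_def)

lemma no_bit_encode_var [simp]: "no_bit (encode_var v @ xs)"
  by (simp add: encode_var_def)

lemma no_bit_encode [simp]: "no_bit (encode \<alpha> @ xs)"
  by (cases \<alpha> rule: encode.cases) simp_all

lemma encode_append_inject:
  assumes "encode \<alpha> @ xs = encode \<beta> @ ys" "no_bit xs" "no_bit ys"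
  shows "\<alpha> = \<beta> \<and> xs = ys"
  using assms
proof (induction \<alpha> arbitrary: \<beta> xs ys rule: encode.induct)
  case (1 k)
  then show ?case by (cases \<beta> rule: encode.cases) (auto simp: encode_var_def)
next
  case (2 v)
  then show ?case
    by (cases \<beta> rule: encode.cases) (auto dest: encode_var_append_inject, auto simp: encode_var_def)
next
  case (3 v)
  then show ?case
    by (cases \<beta> rule: encode.cases) (auto dest: encode_var_append_inject, auto simp: encode_var_def)
next
  case (4 \<alpha>1 \<alpha>2)
  show ?case
  proof (cases \<beta> rule: encode.cases)
    case (4 \<beta>1 \<beta>2)
    with "4.prems" have
      "encode \<alpha>1 @ (tok PlusTok # encode \<alpha>2 @ tok RPar # xs)
       = encode \<beta>1 @ (tok PlusTok # encode \<beta>2 @ tok RPar # ys)" by simp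
    from "4.IH"(1)[OF this] have
      *: "\<alpha>1 = \<beta>1" "encode \<alpha>2 @ (tok RPar # xs) = encode \<beta>2 @ (tok RPar # ys)" by simp_all
    from "4.IH"(2)[OF *(2)] *(1) 4 show ?thesis by simp
  next
    case (5 \<beta>1 \<beta>2)
    with "4.prems" have
      "encode \<alpha>1 @ (tok PlusTok # encode \<alpha>2 @ tok RPar # xs)
       = encode \<beta>1 @ (tok TimesTok # encode \<beta>2 @ tok RPar # ys)" by simp
    from "4.IH"(1)[OF this] show ?thesis by simp
  qed (use "4.prems" in \<open>auto simp: encode_var_def\<close>)
next
  case (5 \<alpha>1 \<alpha>2)
  show ?case
  proof (cases \<beta> rule: encode.cases)
    case (5 \<beta>1 \<beta>2)
    with "5.prems" have
      "encode \<alpha>1 @ (tok TimesTok # encode \<alpha>2 @ tok RPar # xs)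
       = encode \<beta>1 @ (tok TimesTok # encode \<beta>2 @ tok RPar # ys)" by simp
    from "5.IH"(1)[OF this] have
      *: "\<alpha>1 = \<beta>1" "encode \<alpha>2 @ (tok RPar # xs) = encode \<beta>2 @ (tok RPar # ys)" by simp_all
    from "5.IH"(2)[OF *(2)] *(1) 5 show ?thesis by simp
  next
    case (4 \<beta>1 \<beta>2)
    with "5.prems" have
      "encode \<alpha>1 @ (tok TimesTok # encode \<alpha>2 @ tok RPar # xs)
       = encode \<beta>1 @ (tok PlusTok # encode \<beta>2 @ tok RPar # ys)" by simp
    from "5.IH"(1)[OF this] show ?thesis by simp
  qed (use "5.prems" in \<open>auto simp: encode_var_def\<close>)
next
  case (6 v \<alpha>)
  show ?case
  proof (cases \<beta> rule: encode.cases)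
    case (6 w \<beta>')
    with "6.prems" have "encode_var v @ (encode \<alpha> @ xs) = encode_var w @ (encode \<beta>' @ ys)" by simp
    from encode_var_append_inject[OF this] have
      *: "v = w" "encode \<alpha> @ xs = encode \<beta>' @ ys" by simp_all
    from "6.IH"[OF *(2)] "6.prems" *(1) 6 show ?thesis by simp
  qed (use "6.prems" in \<open>auto simp: encode_var_def\<close>)
next
  case (7 v \<alpha>)
  show ?case
  proof (cases \<beta> rule: encode.cases)
    case (7 w \<beta>')
    with "7.prems" have "encode_var v @ (encode \<alpha> @ xs) = encode_var w @ (encode \<beta>' @ ys)" by simp
    from encode_var_append_inject[OF this] have
      *: "v = w" "encode \<alpha> @ xs = encode \<beta>' @ ys" by simp_all
    from "7.IH"[OF *(2)] "7.prems" *(1) 7 show ?thesis by simp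
  qed (use "7.prems" in \<open>auto simp: encode_var_def\<close>)
qed

lemma inj_encode: "inj encode"
proof (rule injI)
  fix \<alpha> \<beta> :: "'r wqbf"
  assume "encode \<alpha> = encode \<beta>"
  then show "\<alpha> = \<beta>"
    using encode_append_inject[of \<alpha> "[]" \<beta> "[]"] by (simp add: no_bit_def)
qed

lemma SAT_encode: "sum_BF \<alpha> \<Longrightarrow> SAT (encode \<alpha>) = sem \<alpha> {}"
proof -
  assume "sum_BF \<alpha>"
  moreover from this have "(THE \<beta>. sum_BF \<beta> \<and> encode \<beta> = encode \<alpha>) = \<alpha>"
    using inj_encode by (intro the_equality) (auto dest: injD)
  ultimately show ?thesis unfolding SAT_def by auto
qed


section \<open>Semiring Turing machines\<close>

text \<open>
  In a transition \<open>((q, a), (q', a'), d, r)\<close> the weight \<open>r\<close> is either \<open>Inr k\<close> for a semiring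
  value \<open>k\<close> or \<open>Inl\<close> applied to the placeholder letter.
\<close>

type_synonym 'r transition = "(nat \<times> nat) \<times> (nat \<times> nat) \<times> int \<times> (nat + 'r)"

record 'r srtm =
  weights :: "'r set"
  states :: "nat set"
  input_alphabet :: "nat set"
  tape_alphabet :: "nat set"
  start_state :: nat
  placeholder :: nat
  blank :: nat
  transitions :: "'r transition set"

definition srtm :: "'r srtm \<Rightarrow> bool" where
  "srtm M \<longleftrightarrow>
     finite (weights M) \<and> finite (states M) \<and> finite (tape_alphabet M) \<and>
     input_alphabet M \<subseteq> tape_alphabet M \<and>
     start_state M \<in> states M \<and>
     placeholder M \<in> tape_alphabet M - input_alphabet M \<and>
     blank M \<in> tape_alphabet M - input_alphabet M \<and>
     transitions M \<subseteq>
       (states M \<times> tape_alphabet M) \<times> (states M \<times> tape_alphabet M) \<times> {-1, 1} \<times>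
       (Inr ` weights M \<union> {Inl (placeholder M)})"

text \<open>Configurations: state, tape (each cell with its letter and its semiring value), head.\<close>

type_synonym 'r config = "nat \<times> (int \<Rightarrow> nat \<times> 'r) \<times> int"

definition applicable :: "'r srtm \<Rightarrow> 'r config \<Rightarrow> 'r transition set" where
  "applicable M c = (case c of (q, x, n) \<Rightarrow>
     {((p, a), (p', a'), d, r) | p a p' a' d r.
        ((p, a), (p', a'), d, r) \<in> transitions M \<and> p = q \<and> a = fst (x n)})"

fun successor :: "'r transition \<Rightarrow> 'r config \<Rightarrow> 'r config" where
  "successor ((p, a), (p', a'), d, r) (q, x, n) = (p', x(n := (a', snd (x n))), n + d)"

fun wt :: "'r transition \<Rightarrow> 'r config \<Rightarrow> 'r" where
  "wt ((p, a), (p', a'), d, Inr k) (q, x, n) = k"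
| "wt ((p, a), (p', a'), d, Inl s) (q, x, n) = snd (x n)"

definition initial_config :: "'r::semiring_1 srtm \<Rightarrow> 'r word \<Rightarrow> 'r config" where
  "initial_config M s =
     (start_state M,
      \<lambda>i. if 0 \<le> i \<and> i < int (length s)
          then (case s ! nat i of Inl a \<Rightarrow> (a, 0) | Inr k \<Rightarrow> (placeholder M, k))
          else (blank M, 0),
      0)"

definition step :: "'r srtm \<Rightarrow> 'r config rel" where
  "step M = {(c, successor t c) | c t. t \<in> applicable M c}"

definition path_bound :: "'r::semiring_1 srtm \<Rightarrow> ('r word \<Rightarrow> nat) \<Rightarrow> bool" where
  "path_bound M L \<longleftrightarrow>
     (\<forall>s \<in> words_over (input_alphabet M). \<forall>k c. (initial_config M s, c) \<in> step M ^^ k \<longrightarrow> k \<le> L s)"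

definition terminating :: "'r::semiring_1 srtm \<Rightarrow> bool" where
  "terminating M \<longleftrightarrow> (\<exists>L. path_bound M L)"

text \<open>
  The recursion is only meaningful where it terminates; \<open>val_unfold\<close> below shows that
  this covers every configuration reachable by a terminating machine.
\<close>

function val :: "'r::semiring_1 srtm \<Rightarrow> 'r config \<Rightarrow> 'r" where
  "val M c = (if applicable M c = {} then 1
              else (\<Sum>t \<in> applicable M c. wt t c * val M (successor t c)))"
  by pat_completeness auto

definition machine_output :: "'r::semiring_1 srtm \<Rightarrow> 'r word \<Rightarrow> 'r" where
  "machine_output M s = val M (initial_config M s)"

lemma val_dom_if_bounded:
  assumes "\<And>k c'. (c, c') \<in> step M ^^ k \<Longrightarrow> k \<le> b"
  shows "val_dom (M, c)"
  using assms
proof (induction b arbitrary: c)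
  case 0
  have "applicable M c = {}"
  proof (rule ccontr)
    assume "applicable M c \<noteq> {}"
    then obtain t where "t \<in> applicable M c" by blast
    then have "(c, successor t c) \<in> step M" unfolding step_def by blast
    then have "(c, successor t c) \<in> step M ^^ 1" by simp
    from 0[OF this] show False by simp
  qed
  then show ?case by (auto intro: accpI elim: val_rel.cases)
next
  case (Suc b)
  show ?case
  proof (rule accpI)
    fix y assume "val_rel y (M, c)"
    then obtain t where t: "t \<in> applicable M c" "y = (M, successor t c)"
      by (cases rule: val_rel.cases) blast
    have "val_dom (M, successor t c)"
    proof (rule Suc.IH)
      fix k c' assume "(successor t c, c') \<in> step M ^^ k"
      moreover have "(c, successor t c) \<in> step M" using t(1) unfolding step_def by blast
      ultimately have "(c, c') \<in> step M ^^ Suc k" by (intro relpow_Suc_I2)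
      from Suc.prems[OF this] show "k \<le> b" by simp
    qed
    with t(2) show "val_dom y" by simp
  qed
qed

lemma val_unfold:
  assumes "terminating M" "s \<in> words_over (input_alphabet M)"
    and "(initial_config M s, c) \<in> (step M)\<^sup>*"
  shows "val M c = (if applicable M c = {} then 1
                    else (\<Sum>t \<in> applicable M c. wt t c * val M (successor t c)))"
proof -
  obtain L where L: "path_bound M L" using assms(1) by (auto simp: terminating_def)
  obtain j where j: "(initial_config M s, c) \<in> step M ^^ j"
    using assms(3) by (auto simp: rtrancl_power)
  have "val_dom (M, c)"
  proof (rule val_dom_if_bounded[where b = "L s"])
    fix k c' assume "(c, c') \<in> step M ^^ k"
    with j have "(initial_config M s, c') \<in> step M ^^ (j + k)"
      by (auto simp: relpow_add)
    with L assms(2) have "j + k \<le> L s" unfolding path_bound_def by blast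
    then show "k \<le> L s" by simp
  qed
  then show ?thesis by (rule val.psimps)
qed

definition NP_inf :: "nat set \<Rightarrow> ('r::semiring_1 word \<Rightarrow> 'r) \<Rightarrow> bool" where
  "NP_inf \<Sigma>\<^sub>I f \<longleftrightarrow>
     (\<exists>M L (p :: nat poly).
        srtm M \<and> input_alphabet M = \<Sigma>\<^sub>I \<and> path_bound M L \<and>
        (\<forall>s \<in> words_over \<Sigma>\<^sub>I. L s \<le> poly p (length s)) \<and>
        (\<forall>s \<in> words_over \<Sigma>\<^sub>I. f s = machine_output M s))"


section \<open>Polynomial-time computable string functions\<close>

text \<open>
  Deterministic multi-tape Turing machines with two-way infinite tapes. Tape \<open>0\<close> initially holds
  the input; on halting (no action defined), tape \<open>1\<close> holds the output.
  An action consists of the next state and, for each tape, the letter written and the head move.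
\<close>

record 'a tm =
  tm_tapes :: nat
  tm_states :: "nat set"
  tm_alphabet :: "'a set"
  tm_start :: nat
  tm_blank :: 'a
  tm_action :: "nat \<Rightarrow> 'a list \<Rightarrow> (nat \<times> ('a \<times> int) list) option"

definition tm :: "'a tm \<Rightarrow> bool" where
  "tm M \<longleftrightarrow>
     2 \<le> tm_tapes M \<and> finite (tm_states M) \<and> finite (tm_alphabet M) \<and>
     tm_start M \<in> tm_states M \<and> tm_blank M \<in> tm_alphabet M \<and>
     (\<forall>q as q' acts.
        q \<in> tm_states M \<longrightarrow> as \<in> lists (tm_alphabet M) \<longrightarrow> length as = tm_tapes M \<longrightarrow>
        tm_action M q as = Some (q', acts) \<longrightarrow>
          q' \<in> tm_states M \<and> length acts = tm_tapes M \<and>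
          acts \<in> lists (tm_alphabet M \<times> {-1, 0, 1}))"

type_synonym 'a tm_config = "nat \<times> ((int \<Rightarrow> 'a) \<times> int) list"

definition tm_step :: "'a tm \<Rightarrow> 'a tm_config \<Rightarrow> 'a tm_config option" where
  "tm_step M c = (case c of (q, ts) \<Rightarrow>
     map_option
       (\<lambda>(q', acts). (q', map2 (\<lambda>(x, n) (a, d). (x(n := a), n + d)) ts acts))
       (tm_action M q (map (\<lambda>(x, n). x n) ts)))"

definition tape_of :: "'a \<Rightarrow> 'a list \<Rightarrow> int \<Rightarrow> 'a" where
  "tape_of b xs i = (if 0 \<le> i \<and> i < int (length xs) then xs ! nat i else b)"

definition tm_initial :: "'a tm \<Rightarrow> 'a list \<Rightarrow> 'a tm_config" where
  "tm_initial M xs =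
     (tm_start M,
      (tape_of (tm_blank M) xs, 0) # replicate (tm_tapes M - 1) (tape_of (tm_blank M) [], 0))"

definition tm_computes_within :: "'a tm \<Rightarrow> nat \<Rightarrow> 'a list \<Rightarrow> 'a list \<Rightarrow> bool" where
  "tm_computes_within M t xs ys \<longleftrightarrow>
     (\<exists>k \<le> t. \<exists>q ts.
        (tm_initial M xs, (q, ts)) \<in> {(c, c'). tm_step M c = Some c'} ^^ k \<and>
        tm_step M (q, ts) = None \<and>
        fst (ts ! 1) = tape_of (tm_blank M) ys)"

text \<open>\<open>F\<close> maps the words in \<open>D\<close> over the alphabet \<open>A\<close> to words over \<open>B\<close>.\<close>

definition polytime_computable ::
    "'a set \<Rightarrow> 'a set \<Rightarrow> 'a list set \<Rightarrow> ('a list \<Rightarrow> 'a list) \<Rightarrow> bool" where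
  "polytime_computable A B D F \<longleftrightarrow>
     (\<exists>M (p :: nat poly).
        tm M \<and> A \<union> B \<subseteq> tm_alphabet M \<and> tm_blank M \<notin> A \<union> B \<and>
        (\<forall>xs \<in> D. tm_computes_within M (poly p (length xs)) xs (F xs)))"


section \<open>Karp s-reductions\<close>

datatype sletter = Letter nat | S_sym | V_sym | E_sym

definition salphabet :: "nat set \<Rightarrow> sletter set" where
  "salphabet \<Sigma> = Letter ` \<Sigma> \<union> {S_sym, V_sym, E_sym}"

text \<open>The words in \<open>(\<Sigma> \<union> {S V\<^sup>n E | n})\<^sup>*\<close>, as plain strings over \<open>\<Sigma> \<union> {S, V, E}\<close>.\<close>

definition swords :: "nat set \<Rightarrow> sletter list set" where
  "swords \<Sigma> = concat ` lists
     ({[Letter a] | a. a \<in> \<Sigma>} \<union> {S_sym # replicate n V_sym @ [E_sym] | n. True})"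

text \<open>
  In a word of \<^const>\<open>swords\<close>, \<open>V_sym\<close> and \<open>E_sym\<close> occur only inside a block opened by \<open>S_sym\<close>,
  which is where such a block is replaced; see \<open>ssubst_block\<close>.
\<close>

fun ssubst :: "(nat \<Rightarrow> 'r) \<Rightarrow> sletter list \<Rightarrow> 'r word" where
  "ssubst \<sigma> [] = []"
| "ssubst \<sigma> (Letter a # xs) = Inl a # ssubst \<sigma> xs"
| "ssubst \<sigma> (S_sym # xs) = Inr (\<sigma> (length (takeWhile (\<lambda>c. c = V_sym) xs))) # ssubst \<sigma> xs"
| "ssubst \<sigma> (V_sym # xs) = ssubst \<sigma> xs"
| "ssubst \<sigma> (E_sym # xs) = ssubst \<sigma> xs"

lemma ssubst_block:
  "ssubst \<sigma> (S_sym # replicate n V_sym @ E_sym # xs) = Inr (\<sigma> n) # ssubst \<sigma> xs"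
proof -
  have "length (takeWhile (\<lambda>c. c = V_sym) (replicate n V_sym @ E_sym # xs)) = n"
    by (induction n) auto
  moreover have "ssubst \<sigma> (replicate n V_sym @ E_sym # xs) = ssubst \<sigma> xs"
    by (induction n) auto
  ultimately show ?thesis by simp
qed

definition karp_s_reducible ::
    "nat set \<Rightarrow> ('r word \<Rightarrow> 'r) \<Rightarrow> nat set \<Rightarrow> ('r word \<Rightarrow> 'r) \<Rightarrow> bool" where
  "karp_s_reducible \<Sigma>\<^sub>1 f\<^sub>1 \<Sigma>\<^sub>2 f\<^sub>2 \<longleftrightarrow>
     (\<exists>T (rs :: 'r list).
        T ` swords \<Sigma>\<^sub>1 \<subseteq> swords \<Sigma>\<^sub>2 \<and>
        polytime_computable (salphabet \<Sigma>\<^sub>1) (salphabet \<Sigma>\<^sub>2) (swords \<Sigma>\<^sub>1) T \<and>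
        distinct rs \<and>
        (\<forall>x \<in> swords \<Sigma>\<^sub>1. \<forall>\<sigma> :: nat \<Rightarrow> 'r.
           (\<forall>i < length rs. \<sigma> i = rs ! i) \<longrightarrow> f\<^sub>1 (ssubst \<sigma> x) = f\<^sub>2 (ssubst \<sigma> (T x))))"

end

theory Submission
  imports Defs "HOL-Library.Countable"
begin

text \<open>
  \<^bold>\<open>Membership.\<close> A machine reads the formula once, from left to right, and multiplies the values that
  it meets. At a sum quantifier it branches over the truth value of the variable. At an opening
  parenthesis it guesses the connective, and for a sum also which operand contributes to the branch;
  the other operand is only traversed, without weights. Guesses are kept as marks on the quantifiers
  and parentheses whose scopes are open. At a literal the machine walks to the left until it finds the
  innermost binder with the same name, which it compares symbol by symbol. By distributivity the
  sum over all branches is the semantics of the formula: reading an evaluated operand multiplies the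
  value of what follows by the semantics of the operand (\<open>operand_evals\<close>). Unbound variables and
  strings that are not formulas lead to factors \<open>0\<close> in all branches (\<open>operand_fails\<close>).

  \<^bold>\<open>Hardness.\<close> Let a machine have running time less than \<open>D\<close>, so that it only visits the cells from
  \<open>-D\<close> to \<open>D\<close>. A configuration is described by Boolean variables for the state, for the position of
  the head and for the letters of the cells, of which there are two alternating copies \<open>X\<close> and \<open>Y\<close>. The
  formulas \<open>\<Phi>\<^sub>m\<^sub>+\<^sub>1(X) = \<Oplus>Y (Step(X, Y) \<otimes> \<Phi>\<^sub>m(Y))\<close> and \<open>\<Oplus>X (Init(X) \<otimes> \<Phi>\<^sub>2\<^sub>D(X))\<close> compute the value. Here
  \<open>Step\<close> is a sum over the transitions \<open>t\<close> of products over the cells, which equal the weight of \<open>t\<close> if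
  \<open>t\<close> is applicable to the configuration \<open>X\<close> and \<open>Y\<close> is its successor, and \<open>0\<close> otherwise
  (\<open>step_segs_sem\<close>). Only one assignment of a block of sum quantifiers survives, so the block performs
  the recursion of the value (\<open>run_step\<close>, \<open>machine_formula_sem\<close>). Halting configurations get a loop
  of weight \<open>1\<close>, so that too many stages do no harm. A value on the input tape enters as the constant
  with the same index.

  \<^bold>\<open>Polynomial time.\<close> The formula is a concatenation of rows, which list the cells of the tape. With
  indices written in unary inside the names of the variables, a row is emitted by a loop over the
  input and over \<open>D\<close> further cells. Such loops are written in a small language with counters, which is
  compiled to multi-tape machines with one tape per counter (\<open>compiled_computes\<close>). The bound \<open>D\<close>, a
  polynomial in the length of the input, is computed by Horner's rule (\<open>runs_poly\<close>), and a calculus of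
  programs that emit strings in polynomial time (\<open>emits\<close>) assembles the rows (\<open>emits_machine\<close>).
\<close>


section \<open>Values of runs and of formulas\<close>

text \<open>
  \<open>evals M k c v\<close>: every run from \<open>c\<close> has at most \<open>k\<close> steps, and \<open>c\<close> has the value \<open>v\<close>. In contrast to
  \<^const>\<open>val\<close>, which is specified only where the recursion terminates, this relation gives value and time
  bound together and comes with an induction rule.
\<close>

inductive evals :: "'r::semiring_1 srtm \<Rightarrow> nat \<Rightarrow> 'r config \<Rightarrow> 'r \<Rightarrow> bool" for M where
  halt: "applicable M c = {} \<Longrightarrow> evals M k c 1"
| step: "applicable M c \<noteq> {} \<Longrightarrow> (\<And>t. t \<in> applicable M c \<Longrightarrow> evals M k (successor t c) (V t)) \<Longrightarrow>
         evals M (Suc k) c (\<Sum>t\<in>applicable M c. wt t c * V t)"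

lemma evals_mono: "evals M k c v \<Longrightarrow> k \<le> k' \<Longrightarrow> evals M k' c v"
proof (induction arbitrary: k' rule: evals.induct)
  case (halt c k)
  then show ?case by (simp add: evals.halt)
next
  case (step c k V)
  then obtain k'' where "k' = Suc k''" "k \<le> k''" by (cases k') auto
  with step show ?case by (auto intro: evals.step)
qed

lemma evals_bounded: "evals M k c v \<Longrightarrow> (c, c') \<in> step M ^^ j \<Longrightarrow> j \<le> k"
proof (induction arbitrary: j rule: evals.induct)
  case (halt c k)
  show ?case
  proof (cases j)
    case (Suc i)
    with halt(2) obtain d where "(c, d) \<in> step M" by (meson relpow_Suc_D2)
    with halt(1) show ?thesis by (auto simp: step_def)
  qed simp
next
  case (step c k V)
  show ?case
  proof (cases j)
    case (Suc i)
    with step.prems obtain d where "(c, d) \<in> Defs.step M" "(d, c') \<in> Defs.step M ^^ i"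
      by (meson relpow_Suc_D2)
    then show ?thesis using step.IH Suc by (auto simp: step_def)
  qed simp
qed

lemma evals_val:
  assumes "evals M k c v"
  shows "val M c = v"
proof -
  have "val_dom (M, c) \<and> val M c = v"
    using assms
  proof (induction rule: evals.induct)
    case (halt c k)
    then have "val_dom (M, c)" by (auto intro: accpI elim: val_rel.cases)
    with halt show ?case by (simp add: val.psimps)
  next
    case (step c k V)
    have "val_dom (M, c)"
      by (rule accpI) (use step in \<open>auto elim!: val_rel.cases\<close>)
    with step show ?case by (subst val.psimps) simp_all
  qed
  then show ?thesis ..
qed

lemma evals_exists:
  assumes "\<And>j c'. (c, c') \<in> step M ^^ j \<Longrightarrow> j \<le> k"
  shows "\<exists>v. evals M k c v"
  using assms
proof (induction k arbitrary: c)
  case 0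
  have "applicable M c = {}"
  proof (rule ccontr)
    assume "applicable M c \<noteq> {}"
    then obtain t where "t \<in> applicable M c" by blast
    then have "(c, successor t c) \<in> step M" unfolding step_def by blast
    then have "(c, successor t c) \<in> step M ^^ 1" by simp
    from 0[OF this] show False by simp
  qed
  then show ?case by (blast intro: evals.halt)
next
  case (Suc k)
  show ?case
  proof (cases "applicable M c = {}")
    case True
    then show ?thesis by (blast intro: evals.halt)
  next
    case False
    have "\<exists>v. evals M k (successor t c) v" if t: "t \<in> applicable M c" for t
    proof (rule Suc.IH)
      fix j c' assume "(successor t c, c') \<in> step M ^^ j"
      moreover have "(c, successor t c) \<in> step M" using t unfolding step_def by blast
      ultimately have "(c, c') \<in> step M ^^ Suc j" by (intro relpow_Suc_I2)
      from Suc.prems[OF this] show "j \<le> k" by simp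
    qed
    then obtain V where "\<And>t. t \<in> applicable M c \<Longrightarrow> evals M k (successor t c) (V t)" by metis
    from evals.step[OF False this] show ?thesis by blast
  qed
qed

text \<open>
  The semantics under a total assignment. It agrees with \<^const>\<open>sem\<close> wherever the interpretation
  contains exactly one literal of each free variable; in particular, every assignment computes the
  value of a closed formula.
\<close>

fun esem :: "'r::semiring_1 wqbf \<Rightarrow> (nat \<Rightarrow> bool) \<Rightarrow> 'r" where
  "esem (Const k) A = k"
| "esem (Lit (PosLit v)) A = (if A v then 1 else 0)"
| "esem (Lit (NegLit v)) A = (if A v then 0 else 1)"
| "esem (Plus \<alpha> \<beta>) A = esem \<alpha> A + esem \<beta> A"
| "esem (Times \<alpha> \<beta>) A = esem \<alpha> A * esem \<beta> A"
| "esem (SumQ v \<alpha>) A = esem \<alpha> (A(v := True)) + esem \<alpha> (A(v := False))"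
| "esem (ProdQ v \<alpha>) A = esem \<alpha> (A(v := True)) * esem \<alpha> (A(v := False))"

lemma sem_eq_esem:
  "\<forall>v\<in>free_vars \<alpha>. (PosLit v \<in> I \<longleftrightarrow> A v) \<and> (NegLit v \<in> I \<longleftrightarrow> \<not> A v) \<Longrightarrow> sem \<alpha> I = esem \<alpha> A"
proof (induction \<alpha> arbitrary: I A)
  case (Lit l)
  then show ?case by (cases l) auto
next
  case (SumQ v \<alpha>)
  have "sem \<alpha> (set_lit (PosLit v) I) = esem \<alpha> (A(v := True))"
       "sem \<alpha> (set_lit (NegLit v) I) = esem \<alpha> (A(v := False))"
    by (rule SumQ.IH; use SumQ.prems in auto)+
  then show ?case by simp
next
  case (ProdQ v \<alpha>)
  have "sem \<alpha> (set_lit (PosLit v) I) = esem \<alpha> (A(v := True))"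
       "sem \<alpha> (set_lit (NegLit v) I) = esem \<alpha> (A(v := False))"
    by (rule ProdQ.IH; use ProdQ.prems in auto)+
  then show ?case by simp
next
  case (Plus \<alpha> \<beta>)
  from Plus.prems have "sem \<alpha> I = esem \<alpha> A" "sem \<beta> I = esem \<beta> A"
    by (auto intro: Plus.IH)
  then show ?case by simp
next
  case (Times \<alpha> \<beta>)
  from Times.prems have "sem \<alpha> I = esem \<alpha> A" "sem \<beta> I = esem \<beta> A"
    by (auto intro: Times.IH)
  then show ?case by simp
qed simp

lemma sem_closed: "free_vars \<alpha> = {} \<Longrightarrow> sem \<alpha> I = esem \<alpha> A"
  by (rule sem_eq_esem) simp

lemma binary_append_bit: "0 < n \<Longrightarrow> binary (2 * n + (if b then 1 else 0)) = binary n @ [if b then Bit1 else Bit0]"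
  by (subst binary.simps) auto

lemma binary_Bit1:
  assumes "set bs \<subseteq> {Bit0, Bit1}"
  shows "\<exists>n>0. binary n = Bit1 # bs"
  using assms
proof (induction bs rule: rev_induct)
  case Nil
  then show ?case by (intro exI[of _ 1]) (simp add: binary.simps)
next
  case (snoc b bs)
  then obtain n where n: "n > 0" "binary n = Bit1 # bs" by auto
  have "b = (if b = Bit1 then Bit1 else Bit0)" using snoc.prems by auto
  with n binary_append_bit[OF n(1), of "b = Bit1"]
  have "binary (2 * n + (if b = Bit1 then 1 else 0)) = Bit1 # bs @ [b]" by simp
  with n show ?case by (intro exI[of _ "2 * n + (if b = Bit1 then 1 else 0)"]) auto
qed


section \<open>A machine that evaluates formulas: cells, states, transitions\<close>

text \<open>
  A cell of the machine consists of the symbol of the input (\<open>Val\<close> for a semiring value), of a mark and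
  of two flags. The mark \<open>Binder b\<close> on a sum quantifier is the guessed truth value of its variable.
  The mark \<open>Paren k d\<close> on an opening parenthesis is the guess \<open>k\<close>, and \<open>d\<close> tells whether the right
  operand has been entered. \<open>KTimes\<close> stands for a product, \<open>KLeft\<close> and \<open>KRight\<close> for a sum of which only the
  named operand contributes, and \<open>KSkip\<close> for a parenthesis inside an operand that does not contribute.
  The first flag marks a position on the right to which the head has to come back, the second flag a
  position inside the name of a binder.

  In the states, \<open>md\<close> tells whether the current formula is evaluated or only skipped, and \<open>s\<close> is the
  sign of the current literal. \<open>Operand\<close> expects the first symbol of a formula. The states
  \<open>BinderVar\<close> to \<open>BinderEnd\<close> read the name of a quantified variable; a name that begins with the bit
  \<open>0\<close> consists of this bit only, whence the two last states. \<open>Seek\<close> walks to the left to the next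
  binder; the states up to \<open>GotoB\<close> compare its name with that of the literal. After a mismatch
  \<open>Back\<close>, \<open>Drop\<close> and \<open>Skip\<close> clean up and lead to the next binder; after a match, \<open>Match\<close>, \<open>Found\<close> and
  \<open>Return\<close> test the truth value and go to the end of the literal. \<open>Done\<close> is reached behind a formula.
  \<open>Close\<close> walks to the left, unmarks the binders whose scopes end, and stops at the innermost open
  parenthesis or at the left end of the input; \<open>Resume\<close> carries the guess found there back to the
  right.
\<close>

datatype base = Tok token | Val | Blank
datatype kind = KTimes | KLeft | KRight | KSkip
datatype mark = Unmarked | Binder bool | Paren kind bool
datatype cell = Cell base mark bool bool
datatype state =
    Operand bool | Negated bool
  | BinderVar bool | BinderBit bool | BinderBits bool | BinderEnd bool
  | Seek bool bool | AtVar bool bool | ReadB bool bool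
  | GotoA "bool option" bool bool | ReadA "bool option" bool bool
  | GotoB bool bool | Back bool bool | Drop bool bool | Skip bool bool
  | Match bool bool | Found bool bool | Return
  | Done | Close | Resume "(kind \<times> bool) option" | Halted
datatype weight = WZero | WOne | WVal

instance token :: countable by countable_datatype
instance base :: countable by countable_datatype
instance kind :: countable by countable_datatype
instance mark :: countable by countable_datatype
instance cell :: countable by countable_datatype
instance state :: countable by countable_datatype

instance token :: finite
proof
  have eq: "(UNIV :: token set) = {LPar, RPar, PlusTok, TimesTok, SumTok, ProdTok, NegTok, VarTok, Bit0, Bit1}"
    by (auto intro: token.exhaust)
  show "finite (UNIV :: token set)" unfolding eq by simp
qed

instance base :: finite
proof
  have eq: "(UNIV :: base set) = range Tok \<union> {Val, Blank}"
    using base.exhaust by auto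
  show "finite (UNIV :: base set)" unfolding eq by simp
qed

instance kind :: finite
proof
  have eq: "(UNIV :: kind set) = {KTimes, KLeft, KRight, KSkip}"
    by (auto intro: kind.exhaust)
  show "finite (UNIV :: kind set)" unfolding eq by simp
qed

instance mark :: finite
proof
  have eq: "(UNIV :: mark set) = range Binder \<union> range (case_prod Paren) \<union> {Unmarked}"
    by (auto, metis mark.exhaust case_prod_conv range_eqI)
  show "finite (UNIV :: mark set)" unfolding eq by simp
qed

instance cell :: finite
proof
  have eq: "(UNIV :: cell set) = range (\<lambda>(b, m, p, q). Cell b m p q)"
    by (auto, metis cell.exhaust case_prod_conv range_eqI)
  show "finite (UNIV :: cell set)" unfolding eq by simp
qed

instance state :: finite
proof
  have eq: "(UNIV :: state set) = range Operand \<union> range Negated \<union> range BinderVar \<union> range BinderBit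
      \<union> range BinderBits \<union> range BinderEnd \<union> range (case_prod Seek) \<union> range (case_prod AtVar)
      \<union> range (case_prod ReadB) \<union> range (\<lambda>(e, s, d). GotoA e s d) \<union> range (\<lambda>(e, s, d). ReadA e s d)
      \<union> range (case_prod GotoB) \<union> range (case_prod Back) \<union> range (case_prod Drop)
      \<union> range (case_prod Skip) \<union> range (case_prod Match) \<union> range (case_prod Found)
      \<union> range Resume \<union> {Return, Done, Close, Halted}" (is "_ = ?R")
  proof -
    have "x \<in> ?R" for x by (cases x) (auto simp: image_iff)
    then show ?thesis by blast
  qed
  show "finite (UNIV :: state set)" unfolding eq by simp
qed

text \<open>
  The next state, the new cell, the movement of the head, and the weight.
\<close>

type_synonym action = "state \<times> cell \<times> int \<times> weight"

text \<open>
  A step of weight \<open>0\<close>, which makes the branch worthless.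
\<close>

definition die :: "cell \<Rightarrow> action list" where
  "die c = [(Halted, c, 1, WZero)]"

fun bit_of :: "base \<Rightarrow> bool option" where
  "bit_of (Tok Bit0) = Some False"
| "bit_of (Tok Bit1) = Some True"
| "bit_of _ = None"

text \<open>
  The choices on the first symbol of a formula. A skipped formula contributes one branch only, so
  nothing is guessed in it: the value of a skipped variable is immaterial and taken to be true.
\<close>

definition operand :: "bool \<Rightarrow> base \<Rightarrow> mark \<Rightarrow> bool \<Rightarrow> bool \<Rightarrow> action list" where
  "operand md b m p q =
     (case b of
        Val \<Rightarrow> [(Done, Cell b m p q, 1, if md then WVal else WOne)]
      | Blank \<Rightarrow> die (Cell b m p q)
      | Tok t \<Rightarrow>
         (if t = VarTok then [(Seek True md, Cell b m True q, -1, WOne)]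
          else if t = NegTok then [(Negated md, Cell b m p q, 1, WOne)]
          else if t = LPar then
            (if md then
               [(Operand True, Cell b (Paren KTimes False) p q, 1, WOne),
                (Operand True, Cell b (Paren KLeft False) p q, 1, WOne),
                (Operand False, Cell b (Paren KRight False) p q, 1, WOne)]
             else [(Operand False, Cell b (Paren KSkip False) p q, 1, WOne)])
          else if t = SumTok then
            (if md then
               [(BinderVar True, Cell b (Binder True) p q, 1, WOne),
                (BinderVar True, Cell b (Binder False) p q, 1, WOne)]
             else [(BinderVar False, Cell b (Binder True) p q, 1, WOne)])
          else die (Cell b m p q)))"

text \<open>
  The guess \<open>k\<close> admits the connective \<open>b\<close>.
\<close>

definition connective :: "kind \<Rightarrow> base \<Rightarrow> bool" where
  "connective k b \<longleftrightarrow>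
     b = Tok TimesTok \<and> (k = KTimes \<or> k = KSkip) \<or> b = Tok PlusTok \<and> k \<noteq> KTimes"

fun act :: "state \<Rightarrow> cell \<Rightarrow> action list" where
  "act (Operand md) (Cell b m p q) = operand md b m p q"
| "act (Negated md) (Cell b m p q) =
     (if b = Tok VarTok then [(Seek False md, Cell b m True q, -1, WOne)] else die (Cell b m p q))"
| "act (BinderVar md) (Cell b m p q) =
     (if b = Tok VarTok then [(BinderBit md, Cell b m p q, 1, WOne)] else die (Cell b m p q))"
| "act (BinderBit md) (Cell b m p q) =
     (case bit_of b of
        None \<Rightarrow> die (Cell b m p q)
      | Some False \<Rightarrow> [(BinderEnd md, Cell b m p q, 1, WOne)]
      | Some True \<Rightarrow> [(BinderBits md, Cell b m p q, 1, WOne)])"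
| "act (BinderBits md) (Cell b m p q) =
     (if bit_of b = None then operand md b m p q else [(BinderBits md, Cell b m p q, 1, WOne)])"
| "act (BinderEnd md) (Cell b m p q) =
     (if bit_of b = None then operand md b m p q else die (Cell b m p q))"
| "act (Seek s md) (Cell b m p q) =
     (case m of
        Binder _ \<Rightarrow> [(AtVar s md, Cell b m p q, 1, WOne)]
      | _ \<Rightarrow> if b = Blank then die (Cell b m p q) else [(Seek s md, Cell b m p q, -1, WOne)])"
| "act (AtVar s md) (Cell b m p q) = [(ReadB s md, Cell b m p q, 1, WOne)]"
| "act (ReadB s md) (Cell b m p q) = [(GotoA (bit_of b) s md, Cell b m p True, 1, WOne)]"
| "act (GotoA e s md) (Cell b m p q) =
     (if p then [(ReadA e s md, Cell b m False q, 1, WOne)] else [(GotoA e s md, Cell b m p q, 1, WOne)])"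
| "act (ReadA e s md) (Cell b m p q) =
     (if bit_of b = e
      then [(if e = None then Match s md else GotoB s md, Cell b m True q, -1, WOne)]
      else [(Back s md, Cell b m p q, -1, WOne)])"
| "act (GotoB s md) (Cell b m p q) =
     (if q then [(ReadB s md, Cell b m p False, 1, WOne)] else [(GotoB s md, Cell b m p q, -1, WOne)])"
| "act (Back s md) (Cell b m p q) =
     (if bit_of b = None
      then [(if q then Skip s md else Drop s md, Cell b m True False, -1, WOne)]
      else [(Back s md, Cell b m p q, -1, WOne)])"
| "act (Drop s md) (Cell b m p q) =
     (if q then [(Skip s md, Cell b m p False, -1, WOne)] else [(Drop s md, Cell b m p q, -1, WOne)])"
| "act (Skip s md) (Cell b m p q) =
     (case m of Binder _ \<Rightarrow> [(Seek s md, Cell b m p q, -1, WOne)]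
      | _ \<Rightarrow> [(Skip s md, Cell b m p q, -1, WOne)])"
| "act (Match s md) (Cell b m p q) =
     (if q then [(Found s md, Cell b m p False, -1, WOne)] else [(Match s md, Cell b m p q, -1, WOne)])"
| "act (Found s md) (Cell b m p q) =
     (case m of
        Binder v \<Rightarrow> if md \<and> v \<noteq> s then die (Cell b m p q) else [(Return, Cell b m p q, 1, WOne)]
      | _ \<Rightarrow> [(Found s md, Cell b m p q, -1, WOne)])"
| "act Return (Cell b m p q) =
     (if p then [(Close, Cell b m p q, -1, WOne)] else [(Return, Cell b m p q, 1, WOne)])"
| "act Done (Cell b m p q) = [(Close, Cell b m True q, -1, WOne)]"
| "act Close (Cell b m p q) =
     (case m of
        Binder _ \<Rightarrow> [(Close, Cell b Unmarked p q, -1, WOne)]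
      | Paren k side \<Rightarrow>
          [(Resume (Some (k, side)), Cell b (if side then Unmarked else Paren k True) p q, 1, WOne)]
      | Unmarked \<Rightarrow> if b = Blank then [(Resume None, Cell b m p q, 1, WOne)]
                    else [(Close, Cell b m p q, -1, WOne)])"
| "act (Resume tp) (Cell b m p q) =
     (if \<not> p then [(Resume tp, Cell b m p q, 1, WOne)]
      else case tp of
        None \<Rightarrow> if b = Blank then [(Halted, Cell b m False q, 1, WOne)] else die (Cell b m False q)
      | Some (k, False) \<Rightarrow>
          if connective k b then [(Operand (k = KTimes \<or> k = KRight), Cell b m False q, 1, WOne)]
          else die (Cell b m False q)
      | Some (k, True) \<Rightarrow>
          if b = Tok RPar then [(Done, Cell b m False q, 1, WOne)] else die (Cell b m False q))"
| "act Halted (Cell b m p q) = []"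

lemma distinct_act: "distinct (act q c)"
  by (cases "(q, c)" rule: act.cases)
     (auto simp: operand_def die_def split: base.split option.split bool.split mark.split)

lemma act_dir: "(q', c', d, r) \<in> set (act q c) \<Longrightarrow> d \<in> {-1, 1}"
  by (cases "(q, c)" rule: act.cases)
     (auto simp: operand_def die_def split: base.splits option.splits bool.splits mark.splits if_splits)

text \<open>
  Unmarked cells without flags become the letters of the input alphabet, the placeholder \<open>10\<close> and the
  blank \<open>11\<close>, so that an initial tape consists of codes of cells.
\<close>

fun enc_base :: "base \<Rightarrow> nat" where
  "enc_base (Tok t) = letter t" | "enc_base Val = 10" | "enc_base Blank = 11"

fun enc_cell :: "cell \<Rightarrow> nat" where
  "enc_cell (Cell b m p q) =
     (if m = Unmarked \<and> \<not> p \<and> \<not> q then enc_base b else 12 + to_nat (Cell b m p q))"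

fun enc_weight :: "weight \<Rightarrow> nat + 'r::semiring_1" where
  "enc_weight WZero = Inr 0" | "enc_weight WOne = Inr 1" | "enc_weight WVal = Inl 10"

lemma letter_less: "letter t < 10"
  by (cases t) auto

lemma letter_neq [simp]: "letter t \<noteq> 10" "letter t \<noteq> 11" "10 \<noteq> letter t" "11 \<noteq> letter t"
  by (cases t; simp)+

lemma enc_base_less: "enc_base b < 12"
  using letter_less by (cases b) (auto intro: less_trans)

lemma inj_enc_base: "enc_base b = enc_base b' \<Longrightarrow> b = b'"
  by (cases b; cases b') auto

lemma inj_enc_cell: "enc_cell c = enc_cell c' \<longleftrightarrow> c = c'"
proof
  assume *: "enc_cell c = enc_cell c'"
  obtain b m p q b' m' p' q' where c: "c = Cell b m p q" "c' = Cell b' m' p' q'"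
    by (metis cell.exhaust)
  show "c = c'"
    using * enc_base_less[of b] enc_base_less[of b']
    by (auto simp: c split: if_splits dest: inj_enc_base)
qed simp

lemma inj_enc_weight: "(enc_weight r :: nat + 'r::semiring_1) = enc_weight r' \<longleftrightarrow> r = r'"
  by (cases r; cases r') auto

definition sat_machine :: "'r::semiring_1 srtm" where
  "sat_machine =
     \<lparr>weights = {0, 1}, states = range (to_nat :: state \<Rightarrow> nat), input_alphabet = sat_alphabet,
      tape_alphabet = range enc_cell, start_state = to_nat (Operand True),
      placeholder = 10, blank = 11,
      transitions = {((to_nat q, enc_cell c), (to_nat q', enc_cell c'), d, enc_weight r) | q c q' c' d r.
                       (q', c', d, r) \<in> set (act q c)}\<rparr>"

lemma srtm_sat_machine: "srtm (sat_machine :: 'r::semiring_1 srtm)"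
proof -
  have cell: "enc_base b \<in> range enc_cell" for b
    by (rule range_eqI[of _ _ "Cell b Unmarked False False"]) simp
  have letters: "letter t \<in> range enc_cell" "10 \<in> range enc_cell" "11 \<in> range enc_cell" for t
    using cell[of "Tok t"] cell[of Val] cell[of Blank] by (simp_all only: enc_base.simps)
  have weight: "(enc_weight r :: nat + 'r) \<in> Inr ` {0, 1} \<union> {Inl 10}" for r
    by (cases r) auto
  show ?thesis
    unfolding srtm_def sat_machine_def srtm.simps
  proof (intro conjI)
    show "{((to_nat q, enc_cell c), (to_nat q', enc_cell c'), d, enc_weight r :: nat + 'r) | q c q' c' d r.
            (q', c', d, r) \<in> set (act q c)}
        \<subseteq> (range (to_nat :: state \<Rightarrow> nat) \<times> range enc_cell) \<times> (range (to_nat :: state \<Rightarrow> nat) \<times> range enc_cell) \<times>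
          {-1, 1} \<times> (Inr ` {0, 1} \<union> {Inl 10})"
    proof (rule subsetI, elim CollectE exE conjE)
      fix t :: "'r transition" and q c q' c' d r
      assume "t = ((to_nat (q :: state), enc_cell c), (to_nat q', enc_cell c'), d, enc_weight r)"
        and "(q', c', d, r) \<in> set (act q c)"
      then show "t \<in> (range (to_nat :: state \<Rightarrow> nat) \<times> range enc_cell) \<times> (range (to_nat :: state \<Rightarrow> nat) \<times> range enc_cell) \<times>
          {-1, 1} \<times> (Inr ` {0, 1} \<union> {Inl 10})"
        using act_dir[of q' c' d r q c] weight[of r] by auto
    qed
  qed (use letters in \<open>auto simp: sat_alphabet_def\<close>)
qed

text \<open>
  The configuration with state \<open>q\<close>, cells \<open>y\<close>, semiring values \<open>vs\<close> and head position \<open>n\<close>.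
\<close>

definition gcfg :: "(int \<Rightarrow> 'r) \<Rightarrow> state \<Rightarrow> (int \<Rightarrow> cell) \<Rightarrow> int \<Rightarrow> 'r config" where
  "gcfg vs q y n = (to_nat q, \<lambda>i. (enc_cell (y i), vs i), n)"

fun wval :: "weight \<Rightarrow> 'r \<Rightarrow> 'r::semiring_1" where
  "wval WZero k = 0" | "wval WOne k = 1" | "wval WVal k = k"

lemma applicable_gcfg:
  "applicable sat_machine (gcfg vs q y n) =
     (\<lambda>(q', c', d, r). ((to_nat q, enc_cell (y n)), (to_nat q', enc_cell c'), d, enc_weight r)) ` set (act q (y n))"
proof -
  have "t \<in> applicable sat_machine (gcfg vs q y n) \<longleftrightarrow>
      (\<exists>q' c' d r. t = ((to_nat q, enc_cell (y n)), (to_nat q', enc_cell c'), d, enc_weight r)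
        \<and> (q', c', d, r) \<in> set (act q (y n)))" for t
    unfolding applicable_def sat_machine_def gcfg_def srtm.simps prod.case fst_conv
    by (auto simp: inj_enc_cell)
  then show ?thesis by (force simp: image_iff)
qed

lemma evals_gcfg:
  assumes "act q (y n) \<noteq> []"
    and "\<And>q' c' d r. (q', c', d, r) \<in> set (act q (y n)) \<Longrightarrow>
           evals sat_machine k (gcfg vs q' (y(n := c')) (n + d)) (V (q', c', d, r))"
  shows "evals sat_machine (Suc k) (gcfg vs q y n)
           (\<Sum>(q', c', d, r) \<leftarrow> act q (y n). wval r (vs n) * V (q', c', d, r))"
proof -
  let ?c = "gcfg vs q y n"
  let ?f = "\<lambda>(q', c', d, r). ((to_nat q, enc_cell (y n)), (to_nat q', enc_cell c'), d, enc_weight r :: nat + 'a)"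
  have inj: "inj_on ?f (set (act q (y n)))"
    by (auto simp: inj_on_def inj_enc_cell inj_enc_weight)
  \<comment> \<open>Distinct actions have distinct codes, so the value can be carried over to the transitions.\<close>
  let ?V = "\<lambda>t. V (the_inv_into (set (act q (y n))) ?f t)"
  have succ: "successor (?f (q', c', d, r)) ?c = gcfg vs q' (y(n := c')) (n + d)" for q' c' d r
    by (auto simp: gcfg_def)
  have "evals sat_machine (Suc k) ?c (\<Sum>t\<in>applicable sat_machine ?c. wt t ?c * ?V t)"
  proof (rule evals.step)
    show "applicable sat_machine ?c \<noteq> {}"
      using assms(1) by (simp add: applicable_gcfg)
    fix t assume "t \<in> applicable sat_machine ?c"
    then obtain x where x: "x \<in> set (act q (y n))" "t = ?f x"
      unfolding applicable_gcfg by blast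
    obtain q' c' d r where x': "x = (q', c', d, r)" by (metis prod_cases4)
    have V: "?V t = V x" using x by (simp only: the_inv_into_f_f[OF inj])
    show "evals sat_machine k (successor t ?c) (?V t)"
      unfolding V unfolding x(2) x' succ using assms(2) x(1) x' by simp
  qed
  also have "(\<Sum>t\<in>applicable sat_machine ?c. wt t ?c * ?V t) =
      (\<Sum>x\<in>set (act q (y n)). wt (?f x) ?c * ?V (?f x))"
    unfolding applicable_gcfg by (rule sum.reindex[OF inj, unfolded o_def])
  also have "\<dots> = (\<Sum>(q', c', d, r)\<in>set (act q (y n)). wval r (vs n) * V (q', c', d, r))"
  proof (rule sum.cong[OF refl])
    fix x assume x: "x \<in> set (act q (y n))"
    obtain q' c' d r where x': "x = (q', c', d, r)" by (metis prod_cases4)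
    have "wt (?f x) ?c = wval r (vs n)"
      by (cases r) (simp_all add: x' gcfg_def)
    moreover have "?V (?f x) = V x" using x by (simp only: the_inv_into_f_f[OF inj])
    ultimately show "wt (?f x) ?c * ?V (?f x) = (case x of (q', c', d, r) \<Rightarrow> wval r (vs n) * V (q', c', d, r))"
      by (simp add: x')
  qed
  also have "\<dots> = (\<Sum>(q', c', d, r) \<leftarrow> act q (y n). wval r (vs n) * V (q', c', d, r))"
    using distinct_act by (simp add: sum_list_distinct_conv_sum_set)
  finally show ?thesis .
qed

lemma evals_halted: "act q (y n) = [] \<Longrightarrow> evals sat_machine k (gcfg vs q y n) 1"
  by (rule evals.halt) (simp add: applicable_gcfg)

lemma evals_die:
  assumes "act q (y n) = die c"
  shows "evals sat_machine (Suc k) (gcfg vs q y n) 0"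
proof -
  have "act Halted x = []" for x by (cases x) simp
  then have "evals sat_machine k (gcfg vs Halted y' n') 1" for y' n'
    by (rule evals_halted)
  with evals_gcfg[of q y n k vs "\<lambda>_. 1"] assms
  show ?thesis by (auto simp: die_def)
qed

text \<open>
  The configuration \<open>c\<close> inherits the value of \<open>c'\<close> at the expense of \<open>k\<close> steps. This is the case if the
  machine gets from \<open>c\<close> to \<open>c'\<close> by deterministic steps of weight \<open>1\<close>.
\<close>

definition silent :: "nat \<Rightarrow> 'r::semiring_1 config \<Rightarrow> 'r config \<Rightarrow> bool" where
  "silent k c c' \<longleftrightarrow> (\<forall>m v. evals sat_machine m c' v \<longrightarrow> evals sat_machine (m + k) c v)"

lemma silentD: "silent k c c' \<Longrightarrow> evals sat_machine m c' v \<Longrightarrow> m + k \<le> n \<Longrightarrow> evals sat_machine n c v"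
  unfolding silent_def using evals_mono by blast

lemma silent_refl: "silent k c c"
  unfolding silent_def using evals_mono le_add1 by blast

lemma silent_trans: "silent k c c' \<Longrightarrow> silent k' c' c'' \<Longrightarrow> k + k' \<le> n \<Longrightarrow> silent n c c''"
  unfolding silent_def
proof (intro allI impI)
  fix m v assume *: "\<forall>m v. evals sat_machine m c' v \<longrightarrow> evals sat_machine (m + k) c v"
    "\<forall>m v. evals sat_machine m c'' v \<longrightarrow> evals sat_machine (m + k') c' v" "k + k' \<le> n"
    "evals sat_machine m c'' v"
  then have "evals sat_machine (m + k' + k) c v" by blast
  then show "evals sat_machine (m + n) c v" by (rule evals_mono) (use *(3) in simp)
qed

lemma silent_mono: "silent k c c' \<Longrightarrow> k \<le> n \<Longrightarrow> silent n c c'"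
  using silent_trans[OF _ silent_refl[of 0]] by simp

lemma silent_step:
  assumes "act q (y n) = [(q', c', d, WOne)]" "y(n := c') = y'" "n + d = n'"
  shows "silent 1 (gcfg vs q y n) (gcfg vs q' y' n')"
  unfolding silent_def
proof (intro allI impI)
  fix m v assume "evals sat_machine m (gcfg vs q' y' n') v"
  with evals_gcfg[of q y n m vs "\<lambda>_. v"] assms
  show "evals sat_machine (m + 1) (gcfg vs q y n) v" by auto
qed

lemma silent_left:
  assumes "\<And>i. n' < i \<Longrightarrow> i \<le> n \<Longrightarrow> act q (y i) = [(q, y i, -1, WOne)]" "n' \<le> n" "nat (n - n') \<le> k"
  shows "silent k (gcfg vs q y n) (gcfg vs q y n')"
proof -
  have "silent j (gcfg vs q y n) (gcfg vs q y (n - int j))" if "j \<le> nat (n - n')" for j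
    using that
  proof (induction j)
    case (Suc j)
    have "silent 1 (gcfg vs q y (n - int j)) (gcfg vs q y (n - int (Suc j)))"
      by (rule silent_step, rule assms(1)) (use Suc.prems in auto)
    with Suc show ?case by (auto intro: silent_trans)
  qed (simp add: silent_refl)
  from this[of "nat (n - n')"] assms(2,3) show ?thesis by (auto intro: silent_mono)
qed

lemma silent_right:
  assumes "\<And>i. n \<le> i \<Longrightarrow> i < n' \<Longrightarrow> act q (y i) = [(q, y i, 1, WOne)]" "n \<le> n'" "nat (n' - n) \<le> k"
  shows "silent k (gcfg vs q y n) (gcfg vs q y n')"
proof -
  have "silent j (gcfg vs q y n) (gcfg vs q y (n + int j))" if "j \<le> nat (n' - n)" for j
    using that
  proof (induction j)
    case (Suc j)
    have "silent 1 (gcfg vs q y (n + int j)) (gcfg vs q y (n + int (Suc j)))"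
      by (rule silent_step, rule assms(1)) (use Suc.prems in auto)
    with Suc show ?case by (auto intro: silent_trans)
  qed (simp add: silent_refl)
  from this[of "nat (n' - n)"] assms(2,3) show ?thesis by (auto intro: silent_mono)
qed


section \<open>Open scopes and the comparison of names\<close>

text \<open>
  The scopes that are open at a position, innermost first: the positions of the quantifiers with variable
  and guessed truth value, and the positions of the parentheses. The tape holds their marks.
\<close>

datatype entry = EBind nat bool | EParen kind bool

type_synonym stack = "(int \<times> entry) list"

fun mark_of :: "entry \<Rightarrow> mark" where
  "mark_of (EBind v b) = Binder b" | "mark_of (EParen k s) = Paren k s"

definition marks :: "stack \<Rightarrow> int \<Rightarrow> mark" where
  "marks stk i = (case map_of stk i of None \<Rightarrow> Unmarked | Some e \<Rightarrow> mark_of e)"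

lemma marks_Nil [simp]: "marks [] i = Unmarked"
  by (simp add: marks_def)

lemma marks_Cons [simp]: "marks ((p, e) # s) i = (if i = p then mark_of e else marks s i)"
  by (simp add: marks_def)

fun topmost :: "stack \<Rightarrow> int" where
  "topmost [] = -1" | "topmost ((p, e) # s) = p"

text \<open>
  The position and the truth value of the innermost binder whose name is spelled \<open>bs\<close>.
\<close>

fun lookup :: "token list \<Rightarrow> stack \<Rightarrow> (int \<times> bool) option" where
  "lookup bs [] = None"
| "lookup bs ((p, EBind v b) # s) = (if binary v = bs then Some (p, b) else lookup bs s)"
| "lookup bs ((p, EParen k d) # s) = lookup bs s"

text \<open>
  Removes the binders inside the innermost open parenthesis; this is what the end of an operand does.
\<close>

fun unbind :: "stack \<Rightarrow> stack" where
  "unbind [] = []"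
| "unbind ((p, EBind v b) # s) = unbind s"
| "unbind ((p, EParen k d) # s) = (p, EParen k d) # s"

locale sat_input =
  fixes w :: "'r::comm_semiring_1 word"
  assumes words: "w \<in> words_over sat_alphabet"
begin

abbreviation N :: nat where "N \<equiv> length w"

text \<open>
  The tape as it is determined by the input, the open scopes \<open>stk\<close> and the positions \<open>a\<close> and \<open>b\<close> of the
  two flags.
\<close>

definition bas :: "int \<Rightarrow> base" where
  "bas i = (if 0 \<le> i \<and> i < int N
            then (case w ! nat i of Inl a \<Rightarrow> Tok (inv letter a) | Inr k \<Rightarrow> Val) else Blank)"

definition vals :: "int \<Rightarrow> 'r" where
  "vals i = (if 0 \<le> i \<and> i < int N
             then (case w ! nat i of Inl a \<Rightarrow> 0 | Inr k \<Rightarrow> k) else 0)"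

definition tape :: "stack \<Rightarrow> int option \<Rightarrow> int option \<Rightarrow> int \<Rightarrow> cell" where
  "tape stk a b i = Cell (bas i) (marks stk i) (a = Some i) (b = Some i)"

definition cfg :: "state \<Rightarrow> stack \<Rightarrow> int option \<Rightarrow> int option \<Rightarrow> int \<Rightarrow> 'r config" where
  "cfg q stk a b n = gcfg vals q (tape stk a b) n"

text \<open>
  The maximal block of bits that begins at position \<open>x\<close> is \<open>ts\<close>.
\<close>

fun run :: "int \<Rightarrow> token list \<Rightarrow> bool" where
  "run x [] \<longleftrightarrow> bit_of (bas x) = None"
| "run x (t # ts) \<longleftrightarrow> (t = Bit0 \<or> t = Bit1) \<and> bas x = Tok t \<and> run (x + 1) ts"

text \<open>
  The positions of the scopes are decreasing and below \<open>i\<close>, and the binders have the names that are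
  written on the tape, each of which ends before the next scope and before \<open>i\<close>.
\<close>

fun wfs :: "int \<Rightarrow> stack \<Rightarrow> bool" where
  "wfs i [] \<longleftrightarrow> True"
| "wfs i ((p, e) # s) \<longleftrightarrow> 0 \<le> p \<and> p < i \<and> wfs p s \<and>
     (case e of EBind v b \<Rightarrow> bas (p + 1) = Tok VarTok \<and> run (p + 2) (binary v) \<and>
                              p + 2 + int (length (binary v)) \<le> i
              | EParen k d \<Rightarrow> True)"

lemma bas_Blank: "bas i = Blank \<longleftrightarrow> i < 0 \<or> int N \<le> i"
  by (auto simp: bas_def split: sum.splits)

lemma wfs_mono: "wfs i s \<Longrightarrow> i \<le> j \<Longrightarrow> wfs j s"
  by (cases s) (auto split: entry.splits)

lemma wfs_topmost: "wfs i s \<Longrightarrow> 0 \<le> i \<Longrightarrow> topmost s < i \<and> -1 \<le> topmost s"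
  by (cases s) auto

lemma marks_above: "wfs i s \<Longrightarrow> topmost s < x \<Longrightarrow> marks s x = Unmarked"
proof (induction i s rule: wfs.induct)
  case (2 i p e s)
  then have "marks s x = Unmarked" by (cases s) auto
  with 2 show ?case by simp
qed simp

lemma wfs_append: "wfs i (s @ t) \<Longrightarrow> wfs i t"
proof (induction i s rule: wfs.induct)
  case (2 i p e s)
  then show ?case using wfs_mono[of p t i] by simp
qed simp

lemma marks_append:
  "wfs i (s @ t) \<Longrightarrow> marks (s @ t) x =
     (if x \<le> topmost t then marks t x else marks s x)"
proof (induction i s rule: wfs.induct)
  case (1 i)
  then show ?case using marks_above by auto
next
  case (2 i p e s)
  from 2 have *: "marks (s @ t) x = (if x \<le> topmost t then marks t x else marks s x)" by simp
  have "topmost t < p" using 2 wfs_topmost[of p t] wfs_append by auto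
  with * show ?case by auto
qed

lemma cfg_step:
  assumes "act q (tape stk a b n) = [(q', tape stk' a' b' n, n' - n, WOne)]"
    and "\<And>i. i \<noteq> n \<Longrightarrow> tape stk' a' b' i = tape stk a b i"
  shows "silent 1 (cfg q stk a b n) (cfg q' stk' a' b' n')"
  unfolding cfg_def by (rule silent_step[where q = q and y = "tape stk a b" and n = n, OF assms(1)]) (use assms(2) in \<open>auto simp: fun_eq_iff\<close>)

lemma cfg_left:
  assumes "\<And>i. n' < i \<Longrightarrow> i \<le> n \<Longrightarrow> act q (tape stk a b i) = [(q, tape stk a b i, -1, WOne)]" "n' \<le> n"
  shows "silent (nat (n - n')) (cfg q stk a b n) (cfg q stk a b n')"
  unfolding cfg_def by (rule silent_left) (use assms in auto)

lemma cfg_right: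
  assumes "\<And>i. n \<le> i \<Longrightarrow> i < n' \<Longrightarrow> act q (tape stk a b i) = [(q, tape stk a b i, 1, WOne)]" "n \<le> n'"
  shows "silent (nat (n' - n)) (cfg q stk a b n) (cfg q stk a b n')"
  unfolding cfg_def by (rule silent_right) (use assms in auto)

lemma silent_comp [trans]: "silent k c c' \<Longrightarrow> silent k' c' c'' \<Longrightarrow> silent (k + k') c c''"
  by (rule silent_trans) auto

abbreviation B :: nat where "B \<equiv> N + 2"

text \<open>
  The remaining bits \<open>cs\<close> at \<open>x\<close> of the name of the binder at \<open>c\<close> are compared with the remaining bits \<open>bs\<close> at
  \<open>y\<close> of the literal that begins at \<open>m\<close>. The first flag is directly before \<open>y\<close>; a match puts it behind the
  literal, and a mismatch puts it back to \<open>m\<close>.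
\<close>

lemma compare:
  assumes "run x cs" "run y bs" "x + int (length cs) \<le> m" "m < y" "y + int (length bs) \<le> int N"
    and "0 \<le> c" "c < x" "marks stk c = Binder v" "\<And>i. c < i \<Longrightarrow> i < x + int (length cs) \<Longrightarrow> marks stk i = Unmarked"
    and "bit_of (bas m) = None" "\<And>i. m < i \<Longrightarrow> i < y \<Longrightarrow> bit_of (bas i) \<noteq> None"
    and "x < y - 1"
  shows "cs = bs \<Longrightarrow> silent ((length bs + 1) * (4 * B)) (cfg (ReadB s md) stk (Some (y - 1)) None x)
           (cfg (Found s md) stk (Some (y + int (length bs))) None c)"
    and "cs \<noteq> bs \<Longrightarrow> silent ((length bs + 1) * (4 * B)) (cfg (ReadB s md) stk (Some (y - 1)) None x)
           (cfg (Seek s md) stk (Some m) None (c - 1))"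
proof -
  let ?T = "cfg (Found s md) stk (Some (y + int (length bs))) None c"
  let ?F = "cfg (Seek s md) stk (Some m) None (c - 1)"
  have "silent ((length bs + 1) * (4 * B)) (cfg (ReadB s md) stk (Some (y - 1)) None x) (if cs = bs then ?T else ?F)"
    using assms
  proof (induction bs arbitrary: cs x y)
    let ?e = "\<lambda>x. bit_of (bas x)"
    \<comment> \<open>One round fetches a bit of the binder and carries it to the next bit of the literal.\<close>
    have start: "silent (nat (y - 1 - x) + 1) (cfg (ReadB s md) stk (Some (y - 1)) None x)
                  (cfg (ReadA (?e x) s md) stk None (Some x) y)" if "x < y - 1" for x y
    proof -
      have "silent 1 (cfg (ReadB s md) stk (Some (y - 1)) None x)
              (cfg (GotoA (?e x) s md) stk (Some (y - 1)) (Some x) (x + 1))"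
        by (rule cfg_step) (auto simp: tape_def)
      also have "silent (nat ((y - 1) - (x + 1))) \<dots> (cfg (GotoA (?e x) s md) stk (Some (y - 1)) (Some x) (y - 1))"
        by (rule cfg_right) (use that in \<open>auto simp: tape_def\<close>)
      also have "silent 1 \<dots> (cfg (ReadA (?e x) s md) stk None (Some x) y)"
        by (rule cfg_step) (auto simp: tape_def)
      finally show ?thesis by (rule silent_mono) (use that in auto)
    qed
    \<comment> \<open>The first flag goes back to the beginning \<open>m\<close> of the literal, the second one is deleted.\<close>
    have mismatch: "silent (4 * B) (cfg (ReadB s md) stk (Some (y - 1)) None x) ?F"
      if "?e x \<noteq> ?e y" "x < y - 1" "x \<le> m" "m < y" "y \<le> int N" "c < x" "\<And>i. c < i \<Longrightarrow> i < x \<Longrightarrow> marks stk i = Unmarked"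
        "\<And>i. m < i \<Longrightarrow> i < y \<Longrightarrow> ?e i \<noteq> None" for x y
    proof -
      note start[OF that(2)]
      also have "silent 1 (cfg (ReadA (?e x) s md) stk None (Some x) y) (cfg (Back s md) stk None (Some x) (y - 1))"
        by (rule cfg_step) (use that(1) in \<open>auto simp: tape_def\<close>)
      also have "silent (nat (y - 1 - m)) \<dots> (cfg (Back s md) stk None (Some x) m)"
        by (rule cfg_left) (use that in \<open>auto simp: tape_def\<close>)
      finally have 1: "silent (nat (y - 1 - x) + 2 + nat (y - 1 - m)) (cfg (ReadB s md) stk (Some (y - 1)) None x)
          (cfg (Back s md) stk None (Some x) m)"
        by (rule silent_mono) auto
      have 2: "silent (nat (m - x) + 1) (cfg (Back s md) stk None (Some x) m) (cfg (Skip s md) stk (Some m) None (x - 1))"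
      \<comment> \<open>If the name of the binder ends directly before the literal, then both flags meet at \<open>m\<close>.\<close>
      proof (cases "x = m")
        case True
        have "silent 1 (cfg (Back s md) stk None (Some x) m) (cfg (Skip s md) stk (Some m) None (x - 1))"
          by (rule cfg_step) (use assms(10) True in \<open>auto simp: tape_def\<close>)
        then show ?thesis by (rule silent_mono) simp
      next
        case False
        have "silent 1 (cfg (Back s md) stk None (Some x) m) (cfg (Drop s md) stk (Some m) (Some x) (m - 1))"
          by (rule cfg_step) (use assms(10) False in \<open>auto simp: tape_def\<close>)
        also have "silent (nat (m - 1 - x)) \<dots> (cfg (Drop s md) stk (Some m) (Some x) x)"
          by (rule cfg_left) (use that False in \<open>auto simp: tape_def\<close>)
        also have "silent 1 \<dots> (cfg (Skip s md) stk (Some m) None (x - 1))"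
          by (rule cfg_step) (use assms(10) False in \<open>auto simp: tape_def\<close>)
        finally show ?thesis by (rule silent_mono) (use that False in auto)
      qed
      have "silent (nat (x - 1 - c)) (cfg (Skip s md) stk (Some m) None (x - 1)) (cfg (Skip s md) stk (Some m) None c)"
        by (rule cfg_left) (use that in \<open>auto simp: tape_def\<close>)
      also have "silent 1 \<dots> ?F"
        by (rule cfg_step) (use assms(8) in \<open>auto simp: tape_def\<close>)
      finally have 3: "silent (nat (x - 1 - c) + 1) (cfg (Skip s md) stk (Some m) None (x - 1)) ?F" .
      show ?thesis
        by (rule silent_mono[OF silent_comp[OF 1 silent_comp[OF 2 3]]]) (use that assms(6) in auto)
    qed
    {
      case (Nil cs x y)
      show ?case
      proof (cases cs)
        case Nil: Nil
        note start[OF \<open>x < y - 1\<close>]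
        also have "silent 1 (cfg (ReadA (?e x) s md) stk None (Some x) y) (cfg (Match s md) stk (Some y) (Some x) (y - 1))"
          by (rule cfg_step) (use Nil.prems Nil in \<open>auto simp: tape_def\<close>)
        also have "silent (nat (y - 1 - x)) \<dots> (cfg (Match s md) stk (Some y) (Some x) x)"
          by (rule cfg_left) (use Nil.prems in \<open>auto simp: tape_def\<close>)
        also have "silent 1 \<dots> (cfg (Found s md) stk (Some y) None (x - 1))"
          by (rule cfg_step) (use Nil.prems in \<open>auto simp: tape_def\<close>)
        also have "silent (nat (x - 1 - c)) \<dots> (cfg (Found s md) stk (Some y) None c)"
          by (rule cfg_left) (use Nil.prems in \<open>auto simp: tape_def\<close>)
        finally show ?thesis
          unfolding Nil by simp (rule silent_mono, use Nil.prems in auto)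
      next
        case (Cons t ts)
        then have "?e x \<noteq> ?e y" using Nil.prems(1,2) by auto
        from mismatch[OF this] Nil.prems Cons show ?thesis by auto
      qed
    next
      case (Cons t bs cs x y)
      show ?case
      proof (cases "\<exists>cs'. cs = t # cs'")
        case True
        then obtain cs' where cs': "cs = t # cs'" by blast
        have e: "?e x = ?e y" "?e y \<noteq> None" using Cons.prems cs' by auto
        note start[OF \<open>x < y - 1\<close>]
        also have "silent 1 (cfg (ReadA (?e x) s md) stk None (Some x) y) (cfg (GotoB s md) stk (Some y) (Some x) (y - 1))"
          by (rule cfg_step) (use e in \<open>auto simp: tape_def\<close>)
        also have "silent (nat (y - 1 - x)) \<dots> (cfg (GotoB s md) stk (Some y) (Some x) x)"
          by (rule cfg_left) (use Cons.prems in \<open>auto simp: tape_def\<close>)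
        also have "silent 1 \<dots> (cfg (ReadB s md) stk (Some (y + 1 - 1)) None (x + 1))"
          by (rule cfg_step) (use Cons.prems in \<open>auto simp: tape_def\<close>)
        also have "silent ((length bs + 1) * (4 * B)) \<dots> (if cs' = bs then cfg (Found s md) stk (Some (y + 1 + int (length bs))) None c else ?F)"
        proof (rule Cons.IH)
          fix i assume "m < i" "i < y + 1"
          then show "?e i \<noteq> None" using Cons.prems(11)[of i] e by (cases "i = y") auto
        qed (use Cons.prems cs' in auto)
        finally have *: "silent (nat (y - 1 - x) + 1 + 1 + nat (y - 1 - x) + 1 + (length bs + 1) * (4 * B))
            (cfg (ReadB s md) stk (Some (y - 1)) None x)
            (if cs' = bs then cfg (Found s md) stk (Some (y + 1 + int (length bs))) None c else ?F)" .
        have "nat (y - 1 - x) \<le> N" using Cons.prems by auto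
        then have "nat (y - 1 - x) + 1 + 1 + nat (y - 1 - x) + 1 + (length bs + 1) * (4 * B) \<le> (length (t # bs) + 1) * (4 * B)"
          by (simp add: algebra_simps)
        note silent_mono[OF * this]
        moreover have "y + 1 + int (length bs) = y + int (length (t # bs))" by simp
        ultimately show ?thesis using cs' by (cases "cs' = bs") simp_all
      next
        case False
        then have "?e x \<noteq> ?e y" using Cons.prems(1,2) by (cases cs) auto
        from mismatch[OF this] Cons.prems have "silent (4 * B) (cfg (ReadB s md) stk (Some (y - 1)) None x) ?F" by auto
        then show ?thesis using False by (auto intro: silent_mono)
      qed
    }
  qed
  then show "cs = bs \<Longrightarrow> silent ((length bs + 1) * (4 * B)) (cfg (ReadB s md) stk (Some (y - 1)) None x) ?T"
    and "cs \<noteq> bs \<Longrightarrow> silent ((length bs + 1) * (4 * B)) (cfg (ReadB s md) stk (Some (y - 1)) None x) ?F"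
    by auto
qed

end


section \<open>Looking up a variable and closing scopes\<close>

context sat_input begin

lemma cfg_die: "act q (tape stk a b n) = die c \<Longrightarrow> evals sat_machine (Suc k) (cfg q stk a b n) 0"
  unfolding cfg_def by (rule evals_die)

lemma wfs_length: "wfs i s \<Longrightarrow> 0 \<le> i \<Longrightarrow> int (length s) \<le> i"
  by (induction i s rule: wfs.induct) auto

lemma marks_binder_name:
  "wfs i (s @ (p, EBind v b) # t) \<Longrightarrow> p < x \<Longrightarrow> x < p + 2 + int (length (binary v)) \<Longrightarrow>
   marks (s @ (p, EBind v b) # t) x = Unmarked"
proof (induction s arbitrary: i)
  case Nil
  then show ?case using marks_above[of i "(p, EBind v b) # t" x] by simp
next
  case (Cons a s)
  obtain p' e where a: "a = (p', e)" by force
  with Cons have *: "wfs p' (s @ (p, EBind v b) # t)" by simp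
  from wfs_append[OF this] have "p + 2 + int (length (binary v)) \<le> p'" by simp
  with Cons.IH[OF *] Cons.prems a show ?case by simp
qed

lemma run_bits: "run x bs \<Longrightarrow> x \<le> i \<Longrightarrow> i < x + int (length bs) \<Longrightarrow> bit_of (bas i) \<noteq> None"
proof (induction bs arbitrary: x)
  case (Cons t bs)
  then show ?case by (cases "i = x") auto
qed simp

definition seek_cost :: nat where "seek_cost = 4 * B * B"

text \<open>
  The scopes \<open>stk1\<close> have been searched in vain, the scopes \<open>stk2\<close> remain. The head is on the innermost of
  the latter, or in the part of the tape without marks to the right of it.
\<close>

lemma seek:
  assumes "wfs m (stk1 @ stk2)" "bas m = Tok VarTok" "run (m + 1) bs" "0 \<le> m"
    "m + 1 + int (length bs) \<le> int N" "topmost stk2 \<le> n" "n < m"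
    "\<And>i. topmost stk2 < i \<Longrightarrow> i \<le> n \<Longrightarrow> marks (stk1 @ stk2) i = Unmarked"
  shows "case lookup bs stk2 of
      None \<Rightarrow> evals sat_machine ((length stk2 + 1) * seek_cost) (cfg (Seek s md) (stk1 @ stk2) (Some m) None n) 0
    | Some (c, b) \<Rightarrow> marks (stk1 @ stk2) c = Binder b \<and> 0 \<le> c \<and> c < m \<and>
        silent ((length stk2 + 1) * seek_cost) (cfg (Seek s md) (stk1 @ stk2) (Some m) None n)
          (cfg (Found s md) (stk1 @ stk2) (Some (m + 1 + int (length bs))) None c)"
  using assms
proof (induction stk2 arbitrary: stk1 n)
  case Nil
  have "silent (nat (n - -1)) (cfg (Seek s md) stk1 (Some m) None n) (cfg (Seek s md) stk1 (Some m) None (-1))"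
    by (rule cfg_left) (use Nil.prems in \<open>auto simp: tape_def bas_Blank\<close>)
  moreover have "evals sat_machine 1 (cfg (Seek s md) stk1 (Some m) None (-1)) 0"
  proof -
    have "marks stk1 (-1) = Unmarked" "bas (-1) = Blank"
      using marks_append[of m stk1 "[]" "-1"] Nil.prems by (auto simp: bas_Blank)
    then have "act (Seek s md) (tape stk1 (Some m) None (-1)) = die (tape stk1 (Some m) None (-1))"
      by (simp add: tape_def)
    from cfg_die[OF this, of 0] show ?thesis by simp
  qed
  moreover have "1 + nat (n - -1) \<le> seek_cost"
    using Nil.prems by (auto simp: seek_cost_def algebra_simps)
  ultimately show ?case by (auto intro: silentD)
next
  case (Cons pe stk2)
  let ?stk = "stk1 @ pe # stk2"
  obtain p e where pe: "pe = (p, e)" by force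
  from wfs_append[OF Cons.prems(1)] have wf: "wfs m ((p, e) # stk2)" unfolding pe .
  have low: "marks ?stk i = marks (pe # stk2) i" if "i \<le> p" for i
    using marks_append[OF Cons.prems(1)] that pe by simp
  have IH: "case lookup bs stk2 of
      None \<Rightarrow> evals sat_machine ((length stk2 + 1) * seek_cost) (cfg (Seek s md) ?stk (Some m) None (p - 1)) 0
    | Some (c, b) \<Rightarrow> marks ?stk c = Binder b \<and> 0 \<le> c \<and> c < m \<and>
        silent ((length stk2 + 1) * seek_cost) (cfg (Seek s md) ?stk (Some m) None (p - 1))
          (cfg (Found s md) ?stk (Some (m + 1 + int (length bs))) None c)"
  proof -
    have "topmost stk2 \<le> p - 1" using wf wfs_topmost[of p stk2] by simp
    moreover have "marks ?stk i = Unmarked" if "topmost stk2 < i" "i \<le> p - 1" for i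
      using low[of i] that marks_above[of p stk2 i] wf pe by simp
    ultimately show ?thesis using Cons.IH[of "stk1 @ [pe]" "p - 1"] Cons.prems(1-5) wf
      unfolding append_assoc append_Cons append_Nil by simp
  qed
  have p: "0 \<le> p" "p < m" "p \<le> n" using wf Cons.prems pe by auto
  have walk: "silent (nat (n - p)) (cfg (Seek s md) ?stk (Some m) None n) (cfg (Seek s md) ?stk (Some m) None p)"
    by (rule cfg_left) (use Cons.prems pe p in \<open>auto simp: tape_def bas_Blank\<close>)
  have len: "length bs + 2 \<le> B" "nat (n - p) + 2 \<le> 4 * B" using Cons.prems p by auto
  \<comment> \<open>A scope that is not the binder in question is passed.\<close>
  have pass: ?case if reach: "silent seek_cost (cfg (Seek s md) ?stk (Some m) None n) (cfg (Seek s md) ?stk (Some m) None (p - 1))"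
    and l: "lookup bs (pe # stk2) = lookup bs stk2"
  proof (cases "lookup bs stk2")
    case None
    with IH have "evals sat_machine ((length stk2 + 1) * seek_cost) (cfg (Seek s md) ?stk (Some m) None (p - 1)) 0" by simp
    from silentD[OF reach this] show ?thesis using None l by simp
  next
    case (Some cb)
    with IH obtain c b where cb: "cb = (c, b)" "marks ?stk c = Binder b" "0 \<le> c" "c < m"
       "silent ((length stk2 + 1) * seek_cost) (cfg (Seek s md) ?stk (Some m) None (p - 1))
          (cfg (Found s md) ?stk (Some (m + 1 + int (length bs))) None c)" by (cases cb) auto
    from silent_trans[OF reach cb(5)] cb show ?thesis using Some l by simp
  qed
  show ?case
  proof (cases e)
    case (EParen k d)
    have "silent 1 (cfg (Seek s md) ?stk (Some m) None p) (cfg (Seek s md) ?stk (Some m) None (p - 1))"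
      by (rule cfg_step) (use low[of p] EParen pe p Cons.prems in \<open>auto simp: tape_def bas_Blank\<close>)
    from silent_comp[OF walk this]
    have "silent seek_cost (cfg (Seek s md) ?stk (Some m) None n) (cfg (Seek s md) ?stk (Some m) None (p - 1))"
      by (rule silent_mono) (use len in \<open>simp add: seek_cost_def algebra_simps\<close>)
    then show ?thesis by (rule pass) (simp add: EParen pe)
  next
    case (EBind v b)
    have mp: "marks ?stk p = Binder b" using low[of p] EBind pe by simp
    have wfb: "bas (p + 1) = Tok VarTok" "run (p + 2) (binary v)" "p + 2 + int (length (binary v)) \<le> m"
      using wf EBind by auto
    have "silent 1 (cfg (Seek s md) ?stk (Some m) None p) (cfg (AtVar s md) ?stk (Some m) None (p + 1))"
      by (rule cfg_step) (use mp in \<open>auto simp: tape_def\<close>)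
    also have "silent 1 \<dots> (cfg (ReadB s md) ?stk (Some (m + 1 - 1)) None (p + 2))"
      by (rule cfg_step) (auto simp: tape_def)
    finally have "silent 2 (cfg (Seek s md) ?stk (Some m) None p) (cfg (ReadB s md) ?stk (Some (m + 1 - 1)) None (p + 2))"
      by (simp add: numeral_2_eq_2)
    note silent_comp[OF walk this]
    moreover have "length (binary v) > 0" using binary_not_Nil by simp
    then have *: "p + 2 < m + 1 - 1" using wfb(3) by linarith
    note cmp = compare[OF wfb(2) Cons.prems(3) wfb(3) _ Cons.prems(5) p(1) _ mp _ _ _ *]
    have un: "marks ?stk i = Unmarked" if "p < i" "i < p + 2 + int (length (binary v))" for i
      using marks_binder_name[of m stk1 p v b stk2 i] Cons.prems(1) that EBind pe by simp
    have cost: "nat (n - p) + 2 + (length bs + 1) * (4 * B) \<le> seek_cost"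
    proof -
      have "nat (n - p) + 2 + (length bs + 1) * (4 * B) \<le> (length bs + 2) * (4 * B)"
        using len(2) by (simp add: algebra_simps)
      also have "\<dots> \<le> B * (4 * B)" using len(1) by (intro mult_le_mono1)
      finally show ?thesis by (simp add: seek_cost_def algebra_simps)
    qed
    show ?thesis
    proof (cases "binary v = bs")
      case True
      have "silent ((length bs + 1) * (4 * B)) (cfg (ReadB s md) ?stk (Some (m + 1 - 1)) None (p + 2))
              (cfg (Found s md) ?stk (Some (m + 1 + int (length bs))) None p)"
        by (rule cmp(1)) (use Cons.prems un True in auto)
      from silent_trans[OF calculation this, of "(length (pe # stk2) + 1) * seek_cost"]
      show ?thesis using True mp pe EBind p cost by simp
    next
      case False
      have "silent ((length bs + 1) * (4 * B)) (cfg (ReadB s md) ?stk (Some (m + 1 - 1)) None (p + 2))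
              (cfg (Seek s md) ?stk (Some m) None (p - 1))"
        by (rule cmp(2)) (use Cons.prems un False in auto)
      from silent_trans[OF calculation this cost] show ?thesis by (rule pass) (use False pe EBind in simp)
    qed
  qed
qed

text \<open>
  The head is on the innermost open scope, and the first flag is at the position \<open>j\<close> behind the formula.
\<close>

definition cfgC :: "stack \<Rightarrow> int \<Rightarrow> 'r config" where
  "cfgC s j = cfg Close s (Some j) None (topmost s)"

lemma wfs_unbind: "wfs i s \<Longrightarrow> wfs i (unbind s)"
proof (induction s rule: unbind.induct)
  case (2 p v b s)
  then show ?case using wfs_mono[of p s i] by auto
qed auto

lemma close:
  "wfs i stk \<Longrightarrow> topmost stk \<le> n \<Longrightarrow> n < j \<Longrightarrow> j \<le> int N \<Longrightarrow>
   silent (nat (n - topmost (unbind stk))) (cfg Close stk (Some j) None n) (cfgC (unbind stk) j)"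
proof (induction stk arbitrary: n i rule: unbind.induct)
  case 1
  show ?case unfolding cfgC_def unbind.simps
    by (rule cfg_left) (use 1 in \<open>auto simp: tape_def bas_Blank\<close>)
next
  case (2 p v b s)
  have walk: "silent (nat (n - p)) (cfg Close ((p, EBind v b) # s) (Some j) None n) (cfg Close ((p, EBind v b) # s) (Some j) None p)"
    by (rule cfg_left) (use 2 marks_above[of p s] wfs_topmost[of p s] in \<open>auto simp: tape_def bas_Blank\<close>)
  have "silent 1 (cfg Close ((p, EBind v b) # s) (Some j) None p) (cfg Close s (Some j) None (p - 1))"
    by (rule cfg_step) (use 2 marks_above[of p s p] wfs_topmost[of p s] in \<open>auto simp: tape_def\<close>)
  moreover have "silent (nat (p - 1 - topmost (unbind s))) (cfg Close s (Some j) None (p - 1)) (cfgC (unbind s) j)"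
    by (rule "2.IH"[of p]) (use 2 wfs_topmost[of p s] in auto)
  ultimately show ?case
    using "2.prems" wfs_topmost[of p "unbind s"] wfs_unbind[of p s]
    by (intro silent_mono[OF silent_comp[OF walk silent_comp]]) auto
next
  case (3 p k d s)
  then have un: "marks s x = Unmarked" if "p < x" for x
    using marks_above[of p s x] wfs_topmost[of p s] that by simp
  show ?case unfolding cfgC_def unbind.simps
    by (rule cfg_left) (use 3 un in \<open>auto simp: tape_def bas_Blank\<close>)
qed

end


section \<open>Literals and parentheses\<close>

context sat_input begin

lemma unbind_head: "unbind s \<noteq> (p, EBind v b) # t"
  by (induction s rule: unbind.induct) auto

lemma evals_one:
  assumes "act q (tape stk a b n) = [(q', tape stk' a' b' n, n' - n, r)]"
    and "\<And>i. i \<noteq> n \<Longrightarrow> tape stk' a' b' i = tape stk a b i"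
    and "evals sat_machine k (cfg q' stk' a' b' n') v"
  shows "evals sat_machine (Suc k) (cfg q stk a b n) (wval r (vals n) * v)"
proof -
  have "(tape stk a b)(n := tape stk' a' b' n) = tape stk' a' b'"
    using assms(2) by (auto simp: fun_eq_iff)
  with evals_gcfg[of q "tape stk a b" n k vals "\<lambda>_. v"] assms(1,3)
  show ?thesis by (auto simp: cfg_def)
qed

text \<open>
  A nondeterministic step, with weights \<open>1\<close>, to configurations with stacks \<open>s'\<close> and values \<open>v\<close>.
\<close>

lemma evals_choice:
  assumes "act q (tape stk None None n) = map (\<lambda>(q', s', v). (q', tape s' None None n, 1, WOne)) xs" "xs \<noteq> []"
    and "\<And>q' s' v i. (q', s', v) \<in> set xs \<Longrightarrow> i \<noteq> n \<Longrightarrow> tape s' None None i = tape stk None None i"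
    and "\<And>q' s' v. (q', s', v) \<in> set xs \<Longrightarrow> evals sat_machine k (cfg q' s' None None (n + 1)) v"
  shows "evals sat_machine (Suc k) (cfg q stk None None n) (\<Sum>(q', s', v)\<leftarrow>xs. v)"
proof -
  let ?f = "\<lambda>(q', s', v). (q', tape s' None None n, 1 :: int, WOne)" and ?g = "\<lambda>(q', s', v). v"
  let ?V = "\<lambda>t. the (map_of (map (\<lambda>x. (?f x, ?g x)) xs) t)"
  have "distinct (map ?f xs)" using distinct_act[of q "tape stk None None n"] assms(1) by simp
  then have "distinct (map fst (map (\<lambda>x. (?f x, ?g x)) xs))" by (simp add: o_def)
  then have V: "?V (?f x) = ?g x" if "x \<in> set xs" for x
    using that by (subst map_of_is_SomeI[of _ _ "?g x"]) auto
  have "evals sat_machine (Suc k) (gcfg vals q (tape stk None None) n)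
      (\<Sum>(q', c', d, r) \<leftarrow> act q (tape stk None None n). wval r (vals n) * ?V (q', c', d, r))"
  proof (rule evals_gcfg)
    show "act q (tape stk None None n) \<noteq> []" using assms(1,2) by simp
    fix q' c' d r assume "(q', c', d, r) \<in> set (act q (tape stk None None n))"
    then obtain s' v where x: "(q', s', v) \<in> set xs" "c' = tape s' None None n" "d = 1" "r = WOne"
      using assms(1) by auto
    have "(tape stk None None)(n := c') = tape s' None None"
      using assms(3)[OF x(1)] x(2) by (auto simp: fun_eq_iff)
    with V[OF x(1)] assms(4)[OF x(1)] x(2-)
    show "evals sat_machine k (gcfg vals q' ((tape stk None None)(n := c')) (n + d)) (?V (q', c', d, r))"
      by (simp add: cfg_def)
  qed
  also have "(\<Sum>(q', c', d, r) \<leftarrow> act q (tape stk None None n). wval r (vals n) * ?V (q', c', d, r)) = (\<Sum>x\<leftarrow>xs. ?g x)"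
    unfolding assms(1) map_map using V by (intro arg_cong[of _ _ sum_list] map_cong) auto
  finally show ?thesis by (simp add: cfg_def)
qed

text \<open>
  A bound on the time that is spent per symbol of a formula.
\<close>

definition cost :: nat where "cost = B * seek_cost + 4 * B"

lemma close_done:
  assumes "wfs j stk" "0 \<le> j" "j \<le> int N" 
  shows "silent B (cfg Done stk None None j) (cfgC (unbind stk) j)"
proof -
  have "silent 1 (cfg Done stk None None j) (cfg Close stk (Some j) None (j - 1))"
    by (rule cfg_step) (auto simp: tape_def)
  also have "silent (nat (j - 1 - topmost (unbind stk))) \<dots> (cfgC (unbind stk) j)"
    using assms wfs_topmost[of j stk] by (intro close[of j]) auto
  finally show ?thesis
    by (rule silent_mono) (use assms wfs_topmost[of j "unbind stk"] wfs_unbind[of j stk] in auto)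
qed

text \<open>
  From the literal that begins at \<open>m\<close>: an unbound variable and, in an evaluated formula, a wrong truth
  value give \<open>0\<close>; otherwise the literal is passed with weight \<open>1\<close>, and the binders whose scopes end with
  it are removed.
\<close>

lemma literal:
  fixes s md :: bool
  assumes wf: "wfs m stk" and m: "bas m = Tok VarTok" "run (m + 1) bs" "0 \<le> m" "m + 1 + int (length bs) \<le> int N"
  defines "c \<equiv> cfg (Seek s md) stk (Some m) None (m - 1)"
  shows "lookup bs stk = None \<Longrightarrow> evals sat_machine cost c 0"
    and "lookup bs stk = Some (p, b) \<Longrightarrow> md \<and> b \<noteq> s \<Longrightarrow> evals sat_machine cost c 0"
    and "lookup bs stk = Some (p, b) \<Longrightarrow> \<not> (md \<and> b \<noteq> s) \<Longrightarrow> silent cost c (cfgC (unbind stk) (m + 1 + int (length bs)))"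
proof -
  let ?e = "m + 1 + int (length bs)"
  have "int (length stk) \<le> m" using wfs_length[OF wf m(3)] .
  with m have "length stk + 1 \<le> B" by simp
  from mult_le_mono1[OF this] have len: "(length stk + 1) * seek_cost + 4 * B \<le> cost"
    by (simp add: cost_def)
  have sk: "case lookup bs stk of
      None \<Rightarrow> evals sat_machine ((length stk + 1) * seek_cost) c 0
    | Some (p, b) \<Rightarrow> marks stk p = Binder b \<and> 0 \<le> p \<and> p < m \<and>
        silent ((length stk + 1) * seek_cost) c (cfg (Found s md) stk (Some ?e) None p)"
    unfolding c_def
  proof (rule seek[where ?stk1.0 = "[]", unfolded append_Nil, OF wf m])
    show "topmost stk \<le> m - 1" using wfs_topmost[OF wf m(3)] by simp
    show "marks stk i = Unmarked" if "topmost stk < i" for i using marks_above[OF wf that] .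
  qed simp
  { assume "lookup bs stk = None"
    with sk have "evals sat_machine ((length stk + 1) * seek_cost) c 0" by simp
    then show "evals sat_machine cost c 0" by (rule evals_mono) (use len in simp) }
  assume "lookup bs stk = Some (p, b)"
  with sk have p: "marks stk p = Binder b" "0 \<le> p" "p < m"
    "silent ((length stk + 1) * seek_cost) c (cfg (Found s md) stk (Some ?e) None p)" by auto
  { assume bad: "md \<and> b \<noteq> s"
    have *: "evals sat_machine (Suc 0) (cfg (Found s md) stk (Some ?e) None p) 0"
      by (rule cfg_die[where c = "tape stk (Some ?e) None p"]) (use p bad in \<open>auto simp: tape_def\<close>)
    show "evals sat_machine cost c 0" by (rule silentD[OF p(4) *]) (use len in simp) }
  assume ok: "\<not> (md \<and> b \<noteq> s)"
  have "silent 1 (cfg (Found s md) stk (Some ?e) None p) (cfg Return stk (Some ?e) None (p + 1))"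
    by (rule cfg_step) (use p ok in \<open>auto simp: tape_def\<close>)
  also have "silent (nat (?e - (p + 1))) \<dots> (cfg Return stk (Some ?e) None ?e)"
    by (rule cfg_right) (use p in \<open>auto simp: tape_def\<close>)
  also have "silent 1 \<dots> (cfg Close stk (Some ?e) None (?e - 1))"
    by (rule cfg_step) (auto simp: tape_def)
  also have "silent (nat (?e - 1 - topmost (unbind stk))) \<dots> (cfgC (unbind stk) ?e)"
    using wf m wfs_topmost[OF wf m(3)] by (intro close[of m]) auto
  finally have "silent (4 * B) (cfg (Found s md) stk (Some ?e) None p) (cfgC (unbind stk) ?e)"
    by (rule silent_mono) (use p m wfs_topmost[OF wfs_unbind[OF wf] m(3)] in auto)
  from silent_comp[OF p(4) this] show "silent cost c (cfgC (unbind stk) ?e)"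
    by (rule silent_mono) (use len in simp)
qed

lemma resume_empty:
  assumes "0 \<le> j" "j \<le> int N"
  shows "silent B (cfgC [] j) (cfg (Resume None) [] (Some j) None j)"
proof -
  have "silent 1 (cfgC [] j) (cfg (Resume None) [] (Some j) None 0)"
    unfolding cfgC_def by (rule cfg_step) (auto simp: tape_def bas_Blank)
  also have "silent (nat (j - 0)) \<dots> (cfg (Resume None) [] (Some j) None j)"
    by (rule cfg_right) (use assms in \<open>auto simp: tape_def\<close>)
  finally show ?thesis by (rule silent_mono) (use assms in auto)
qed

lemma resume_paren:
  assumes "wfs j ((p, EParen k d) # s)" "j \<le> int N"
    and "s' = (if d then s else (p, EParen k True) # s)"
  shows "silent B (cfgC ((p, EParen k d) # s) j) (cfg (Resume (Some (k, d))) s' (Some j) None j)"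
proof -
  have "topmost s < p" using wfs_topmost[of p s] assms by auto
  then have un: "marks s p = Unmarked" using assms by (intro marks_above[of p]) auto
  have "silent 1 (cfgC ((p, EParen k d) # s) j) (cfg (Resume (Some (k, d))) s' (Some j) None (p + 1))"
    unfolding cfgC_def by (rule cfg_step) (use assms un in \<open>auto simp: tape_def bas_Blank\<close>)
  also have "silent (nat (j - (p + 1))) \<dots> (cfg (Resume (Some (k, d))) s' (Some j) None j)"
    by (rule cfg_right) (use assms in \<open>auto simp: tape_def\<close>)
  finally show ?thesis by (rule silent_mono) (use assms in auto)
qed

lemma finish:
  "evals sat_machine (B + 1) (cfgC [] (int N)) 1"
proof -
  have halted: "act Halted x = []" for x by (cases x) simp
  have "silent 1 (cfg (Resume None) [] (Some (int N)) None (int N)) (cfg Halted [] None None (int N + 1))"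
    by (rule cfg_step) (auto simp: tape_def bas_Blank)
  then have "silent (B + 1) (cfgC [] (int N)) (cfg Halted [] None None (int N + 1))"
    by (rule silent_comp[OF resume_empty, rotated 2]) simp_all
  then show ?thesis
    by (rule silentD[where m = 0]) (simp_all add: cfg_def evals_halted halted)
qed

lemma finish_die:
  assumes "0 \<le> j" "j < int N"
  shows "evals sat_machine (B + 1) (cfgC [] j) 0"
proof -
  have "evals sat_machine (Suc 0) (cfg (Resume None) [] (Some j) None j) 0"
    by (rule cfg_die[where c = "Cell (bas j) Unmarked False False"]) (use assms in \<open>auto simp: tape_def bas_Blank\<close>)
  note ev = silentD[OF resume_empty this]
  show ?thesis by (rule ev) (use assms in simp_all)
qed

lemma left_paren:
  assumes "wfs j ((p, EParen k False) # s)" "j \<le> int N"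
  shows "connective k (bas j) \<Longrightarrow> silent (B + 1) (cfgC ((p, EParen k False) # s) j)
           (cfg (Operand (k = KTimes \<or> k = KRight)) ((p, EParen k True) # s) None None (j + 1))"
    and "\<not> connective k (bas j) \<Longrightarrow> evals sat_machine (B + 1) (cfgC ((p, EParen k False) # s) j) 0"
proof -
  let ?c = "cfg (Resume (Some (k, False))) ((p, EParen k True) # s) (Some j) None j"
  have r: "silent B (cfgC ((p, EParen k False) # s) j) ?c" by (rule resume_paren[OF assms]) simp
  { assume c: "connective k (bas j)"
    have "silent 1 ?c (cfg (Operand (k = KTimes \<or> k = KRight)) ((p, EParen k True) # s) None None (j + 1))"
      by (rule cfg_step) (use c in \<open>auto simp: tape_def\<close>)
    from silent_comp[OF r this] show "silent (B + 1) (cfgC ((p, EParen k False) # s) j)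
           (cfg (Operand (k = KTimes \<or> k = KRight)) ((p, EParen k True) # s) None None (j + 1))" . }
  assume c: "\<not> connective k (bas j)"
  have "evals sat_machine (Suc 0) ?c 0"
    by (rule cfg_die[where c = "tape ((p, EParen k True) # s) None None j"]) (use c in \<open>auto simp: tape_def\<close>)
  then show "evals sat_machine (B + 1) (cfgC ((p, EParen k False) # s) j) 0" by (rule silentD[OF r]) simp
qed

lemma right_paren:
  assumes "wfs j ((p, EParen k True) # s)" "j \<le> int N"
  shows "bas j = Tok RPar \<Longrightarrow> silent (2 * B + 1) (cfgC ((p, EParen k True) # s) j) (cfgC (unbind s) (j + 1))"
    and "bas j \<noteq> Tok RPar \<Longrightarrow> evals sat_machine (B + 1) (cfgC ((p, EParen k True) # s) j) 0"
proof -
  let ?c = "cfg (Resume (Some (k, True))) s (Some j) None j"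
  have r: "silent B (cfgC ((p, EParen k True) # s) j) ?c" by (rule resume_paren[OF assms]) simp
  { assume t: "bas j = Tok RPar"
    then have j: "j < int N" using bas_Blank[of j] assms by (cases "j < int N") auto
    have "silent 1 ?c (cfg Done s None None (j + 1))"
      by (rule cfg_step) (use t in \<open>auto simp: tape_def\<close>)
    note silent_comp[OF r this]
    also have "silent B (cfg Done s None None (j + 1)) (cfgC (unbind s) (j + 1))"
      by (rule close_done) (use assms j wfs_mono[of p s "j + 1"] in auto)
    finally show "silent (2 * B + 1) (cfgC ((p, EParen k True) # s) j) (cfgC (unbind s) (j + 1))"
      by (rule silent_mono) simp }
  assume c: "bas j \<noteq> Tok RPar"
  have "evals sat_machine (Suc 0) ?c 0"
    by (rule cfg_die[where c = "tape s None None j"]) (use c in \<open>auto simp: tape_def\<close>)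
  then show "evals sat_machine (B + 1) (cfgC ((p, EParen k True) # s) j) 0" by (rule silentD[OF r]) simp
qed

text \<open>
  A bit cannot follow a complete formula.
\<close>

lemma stray_bit:
  assumes "wfs j s" "0 \<le> j" "j \<le> int N" "bit_of (bas j) \<noteq> None"
  shows "evals sat_machine (B + 1) (cfgC (unbind s) j) 0"
proof -
  have j: "j < int N" using assms bas_Blank[of j] by (cases "j < int N") auto
  have wf: "wfs j (unbind s)" using wfs_unbind assms by simp
  show ?thesis
  proof (cases "unbind s" rule: unbind.cases)
    case 1
    then show ?thesis using finish_die assms j by simp
  next
    case (2 p v b t)
    then show ?thesis by (metis unbind_head)
  next
    case (3 p k d t)
    have "\<not> connective k (bas j)" "bas j \<noteq> Tok RPar" using assms(4) by (auto simp: connective_def)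
    then show ?thesis
      using left_paren(2)[of j p k t] right_paren(2)[of j p k t] wf assms(3) unfolding 3 by (cases d) simp_all
  qed
qed

end


section \<open>Positions at which a formula begins\<close>

text \<open>
  A name beginning with the bit \<open>0\<close> is complete.
\<close>

lemma binary_head: "binary n = Bit0 # bs \<Longrightarrow> bs = []"
proof (induction n arbitrary: bs rule: binary.induct)
  case (1 n)
  show ?case
  proof (cases "n < 2")
    case True
    with 1(2) show ?thesis by (subst (asm) binary.simps) auto
  next
    case False
    obtain b cs where cs: "binary (n div 2) = b # cs" using binary_not_Nil by (cases "binary (n div 2)") auto
    have "b # cs @ [if even n then Bit0 else Bit1] = Bit0 # bs"
      using 1(2) False cs by (subst (asm) binary.simps) auto
    then have "b = Bit0" by simp
    with 1(1)[OF False] cs have "cs = []" by simp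
    with cs \<open>b = Bit0\<close> have "binary (n div 2) = binary 0" by (simp add: binary.simps[of 0])
    then have "n div 2 = 0" by (rule binary_inj)
    with False show ?thesis by linarith
  qed
qed

context sat_input begin

lemma word_tok: "i < N \<Longrightarrow> (\<exists>t. w ! i = tok t) \<or> (\<exists>k. w ! i = Inr k)"
proof -
  assume "i < N"
  then have "w ! i \<in> set w" by simp
  moreover have "set w \<subseteq> Inl ` range letter \<union> range Inr"
    using words by (auto simp: words_over_def sat_alphabet_def lists_eq_set)
  ultimately have "w ! i \<in> Inl ` range letter \<union> range Inr" by blast
  then show ?thesis by auto
qed

lemma inv_letter [simp]: "inv letter (letter t) = t"
  by (rule inv_f_f) (simp add: inj_def)

lemma bas_tok: "i < N \<Longrightarrow> bas (int i) = Tok t \<longleftrightarrow> w ! i = tok t"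
  using word_tok[of i] by (auto simp: bas_def)

lemma bas_Val: "i < N \<Longrightarrow> bas (int i) = Val \<longleftrightarrow> (\<exists>k. w ! i = Inr k)"
  using word_tok[of i] by (auto simp: bas_def)

lemma drop_Cons_iff: "drop i w = x # u \<longleftrightarrow> i < N \<and> w ! i = x \<and> u = drop (Suc i) w"
  by (metis Cons_nth_drop_Suc drop_eq_Nil leI list.distinct(1) list.inject)

lemma drop_tok: "drop i w = tok t # u \<longleftrightarrow> i < N \<and> bas (int i) = Tok t \<and> u = drop (Suc i) w"
  unfolding drop_Cons_iff using bas_tok by auto

lemma no_bit_drop: "no_bit (drop i w) \<longleftrightarrow> bit_of (bas (int i)) = None"
proof (cases "i < N")
  case True
  then have "drop i w = w ! i # drop (Suc i) w" by (simp add: Cons_nth_drop_Suc)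
  moreover have "bit_of (bas (int i)) = None \<longleftrightarrow> bas (int i) \<noteq> Tok Bit0 \<and> bas (int i) \<noteq> Tok Bit1"
    by (cases "bas (int i)" rule: bit_of.cases) auto
  ultimately show ?thesis using bas_tok[OF True] by (auto simp: no_bit_def)
next
  case False
  then have "bas (int i) = Blank" using bas_Blank by simp
  with False show ?thesis by (simp add: no_bit_def)
qed

lemma run_drop:
  "set bs \<subseteq> {Bit0, Bit1} \<Longrightarrow> run (int i) bs \<longleftrightarrow>
     drop i w = map tok bs @ drop (i + length bs) w \<and> no_bit (drop (i + length bs) w)"
proof (induction bs arbitrary: i)
  case Nil
  then show ?case by (simp add: no_bit_drop)
next
  case (Cons b bs)
  have "run (int i) (b # bs) \<longleftrightarrow> bas (int i) = Tok b \<and> run (int (Suc i)) bs"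
    using Cons.prems by (auto simp: add.commute)
  also have "\<dots> \<longleftrightarrow> bas (int i) = Tok b \<and> drop (Suc i) w = map tok bs @ drop (Suc i + length bs) w
       \<and> no_bit (drop (Suc i + length bs) w)"
    using Cons.IH[of "Suc i"] Cons.prems by (metis insert_subset list.simps(15))
  also have "\<dots> \<longleftrightarrow> drop i w = tok b # map tok bs @ drop (Suc i + length bs) w
       \<and> no_bit (drop (Suc i + length bs) w)"
    unfolding drop_tok using bas_Blank[of "int i"] by (cases "i < N") auto
  finally show ?case by simp
qed

lemma run_exists: "\<exists>bs. set bs \<subseteq> {Bit0, Bit1} \<and> run (int i) bs"
proof (induction "N - i" arbitrary: i rule: less_induct)
  case less
  show ?case
  proof (cases "bas (int i) = Tok Bit0 \<or> bas (int i) = Tok Bit1")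
    case True
    then have "i < N" using bas_Blank[of "int i"] by (cases "i < N") auto
    then have "\<exists>bs. set bs \<subseteq> {Bit0, Bit1} \<and> run (int (Suc i)) bs"
      by (intro less) auto
    then obtain bs where "set bs \<subseteq> {Bit0, Bit1}" "run (int (Suc i)) bs" by blast
    with True show ?thesis
      by (intro exI[of _ "(if bas (int i) = Tok Bit0 then Bit0 else Bit1) # bs"]) (auto simp: add.commute)
  next
    case False
    then have "run (int i) []" by (cases "bas (int i)" rule: bit_of.cases) auto
    then show ?thesis by (intro exI[of _ "[]"]) simp
  qed
qed

lemma run_length: "run (int i) bs \<Longrightarrow> i \<le> N \<Longrightarrow> i + length bs \<le> N"
proof (induction bs arbitrary: i)
  case (Cons b bs)
  then have "i < N" using bas_Blank[of "int i"] by (cases "i < N") auto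
  with Cons.IH[of "Suc i"] Cons.prems(1) show ?case by (auto simp: add.commute)
qed simp

text \<open>
  The bound variables and their truth values, according to the stack.
\<close>

definition names :: "stack \<Rightarrow> nat set" where
  "names stk = {v. lookup (binary v) stk \<noteq> None}"

definition env :: "stack \<Rightarrow> nat \<Rightarrow> bool" where
  "env stk v = (case lookup (binary v) stk of None \<Rightarrow> False | Some (p, b) \<Rightarrow> b)"

lemma names_simps [simp]:
  "names ((p, EParen k d) # s) = names s" "names ((p, EBind v b) # s) = insert v (names s)" "names [] = {}"
  by (auto simp: names_def dest: binary_inj)

lemma env_simps [simp]:
  "env ((p, EParen k d) # s) = env s" "env ((p, EBind v b) # s) = (env s)(v := b)"
  by (auto simp: env_def fun_eq_iff dest: binary_inj)

text \<open>
  The value in front of the formula \<open>\<alpha>\<close> if \<open>V\<close> is the value behind it: an evaluated formula multiplies by its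
  semantics, a skipped one does not change the value, and an unbound variable gives \<open>0\<close> in any case.
\<close>

definition vl :: "bool \<Rightarrow> 'r wqbf \<Rightarrow> stack \<Rightarrow> 'r \<Rightarrow> 'r" where
  "vl md \<alpha> stk V = (if free_vars \<alpha> \<subseteq> names stk then if md then esem \<alpha> (env stk) * V else V else 0)"

lemma vl_EParen [simp]: "vl md \<alpha> ((p, EParen k d) # s) V = vl md \<alpha> s V"
  by (simp add: vl_def)

lemma vl_zero [simp]: "vl md \<alpha> s 0 = 0"
  by (simp add: vl_def)

text \<open>
  The formula \<open>\<alpha>\<close> is written at the positions from \<open>i\<close> to \<open>j - 1\<close>. The condition on the next symbol makes
  \<open>\<alpha>\<close> and \<open>j\<close> unique, because a bit would continue the name of a final variable.
\<close>

definition good :: "nat \<Rightarrow> 'r wqbf \<Rightarrow> nat \<Rightarrow> bool" where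
  "good i \<alpha> j \<longleftrightarrow> j \<le> N \<and> drop i w = encode \<alpha> @ drop j w \<and> no_bit (drop j w) \<and> only_sum_quantifiers \<alpha>"

text \<open>
  In the state \<open>q\<close> the machine treats the symbol at position \<open>i\<close> as the beginning of a formula. Besides
  \<open>Operand md\<close> these are the states that have just read the name of a quantified variable, whose end is
  recognised only by the symbol that follows.
\<close>

definition opens :: "state \<Rightarrow> bool \<Rightarrow> nat \<Rightarrow> bool" where
  "opens q md i \<longleftrightarrow> (\<forall>m p r. act q (Cell (bas (int i)) m p r) = operand md (bas (int i)) m p r)"

lemma opens_Operand [simp]: "opens (Operand md) md i"
  by (simp add: opens_def)

lemma encode_not_Nil: "encode \<alpha> \<noteq> []"
  by (cases \<alpha> rule: encode.cases) (auto simp: encode_var_def)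

lemma good_length: "good i \<alpha> j \<Longrightarrow> i < j \<and> j = i + length (encode \<alpha>)"
proof -
  assume "good i \<alpha> j"
  then have j: "j \<le> N" and d: "drop i w = encode \<alpha> @ drop j w" by (auto simp: good_def)
  from arg_cong[OF d, of length] have "N - i = length (encode \<alpha>) + (N - j)" by simp
  moreover have "length (encode \<alpha>) > 0" using encode_not_Nil by simp
  ultimately show ?thesis using j by linarith
qed

lemma drop_append_drop: "drop i w = u @ drop j w \<Longrightarrow> drop (i + length u) w = drop j w"
  by (metis add.commute append_eq_conv_conj drop_drop)

lemma good_split:
  assumes "drop i w = encode \<alpha> @ u" "no_bit u" "only_sum_quantifiers \<alpha>"
  shows "good i \<alpha> (i + length (encode \<alpha>)) \<and> u = drop (i + length (encode \<alpha>)) w"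
proof -
  have u: "u = drop (i + length (encode \<alpha>)) w"
    using assms(1) by (metis add.commute append_eq_conv_conj drop_drop)
  from arg_cong[OF assms(1), of length] have "N - i = length (encode \<alpha>) + length u" by simp
  moreover have "length (encode \<alpha>) > 0" using encode_not_Nil by simp
  ultimately have "i + length (encode \<alpha>) \<le> N" by linarith
  with assms u show ?thesis by (simp add: good_def)
qed

lemma cost_ge: "4 * B \<le> cost" "B + 2 \<le> cost" "Suc 0 \<le> cost"
  by (auto simp: cost_def)

text \<open>
  The machine reads the name of a quantified variable.
\<close>

lemma pass_binder:
  assumes "bas (int i + 1) = Tok VarTok" "run (int i + 2) (binary v)"
  obtains q where "opens q md (i + 2 + length (binary v))"
    "silent (length (binary v) + 1) (cfg (BinderVar md) stk None None (int i + 1))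
       (cfg q stk None None (int (i + 2 + length (binary v))))"
proof -
  obtain b bs where b: "binary v = b # bs" using binary_not_Nil by (cases "binary v") auto
  have bit: "b = Bit0 \<or> b = Bit1" using binary_bits[of v] b by auto
  have stop: "bit_of (bas (int (i + 2 + length (binary v)))) = None"
  proof -
    have "run x cs \<Longrightarrow> bit_of (bas (x + int (length cs))) = None" for x cs
    proof (induction cs arbitrary: x)
      case (Cons c cs)
      from Cons.IH[of "x + 1"] Cons.prems show ?case by (simp add: algebra_simps)
    qed simp
    from this[OF assms(2)] show ?thesis by (simp add: algebra_simps)
  qed
  define q where "q = (if b = Bit0 then BinderEnd md else BinderBits md)"
  have "silent 1 (cfg (BinderVar md) stk None None (int i + 1)) (cfg (BinderBit md) stk None None (int i + 2))"
    by (rule cfg_step) (use assms in \<open>auto simp: tape_def\<close>)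
  also have "silent 1 \<dots> (cfg q stk None None (int i + 3))"
    by (rule cfg_step) (use assms b bit in \<open>auto simp: tape_def q_def\<close>)
  also have "silent (nat (int (i + 2 + length (binary v)) - (int i + 3))) \<dots>
      (cfg q stk None None (int (i + 2 + length (binary v))))"
  proof (cases "b = Bit0")
    case True
    then have "bs = []" using binary_head b by simp
    with b have e: "int (i + 2 + length (binary v)) = int i + 3" by simp
    show ?thesis unfolding e by (rule silent_refl)
  next
    case False
    show ?thesis
    proof (rule cfg_right)
      fix x assume "int i + 3 \<le> x" "x < int (i + 2 + length (binary v))"
      then show "act q (tape stk None None x) = [(q, tape stk None None x, 1, WOne)]"
        using run_bits[OF assms(2), of x] False by (auto simp: q_def tape_def)
    qed (use b in simp)
  qed
  finally have "silent (length (binary v) + 1) (cfg (BinderVar md) stk None None (int i + 1))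
       (cfg q stk None None (int (i + 2 + length (binary v))))"
    by (rule silent_mono) (use b in simp)
  moreover have "opens q md (i + 2 + length (binary v))"
    using stop by (auto simp: opens_def q_def)
  ultimately show thesis by (rule that[rotated])
qed

text \<open>
  The body of a parenthesis \<open>(\<alpha> c \<beta>)\<close> under the guess \<open>k\<close>. If the guess does not fit the connective,
  then the value behind \<open>\<alpha>\<close> is \<open>0\<close>.
\<close>

lemma binary_operation:
  assumes stk: "wfs (int i) stk" "j \<le> N"
    and al: "\<And>md stk V t. wfs (int (Suc i)) stk \<Longrightarrow> evals sat_machine t (cfgC (unbind stk) (int j1)) V \<Longrightarrow>
      evals sat_machine (t + (j1 - Suc i) * cost) (cfg (Operand md) stk None None (int (Suc i))) (vl md \<alpha> stk V)"
    and be: "\<And>md stk V t. wfs (int (Suc j1)) stk \<Longrightarrow> evals sat_machine t (cfgC (unbind stk) (int j2)) V \<Longrightarrow>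
      evals sat_machine (t + (j2 - Suc j1) * cost) (cfg (Operand md) stk None None (int (Suc j1))) (vl md \<beta> stk V)"
    and pos: "i < j1" "j1 < j2" "j = Suc j2" "bas (int j2) = Tok RPar"
    and V: "evals sat_machine t (cfgC (unbind stk) (int j)) V"
  shows "evals sat_machine (t + (j - i - 1) * cost) (cfg (Operand md) ((int i, EParen k False) # stk) None None (int (Suc i)))
     (vl md \<alpha> stk (if connective k (bas (int j1)) then vl (k = KTimes \<or> k = KRight) \<beta> stk V else 0))"
proof -
  let ?s = "\<lambda>d. (int i, EParen k d) # stk"
  have wf: "wfs x (?s d)" if "int i < x" for x d
    using stk that wfs_mono by simp
  have mid: "evals sat_machine (t + (2 * B + 1) + (j2 - Suc j1) * cost + (B + 1)) (cfgC (?s False) (int j1))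
     (if connective k (bas (int j1)) then vl (k = KTimes \<or> k = KRight) \<beta> stk V else 0)"
  proof (cases "connective k (bas (int j1))")
    case True
    have "evals sat_machine (t + (2 * B + 1)) (cfgC (unbind (?s True)) (int j2)) V"
      unfolding unbind.simps
      by (rule silentD[OF right_paren(1) V[unfolded pos(3) int_Suc]]) (use pos stk wf in auto)
    then have ev: "evals sat_machine (t + (2 * B + 1) + (j2 - Suc j1) * cost)
        (cfg (Operand (k = KTimes \<or> k = KRight)) (?s True) None None (int j1 + 1)) (vl (k = KTimes \<or> k = KRight) \<beta> (?s True) V)"
      unfolding int_Suc[symmetric] by (intro be wf) (use pos in auto)
    have "evals sat_machine (t + (2 * B + 1) + (j2 - Suc j1) * cost + (B + 1)) (cfgC (?s False) (int j1))
        (vl (k = KTimes \<or> k = KRight) \<beta> (?s True) V)"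
      by (rule silentD[OF left_paren(1)[OF wf] ev]) (use True pos stk in auto)
    with True show ?thesis by simp
  next
    case False
    have "evals sat_machine (B + 1) (cfgC (?s False) (int j1)) 0"
      by (rule left_paren(2)[OF wf]) (use False pos stk in auto)
    from evals_mono[OF this] False show ?thesis by simp
  qed
  have "evals sat_machine (t + (2 * B + 1) + (j2 - Suc j1) * cost + (B + 1) + (j1 - Suc i) * cost)
     (cfg (Operand md) (?s False) None None (int (Suc i)))
     (vl md \<alpha> (?s False) (if connective k (bas (int j1)) then vl (k = KTimes \<or> k = KRight) \<beta> stk V else 0))"
    by (rule al) (use wf mid stk in auto)
  moreover have "t + (2 * B + 1) + (j2 - Suc j1) * cost + (B + 1) + (j1 - Suc i) * cost \<le> t + (j - i - 1) * cost"
  proof -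
    have "j - i - 1 = (j2 - Suc j1) + (j1 - Suc i) + 2" using pos by simp
    then have "(j - i - 1) * cost = (j2 - Suc j1) * cost + (j1 - Suc i) * cost + 2 * cost"
      by (simp add: algebra_simps)
    then show ?thesis using cost_ge by linarith
  qed
  ultimately have "evals sat_machine (t + (j - i - 1) * cost) (cfg (Operand md) (?s False) None None (int (Suc i)))
     (vl md \<alpha> (?s False) (if connective k (bas (int j1)) then vl (k = KTimes \<or> k = KRight) \<beta> stk V else 0))"
    by (rule evals_mono)
  then show ?thesis by (simp only: vl_EParen)
qed

lemma operand_step:
  assumes "opens q md i" "operand md (bas (int i)) (marks stk (int i)) False False = map (\<lambda>(q', s', v). (q', tape s' None None (int i), 1, WOne)) xs" "xs \<noteq> []"
    and "wfs (int i) stk"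
    and "\<And>q' s' v. (q', s', v) \<in> set xs \<Longrightarrow> (\<exists>e. s' = (int i, e) # stk) \<and> evals sat_machine k (cfg q' s' None None (int i + 1)) v"
  shows "evals sat_machine (Suc k) (cfg q stk None None (int i)) (\<Sum>(q', s', v)\<leftarrow>xs. v)"
proof (rule evals_choice[OF _ assms(3)])
  show "act q (tape stk None None (int i)) = map (\<lambda>(q', s', v). (q', tape s' None None (int i), 1, WOne)) xs"
    using assms(1,2) by (simp add: opens_def tape_def)
  fix q' s' v x assume "(q', s', v) \<in> set xs"
  from assms(5)[OF this]
  show "x \<noteq> int i \<Longrightarrow> tape s' None None x = tape stk None None x"
    and "evals sat_machine k (cfg q' s' None None (int i + 1)) v" by (auto simp: tape_def)
qed

text \<open>
  The values \<open>X md k\<close> of the branches, where \<open>md\<close> is the mode of the left operand and \<open>k\<close> the guess.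
\<close>

lemma operand_paren:
  assumes "bas (int i) = Tok LPar" "wfs (int i) stk" "opens q md i"
    and "\<And>k md. evals sat_machine t (cfg (Operand md) ((int i, EParen k False) # stk) None None (int (Suc i))) (X md k)"
  shows "evals sat_machine (Suc t) (cfg q stk None None (int i))
     (if md then X True KTimes + (X True KLeft + X False KRight) else X False KSkip)"
proof (cases md)
  case True
  from operand_step[OF assms(3), of stk "[(Operand True, (int i, EParen KTimes False) # stk, X True KTimes),
      (Operand True, (int i, EParen KLeft False) # stk, X True KLeft),
      (Operand False, (int i, EParen KRight False) # stk, X False KRight)]" t] assms(1,2,4) True
  show ?thesis by (auto simp: operand_def tape_def add.commute)
next
  case False
  from operand_step[OF assms(3), of stk "[(Operand False, (int i, EParen KSkip False) # stk, X False KSkip)]" t] assms(1,2,4) False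
  show ?thesis by (auto simp: operand_def tape_def add.commute)
qed

lemma operand_quantifier:
  assumes "bas (int i) = Tok SumTok" "wfs (int i) stk" "opens q md i"
    and "\<And>b. evals sat_machine t (cfg (BinderVar md) ((int i, EBind v b) # stk) None None (int i + 1)) (X b)"
  shows "evals sat_machine (Suc t) (cfg q stk None None (int i)) (if md then X True + X False else X True)"
proof (cases md)
  case True
  from operand_step[OF assms(3), of stk "[(BinderVar True, (int i, EBind v True) # stk, X True),
      (BinderVar True, (int i, EBind v False) # stk, X False)]" t] assms(1,2,4) True
  show ?thesis by (auto simp: operand_def tape_def)
next
  case False
  from operand_step[OF assms(3), of stk "[(BinderVar False, (int i, EBind v True) # stk, X True)]" t] assms(1,2,4) False
  show ?thesis by (auto simp: operand_def tape_def)
qed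

lemma operand_variable:
  assumes "bas (int i) = Tok VarTok" "wfs (int i) stk" "opens q md i"
    and "evals sat_machine t (cfg (Seek True md) stk (Some (int i)) None (int i - 1)) v"
  shows "evals sat_machine (Suc t) (cfg q stk None None (int i)) v"
  by (rule silentD[OF cfg_step assms(4)]) (use assms in \<open>auto simp: opens_def operand_def tape_def\<close>)

lemma operand_negated:
  assumes "bas (int i) = Tok NegTok" "bas (int i + 1) = Tok VarTok" "wfs (int i) stk" "opens q md i"
    and "evals sat_machine t (cfg (Seek False md) stk (Some (int i + 1)) None (int i)) v"
  shows "evals sat_machine (t + 2) (cfg q stk None None (int i)) v"
proof -
  have "silent 1 (cfg q stk None None (int i)) (cfg (Negated md) stk None None (int i + 1))"
    by (rule cfg_step) (use assms in \<open>auto simp: opens_def operand_def tape_def\<close>)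
  also have "silent 1 \<dots> (cfg (Seek False md) stk (Some (int i + 1)) None (int i))"
    by (rule cfg_step) (use assms in \<open>auto simp: tape_def\<close>)
  finally show ?thesis by (rule silentD[OF _ assms(5)]) simp
qed

lemma operand_constant:
  assumes "bas (int i) = Val" "wfs (int i) stk" "opens q md i" "i < N"
    and "evals sat_machine t (cfgC (unbind stk) (int (Suc i))) V"
  shows "evals sat_machine (t + B + 1) (cfg q stk None None (int i)) (if md then vals (int i) * V else V)"
proof -
  have "evals sat_machine (t + B) (cfg Done stk None None (int i + 1)) V"
    by (rule silentD[OF close_done])
       (use assms wfs_mono[of "int i" stk "int i + 1"] in \<open>auto simp: add.commute\<close>)
  from evals_one[OF _ _ this, of q stk None None "int i" "if md then WVal else WOne"] assms
  show ?thesis by (auto simp: opens_def operand_def tape_def)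
qed

end


section \<open>Evaluation of a formula\<close>

context sat_input begin

lemma Suc_cost: "i < j \<Longrightarrow> Suc (t + (j - i - 1) * cost) \<le> t + (j - i) * cost"
  using cost_ge(3) by (auto simp: less_iff_Suc_add)

lemma operand_binary:
  assumes good: "good i \<gamma> j" "(\<gamma>, c) \<in> {(Plus \<alpha> \<beta>, PlusTok), (Times \<alpha> \<beta>, TimesTok)}"
    and al: "\<And>i j stk md t V. good i \<alpha> j \<Longrightarrow> wfs (int i) stk \<Longrightarrow> evals sat_machine t (cfgC (unbind stk) (int j)) V \<Longrightarrow>
      evals sat_machine (t + (j - i) * cost) (cfg (Operand md) stk None None (int i)) (vl md \<alpha> stk V)"
    and be: "\<And>i j stk md t V. good i \<beta> j \<Longrightarrow> wfs (int i) stk \<Longrightarrow> evals sat_machine t (cfgC (unbind stk) (int j)) V \<Longrightarrow>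
      evals sat_machine (t + (j - i) * cost) (cfg (Operand md) stk None None (int i)) (vl md \<beta> stk V)"
    and stk: "wfs (int i) stk" "opens q md i" and V: "evals sat_machine t (cfgC (unbind stk) (int j)) V"
  defines "X \<equiv> \<lambda>md k. vl md \<alpha> stk (if connective k (Tok c) then vl (k = KTimes \<or> k = KRight) \<beta> stk V else 0)"
  shows "evals sat_machine (t + (j - i) * cost) (cfg q stk None None (int i))
     (if md then X True KTimes + (X True KLeft + X False KRight) else X False KSkip)"
proof -
  define j1 where "j1 = Suc i + length (encode \<alpha>)"
  define j2 where "j2 = Suc j1 + length (encode \<beta>)"
  from good have d: "drop i w = tok LPar # encode \<alpha> @ tok c # encode \<beta> @ tok RPar # drop j w"
    and o: "only_sum_quantifiers \<alpha>" "only_sum_quantifiers \<beta>" "j \<le> N" by (auto simp: good_def)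
  have c: "c = PlusTok \<or> c = TimesTok" using good(2) by auto
  have d1: "bas (int i) = Tok LPar" "drop (Suc i) w = encode \<alpha> @ tok c # encode \<beta> @ tok RPar # drop j w"
    using d unfolding drop_tok by simp_all
  have g1: "good (Suc i) \<alpha> j1" and "drop j1 w = tok c # encode \<beta> @ tok RPar # drop j w"
    using good_split[OF d1(2)] o c by (auto simp: j1_def)
  then have d2: "bas (int j1) = Tok c" "drop (Suc j1) w = encode \<beta> @ tok RPar # drop j w"
    unfolding drop_tok by simp_all
  from good_split[OF d2(2)] o have g2: "good (Suc j1) \<beta> j2" and "drop j2 w = tok RPar # drop j w"
    by (simp_all add: j2_def)
  then have d3: "bas (int j2) = Tok RPar" unfolding drop_tok by simp
  have j: "j = Suc j2" using good_length[OF good(1)] good(2) by (auto simp: j1_def j2_def)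
  have pos: "i < j1" "j1 < j2" using good_length[OF g1] good_length[OF g2] by simp_all
  have "evals sat_machine (t + (j - i - 1) * cost) (cfg (Operand md) ((int i, EParen k False) # stk) None None (int (Suc i))) (X md k)"
    for md k
    unfolding X_def d2(1)[symmetric]
    by (rule binary_operation[OF stk(1) o(3) al[OF g1] be[OF g2] pos j d3 V])
  from operand_paren[OF d1(1) stk this]
  have "evals sat_machine (Suc (t + (j - i - 1) * cost)) (cfg q stk None None (int i))
     (if md then X True KTimes + (X True KLeft + X False KRight) else X False KSkip)" .
  then show ?thesis
    by (rule evals_mono) (use good_length[OF good(1)] in \<open>intro Suc_cost; simp\<close>)
qed

text \<open>
  If the value of the configuration behind a formula is \<open>V\<close>, then the value in front of it is the product
  of \<open>V\<close> and the semantics of the formula. By induction on the formula; the time is proportional to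
  its length.
\<close>

lemma operand_evals:
  "good i \<alpha> j \<Longrightarrow> wfs (int i) stk \<Longrightarrow> opens q md i \<Longrightarrow> evals sat_machine t (cfgC (unbind stk) (int j)) V \<Longrightarrow>
   evals sat_machine (t + (j - i) * cost) (cfg q stk None None (int i)) (vl md \<alpha> stk V)"
proof (induction \<alpha> arbitrary: i j stk q md t V)
  case (Const k)
  from Const.prems(1) good_length[OF Const.prems(1)]
  have d: "i < N" "w ! i = Inr k" "j = Suc i"
    by (auto simp: good_def drop_Cons_iff)
  then have "bas (int i) = Val" "vals (int i) = k" by (auto simp: bas_def vals_def)
  from operand_constant[OF this(1) Const.prems(2,3) d(1) Const.prems(4)[unfolded d(3)]] this(2)
  have "evals sat_machine (t + B + 1) (cfg q stk None None (int i)) (vl md (Const k) stk V)"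
    by (cases md) (simp_all add: vl_def)
  then show ?case by (rule evals_mono) (use d cost_ge in simp)
next
  case (Lit l)
  have lit: "evals sat_machine (t + cost) (cfg (Seek s md) stk (Some (int m)) None (int m - 1)) (vl md (Lit l) stk V)"
    if l: "l = (if s then PosLit v else NegLit v)" and m: "bas (int m) = Tok VarTok" "run (int (Suc m)) (binary v)"
      "j = Suc m + length (binary v)" "wfs (int m) stk" for s v m
  proof -
    have j: "int m + 1 + int (length (binary v)) = int j" "j \<le> N" using m Lit.prems(1) by (auto simp: good_def)
    have r: "run (int m + 1) (binary v)" using m(2) by (simp add: add.commute)
    note L = literal[where md = md and s = s, OF m(4,1) r, unfolded j(1)]
    have fv: "free_vars (Lit l :: 'r wqbf) = {v}" using l by simp
    show ?thesis
    proof (cases "lookup (binary v) stk")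
      case None
      then have "v \<notin> names stk" by (simp add: names_def)
      then have "vl md (Lit l) stk V = 0" by (simp add: vl_def fv)
      with evals_mono[OF L(1)[OF _ _ None]] j(2) show ?thesis by simp
    next
      case (Some pb)
      then obtain p b where pb: "lookup (binary v) stk = Some (p, b)" by (cases pb) auto
      then have e: "v \<in> names stk" "env stk v = b" by (auto simp: names_def env_def)
      show ?thesis
      proof (cases "md \<and> b \<noteq> s")
        case True
        then have "vl md (Lit l) stk V = 0" using e l by (auto simp: vl_def fv)
        with evals_mono[OF L(2)[OF _ _ pb True]] j(2) show ?thesis by simp
      next
        case False
        then have "vl md (Lit l) stk V = V" using e l by (auto simp: vl_def fv)
        with silentD[OF L(3)[OF _ _ pb False] Lit.prems(4)] j(2) show ?thesis by simp
      qed
    qed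
  qed
  have len: "cost + t + 2 \<le> t + (j - i) * cost" if "Suc i < j"
  proof -
    have "2 * cost \<le> (j - i) * cost" using that by (intro mult_le_mono1) simp
    then show ?thesis using cost_ge by linarith
  qed
  show ?case
  proof (cases l)
    case (PosLit v)
    with Lit.prems(1) have d: "drop i w = tok VarTok # map tok (binary v) @ drop j w"
      by (simp add: good_def encode_var_def)
    then have d': "bas (int i) = Tok VarTok" "drop (Suc i) w = map tok (binary v) @ drop j w" "i < N"
      unfolding drop_tok by simp_all
    have j: "j = Suc i + length (binary v)"
      using good_length[OF Lit.prems(1)] PosLit by (simp add: encode_var_def)
    with d' Lit.prems(1) have "run (int (Suc i)) (binary v)"
      using run_drop[OF binary_bits, of "Suc i" v] by (simp add: good_def)
    from operand_variable[OF d'(1) Lit.prems(2,3) lit[of True v i, OF _ d'(1) this j Lit.prems(2)]] PosLit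
    have "evals sat_machine (Suc (t + cost)) (cfg q stk None None (int i)) (vl md (Lit l) stk V)" by simp
    moreover have "Suc i < j" using binary_not_Nil j by simp
    from len[OF this] have "Suc (t + cost) \<le> t + (j - i) * cost" by linarith
    ultimately show ?thesis by (rule evals_mono)
  next
    case (NegLit v)
    with Lit.prems(1) have d: "drop i w = tok NegTok # tok VarTok # map tok (binary v) @ drop j w"
      by (simp add: good_def encode_var_def)
    have neg: "bas (int i) = Tok NegTok" "drop (Suc i) w = tok VarTok # map tok (binary v) @ drop j w"
      using d[unfolded drop_tok] by simp_all
    from neg(2) have "bas (int (Suc i)) = Tok VarTok" "drop (Suc (Suc i)) w = map tok (binary v) @ drop j w"
      unfolding drop_tok by simp_all
    note d' = neg(1) this
    have j: "j = Suc (Suc i) + length (binary v)"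
      using good_length[OF Lit.prems(1)] NegLit by (simp add: encode_var_def)
    with d' Lit.prems(1) have r: "run (int (Suc (Suc i))) (binary v)"
      using run_drop[OF binary_bits, of "Suc (Suc i)" v] by (simp add: good_def)
    have "evals sat_machine (t + cost) (cfg (Seek False md) stk (Some (int (Suc i))) None (int (Suc i) - 1)) (vl md (Lit l) stk V)"
      by (rule lit[OF _ d'(2) r j]) (use NegLit Lit.prems(2) wfs_mono[of "int i" stk] in auto)
    with operand_negated[OF d'(1) _ Lit.prems(2,3)] d'(2)
    have "evals sat_machine (t + cost + 2) (cfg q stk None None (int i)) (vl md (Lit l) stk V)"
      by (simp add: add.commute)
    then show ?thesis by (rule evals_mono) (use len j in simp)
  qed
next
  case (Plus \<alpha> \<beta>)
  have "evals sat_machine (t + (j - i) * cost) (cfg q stk None None (int i))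
     (if md then vl True \<alpha> stk 0 + (vl True \<alpha> stk (vl False \<beta> stk V) + vl False \<alpha> stk (vl True \<beta> stk V))
      else vl False \<alpha> stk (vl False \<beta> stk V))"
    using operand_binary[OF Plus.prems(1) _ Plus.IH(1)[OF _ _ opens_Operand] Plus.IH(2)[OF _ _ opens_Operand] Plus.prems(2-4), of PlusTok]
    by (cases md) (simp_all add: connective_def)
  also have "(if md then vl True \<alpha> stk 0 + (vl True \<alpha> stk (vl False \<beta> stk V) + vl False \<alpha> stk (vl True \<beta> stk V))
      else vl False \<alpha> stk (vl False \<beta> stk V)) = vl md (Plus \<alpha> \<beta>) stk V"
    by (simp add: vl_def distrib_right)
  finally show ?case .
next
  case (Times \<alpha> \<beta>)
  have "evals sat_machine (t + (j - i) * cost) (cfg q stk None None (int i))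
     (if md then vl True \<alpha> stk (vl True \<beta> stk V) + (vl True \<alpha> stk 0 + vl False \<alpha> stk 0)
      else vl False \<alpha> stk (vl False \<beta> stk V))"
    using operand_binary[OF Times.prems(1) _ Times.IH(1)[OF _ _ opens_Operand] Times.IH(2)[OF _ _ opens_Operand] Times.prems(2-4), of TimesTok]
    by (cases md) (simp_all add: connective_def)
  also have "(if md then vl True \<alpha> stk (vl True \<beta> stk V) + (vl True \<alpha> stk 0 + vl False \<alpha> stk 0)
      else vl False \<alpha> stk (vl False \<beta> stk V)) = vl md (Times \<alpha> \<beta>) stk V"
    by (simp add: vl_def mult.assoc)
  finally show ?case .
next
  case (SumQ v \<alpha>)
  define i' where "i' = i + 2 + length (binary v)"
  from SumQ.prems(1) have d: "drop i w = tok SumTok # tok VarTok # map tok (binary v) @ encode \<alpha> @ drop j w"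
    and o: "only_sum_quantifiers \<alpha>" "j \<le> N" "no_bit (drop j w)" by (auto simp: good_def encode_var_def)
  have quant: "bas (int i) = Tok SumTok" "drop (Suc i) w = tok VarTok # map tok (binary v) @ encode \<alpha> @ drop j w"
    using d[unfolded drop_tok] by simp_all
  from quant(2) have "bas (int i + 1) = Tok VarTok" "drop (Suc (Suc i)) w = map tok (binary v) @ encode \<alpha> @ drop j w"
    unfolding drop_tok by (simp_all add: add.commute)
  note d' = quant(1) this
  have i': "drop i' w = encode \<alpha> @ drop j w"
    using drop_append_drop[of "Suc (Suc i)" "map tok (binary v)"] d'(3)
    unfolding i'_def by (metis add.assoc add_2_eq_Suc' append_eq_conv_conj drop_drop add.commute length_map)
  with o have g: "good i' \<alpha> j" by (simp add: good_def)
  have r: "run (int i + 2) (binary v)"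
    using run_drop[OF binary_bits, of "Suc (Suc i)" v] d'(3) i' by (simp add: i'_def add.commute)
  have wf: "wfs (int i') ((int i, EBind v b) # stk)" for b
    using SumQ.prems(2) d' r by (simp add: i'_def)
  have "evals sat_machine (t + (j - i') * cost + (length (binary v) + 1))
        (cfg (BinderVar md) ((int i, EBind v b) # stk) None None (int i + 1)) (vl md \<alpha> ((int i, EBind v b) # stk) V)" for b
  proof -
    obtain q' where q': "opens q' md i'" and
      s: "silent (length (binary v) + 1) (cfg (BinderVar md) ((int i, EBind v b) # stk) None None (int i + 1))
       (cfg q' ((int i, EBind v b) # stk) None None (int i'))"
      unfolding i'_def by (rule pass_binder[OF d'(2) r])
    have "evals sat_machine (t + (j - i') * cost) (cfg q' ((int i, EBind v b) # stk) None None (int i')) (vl md \<alpha> ((int i, EBind v b) # stk) V)"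
      by (rule SumQ.IH[OF g wf q']) (use SumQ.prems(4) in simp)
    from silentD[OF s this] show ?thesis by simp
  qed
  from operand_quantifier[OF d'(1) SumQ.prems(2,3) this]
  have 1: "evals sat_machine (Suc (t + (j - i') * cost + (length (binary v) + 1))) (cfg q stk None None (int i))
     (if md then vl md \<alpha> ((int i, EBind v True) # stk) V + vl md \<alpha> ((int i, EBind v False) # stk) V
      else vl md \<alpha> ((int i, EBind v True) # stk) V)" .
  have 2: "(if md then vl md \<alpha> ((int i, EBind v True) # stk) V + vl md \<alpha> ((int i, EBind v False) # stk) V
      else vl md \<alpha> ((int i, EBind v True) # stk) V) = vl md (SumQ v \<alpha>) stk V"
    by (auto simp: vl_def distrib_right)
  have 3: "Suc (t + (j - i') * cost + (length (binary v) + 1)) \<le> t + (j - i) * cost"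
  proof -
    have "i' < j" using good_length[OF g] by blast
    then have "j - i = (j - i') + (length (binary v) + 2)" by (simp add: i'_def)
    then have "(j - i) * cost = (j - i') * cost + (length (binary v) + 2) * cost"
      by (simp only: add_mult_distrib)
    moreover have "(length (binary v) + 2) * 1 \<le> (length (binary v) + 2) * cost"
      using cost_ge(3) by (intro mult_le_mono2) simp
    moreover have "c = a + d \<Longrightarrow> (l + 2) * 1 \<le> d \<Longrightarrow> Suc (t + a + (l + 1)) \<le> t + c" for a c d l :: nat by simp
    ultimately show ?thesis by blast
  qed
  show ?case by (rule evals_mono[OF 1[unfolded 2] 3])
next
  case (ProdQ v \<alpha>)
  then show ?case by (simp add: good_def)
qed

end


section \<open>Ill-formed input, and membership of SAT\<close>

context sat_input begin

lemma lookup_Some: "lookup bs stk = Some x \<Longrightarrow> \<exists>v. binary v = bs"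
  by (induction bs stk rule: lookup.induct) (auto split: if_splits)

lemma bas_Tok_less: "bas (int i) = Tok t \<Longrightarrow> i < N"
  using bas_Blank[of "int i"] by (cases "i < N") auto

lemma good_binary_operation:
  assumes "bas (int i) = Tok LPar" "good (Suc i) \<alpha> j1" "bas (int j1) = Tok PlusTok \<or> bas (int j1) = Tok TimesTok"
    "good (Suc j1) \<beta> j2" "bas (int j2) = Tok RPar" "no_bit (drop (Suc j2) w)"
  shows "\<exists>\<gamma>. good i \<gamma> (Suc j2)"
proof -
  define c where "c = (if bas (int j1) = Tok PlusTok then PlusTok else TimesTok)"
  have c: "bas (int j1) = Tok c" using assms(3) by (auto simp: c_def)
  have "drop i w = tok LPar # drop (Suc i) w" "drop j1 w = tok c # drop (Suc j1) w" "drop j2 w = tok RPar # drop (Suc j2) w"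
    unfolding drop_tok using assms c bas_Tok_less by auto
  with assms have "drop i w = tok LPar # encode \<alpha> @ tok c # encode \<beta> @ tok RPar # drop (Suc j2) w"
    by (simp add: good_def)
  moreover have "Suc j2 \<le> N" using bas_Tok_less[OF assms(5)] by simp
  ultimately have "good i (if c = PlusTok then Plus \<alpha> \<beta> else Times \<alpha> \<beta>) (Suc j2)"
    using assms by (auto simp: good_def c_def)
  then show ?thesis by blast
qed

lemma good_literal:
  assumes "bas (int i) = Tok VarTok" "run (int (Suc i)) (binary v)"
  shows "good i (Lit (PosLit v)) (Suc i + length (binary v))"
proof -
  have "drop i w = tok VarTok # drop (Suc i) w" unfolding drop_tok using assms bas_Tok_less by auto
  moreover have "Suc i + length (binary v) \<le> N"
    using run_length[OF assms(2)] bas_Tok_less[OF assms(1)] by simp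
  ultimately show ?thesis
    using assms(2) run_drop[OF binary_bits, of "Suc i" v] by (simp add: good_def encode_var_def)
qed

lemma good_negated:
  assumes "bas (int i) = Tok NegTok" "bas (int (Suc i)) = Tok VarTok" "run (int (Suc (Suc i))) (binary v)"
  shows "good i (Lit (NegLit v)) (Suc (Suc i) + length (binary v))"
proof -
  have "drop i w = tok NegTok # drop (Suc i) w" unfolding drop_tok using assms bas_Tok_less by auto
  with good_literal[OF assms(2,3)] show ?thesis by (simp add: good_def)
qed

lemma good_quantifier:
  assumes "bas (int i) = Tok SumTok" "bas (int (Suc i)) = Tok VarTok" "run (int (Suc (Suc i))) (binary v)"
    "good (Suc (Suc i) + length (binary v)) \<alpha> j"
  shows "good i (SumQ v \<alpha>) j"
proof -
  have "drop i w = tok SumTok # drop (Suc i) w" "drop (Suc i) w = tok VarTok # drop (Suc (Suc i)) w"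
    unfolding drop_tok using assms(1,2) bas_Tok_less by auto
  then show ?thesis
    using assms(3,4) run_drop[OF binary_bits, of "Suc (Suc i)" v] by (simp add: good_def encode_var_def)
qed

text \<open>
  Where no formula begins, every branch has the factor \<open>0\<close>. By induction on the number of symbols to the
  right: a parenthesis or a quantifier fails because one of its parts is no formula, or because the
  symbol behind a part is wrong, which is found out when the machine returns there.
\<close>

lemma operand_fails:
  "(\<And>\<alpha> j. \<not> good i \<alpha> j) \<Longrightarrow> i \<le> N \<Longrightarrow> wfs (int i) stk \<Longrightarrow> opens q md i \<Longrightarrow>
   evals sat_machine ((N + 1 - i) * cost) (cfg q stk None None (int i)) 0"
proof (induction "N - i" arbitrary: i stk q md rule: less_induct)
  case less
  note bad = less.prems(1) and wf = less.prems(3) and op = less.prems(4)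
  have IH: "evals sat_machine ((N + 1 - i') * cost) (cfg q' stk' None None (int i')) 0"
    if "i < i'" "i' \<le> N" "\<And>\<alpha> j. \<not> good i' \<alpha> j" "wfs (int i') stk'" "opens q' md' i'" for i' stk' q' md'
    by (rule less.hyps[OF _ that(3) that(2) that(4,5)]) (use that in auto)
  have enough: "evals sat_machine k c 0 \<Longrightarrow> k \<le> cost \<Longrightarrow> evals sat_machine ((N + 1 - j) * cost) c 0" if "j \<le> N" for k j c
  proof (erule evals_mono)
    assume "k \<le> cost"
    also have "1 * cost \<le> (N + 1 - j) * cost" using that by (intro mult_le_mono1) simp
    finally show "k \<le> (N + 1 - j) * cost" by simp
  qed
  have add: "(N + 1 - j) * cost + (j - Suc i') * cost = (N - i') * cost" if "i' < j" "j \<le> N" for i' j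
  proof -
    have "N - i' = (N + 1 - j) + (j - Suc i')" using that by simp
    then show ?thesis by (simp only: add_mult_distrib)
  qed
  have die: ?case if "operand md (bas (int i)) (marks stk (int i)) False False = die c" for c
  proof -
    have "evals sat_machine (Suc 0) (cfg q stk None None (int i)) 0"
      by (rule cfg_die[where c = c]) (use that op in \<open>simp add: opens_def tape_def\<close>)
    from enough[OF less.prems(2) this cost_ge(3)] show ?thesis .
  qed
  have Suc_cost: "Suc ((N - i) * cost) \<le> (N + 1 - i) * cost" "k \<le> cost \<Longrightarrow> (N - i) * cost + k \<le> (N + 1 - i) * cost" for k
    using less.prems(2) cost_ge(3) by (auto simp: Suc_diff_le)
  show ?case
  proof (cases "bas (int i)")
    case Blank
    then show ?thesis by (intro die) (simp add: operand_def)
  next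
    case Val
    then have i: "i < N" using bas_Blank[of "int i"] by (cases "i < N") auto
    show ?thesis
    proof (cases "no_bit (drop (Suc i) w)")
      case True
      obtain k where "w ! i = Inr k" using Val bas_Val[OF i] by blast
      then have "drop i w = Inr k # drop (Suc i) w" using i by (simp add: drop_Cons_iff)
      with True i have "good i (Const k) (Suc i)" by (simp add: good_def)
      with bad show ?thesis by blast
    next
      case False
      then have "evals sat_machine (B + 1) (cfgC (unbind stk) (int (Suc i))) 0"
        using i wfs_mono[OF wf] by (intro stray_bit) (auto simp: no_bit_drop[symmetric] simp del: of_nat_Suc)
      from operand_constant[OF Val wf op i this]
      have "evals sat_machine (B + 1 + B + 1) (cfg q stk None None (int i)) 0" by (cases md) auto
      from enough[OF less.prems(2) this] cost_ge(1) show ?thesis by simp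
    qed
  next
    case (Tok t)
    then have i: "i < N" by (rule bas_Tok_less)
    consider "t = LPar" | "t = SumTok" | "t = VarTok" | "t = NegTok"
      | "t \<notin> {LPar, SumTok, VarTok, NegTok}" by blast
    then show ?thesis
    proof cases
      case 1
      with Tok have b: "bas (int i) = Tok LPar" by simp
      have "evals sat_machine ((N - i) * cost) (cfg (Operand md) ((int i, EParen k False) # stk) None None (int (Suc i))) 0" for k md
      proof -
        let ?s = "\<lambda>d. (int i, EParen k d) # stk"
        have wfs': "wfs x (?s d)" if "int i < x" for x d using wf that by simp
        show ?thesis
        proof (cases "\<exists>\<alpha> j. good (Suc i) \<alpha> j")
          case False
          then show ?thesis using IH[of "Suc i" "?s False" "Operand md" md] i wfs' wf by simp
        next
          case True
          then obtain \<alpha> j1 where g1: "good (Suc i) \<alpha> j1" by blast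
          then have j1: "i < j1" "j1 \<le> N" using good_length[OF g1] by (auto simp: good_def)
          have "evals sat_machine ((N + 1 - j1) * cost) (cfgC (?s False) (int j1)) 0"
          proof (cases "connective k (bas (int j1))")
            case False
            have "evals sat_machine (B + 1) (cfgC (?s False) (int j1)) 0"
              by (rule left_paren(2)[OF wfs' _ False]) (use j1 in auto)
            then show ?thesis by (rule enough[OF j1(2)]) (use cost_ge(2) in simp)
          next
            case True
            then have c: "bas (int j1) = Tok PlusTok \<or> bas (int j1) = Tok TimesTok" by (auto simp: connective_def)
            then have j1': "j1 < N" using bas_Tok_less by blast
            let ?c = "cfg (Operand (k = KTimes \<or> k = KRight)) (?s True) None None (int (Suc j1))"
            have "evals sat_machine ((N - j1) * cost) ?c 0"
            proof (cases "\<exists>\<beta> j. good (Suc j1) \<beta> j")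
              case False
              then show ?thesis using IH[of "Suc j1" "?s True" "Operand (k = KTimes \<or> k = KRight)" "k = KTimes \<or> k = KRight"] j1 j1' wfs' wf by simp
            next
              case True
              then obtain \<beta> j2 where g2: "good (Suc j1) \<beta> j2" by blast
              then have j2: "j1 < j2" "j2 \<le> N" using good_length[OF g2] by (auto simp: good_def)
              have "evals sat_machine ((N + 1 - j2) * cost) (cfgC (?s True) (int j2)) 0"
              proof (cases "bas (int j2) = Tok RPar")
                case False
                have "evals sat_machine (B + 1) (cfgC (?s True) (int j2)) 0"
                  by (rule right_paren(2)[OF wfs' _ False]) (use j1 j2 in auto)
                then show ?thesis by (rule enough[OF j2(2)]) (use cost_ge(2) in simp)
              next
                case True
                then have j2': "j2 < N" by (rule bas_Tok_less)
                from bad good_binary_operation[OF b g1 c g2 True] have "\<not> no_bit (drop (Suc j2) w)" by blast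
                then have ev: "evals sat_machine (B + 1) (cfgC (unbind stk) (int (Suc j2))) 0"
                  using j1 j2 j2' wfs_mono[OF wf] by (intro stray_bit) (auto simp: no_bit_drop[symmetric] simp del: of_nat_Suc)
                have "evals sat_machine (4 * B) (cfgC (?s True) (int j2)) 0"
                  by (rule silentD[OF right_paren(1)[OF wfs' _ True] ev[unfolded int_Suc]]) (use j1 j2 in auto)
                then show ?thesis by (rule enough[OF j2(2)]) (use cost_ge(1) in simp)
              qed
              then have "evals sat_machine ((N + 1 - j2) * cost) (cfgC (unbind (?s True)) (int j2)) 0" by simp
              from operand_evals[OF g2 wfs' opens_Operand this] add[OF j2] j1
              show ?thesis by (metis vl_zero less_Suc_eq of_nat_less_iff)
            qed
            then have ev: "evals sat_machine ((N - j1) * cost) (cfg (Operand (k = KTimes \<or> k = KRight)) (?s True) None None (int j1 + 1)) 0"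
              by (simp add: add.commute)
            show ?thesis
            proof (rule silentD[OF left_paren(1)[OF wfs' _ True] ev])
              show "(N - j1) * cost + (B + 1) \<le> (N + 1 - j1) * cost"
                using j1(2) cost_ge(2) by (simp add: Suc_diff_le)
            qed (use j1 in auto)
          qed
          then have "evals sat_machine ((N + 1 - j1) * cost) (cfgC (unbind (?s False)) (int j1)) 0" by simp
          from operand_evals[OF g1 wfs' opens_Operand this] add[OF j1]
          show ?thesis by (metis vl_zero lessI of_nat_less_iff)
        qed
      qed
      from operand_paren[OF b wf op this] have "evals sat_machine (Suc ((N - i) * cost)) (cfg q stk None None (int i)) 0"
        by (simp only: add_0_left if_cancel)
      from evals_mono[OF this Suc_cost(1)] show ?thesis .
    next
      case 2
      with Tok have b: "bas (int i) = Tok SumTok" by simp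
      \<comment> \<open>The entry on the stack has the right variable whenever the bits are a name.\<close>
      have claim: "evals sat_machine ((N - i) * cost) (cfg (BinderVar md) ((int i, EBind v b) # stk) None None (int i + 1)) 0"
        if v: "\<And>bs v'. run (int i + 2) bs \<Longrightarrow> binary v' = bs \<Longrightarrow> v = v'" for v b
      proof -
        let ?s = "(int i, EBind v b) # stk"
        have small: "evals sat_machine k c 0 \<Longrightarrow> k \<le> cost \<Longrightarrow> evals sat_machine ((N - i) * cost) c 0" for k c
          using enough[of "Suc i" k c] i by simp
        have cost3: "3 \<le> cost" using cost_ge(1) by simp
        show ?thesis
        proof (cases "bas (int i + 1) = Tok VarTok")
          case False
          have "evals sat_machine (Suc 0) (cfg (BinderVar md) ?s None None (int i + 1)) 0"
            by (rule cfg_die[where c = "tape ?s None None (int i + 1)"]) (use False in \<open>simp add: tape_def\<close>)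
          then show ?thesis by (rule small) (use cost3 in simp)
        next
          case True
          then have i1: "bas (int (Suc i)) = Tok VarTok" by (simp add: add.commute)
          then have "Suc i < N" by (rule bas_Tok_less)
          obtain bs where bs: "set bs \<subseteq> {Bit0, Bit1}" "run (int (Suc (Suc i))) bs" using run_exists by blast
          then have r: "run (int i + 2) bs" by (simp add: add.commute)
          show ?thesis
          proof (cases "\<exists>v. binary v = bs")
            case True
            with v r have bv: "binary v = bs" by blast
            define i' where "i' = i + 2 + length (binary v)"
            have i': "i' \<le> N" using run_length[OF bs(2)] \<open>Suc i < N\<close> bv by (simp add: i'_def)
            have "\<not> good i' \<alpha> j" for \<alpha> j
              using good_quantifier[OF b i1, of v \<alpha> j] bs(2) bv bad by (auto simp: i'_def)
            moreover have "wfs (int i') ?s"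
              using wf \<open>bas (int i + 1) = Tok VarTok\<close> r bv by (simp add: i'_def)
            moreover obtain q' where q': "opens q' md i'" and
              sil: "silent (length (binary v) + 1) (cfg (BinderVar md) ?s None None (int i + 1)) (cfg q' ?s None None (int i'))"
              unfolding i'_def by (rule pass_binder[OF \<open>bas (int i + 1) = Tok VarTok\<close> r[folded bv]])
            ultimately have ev: "evals sat_machine ((N + 1 - i') * cost) (cfg q' ?s None None (int i')) 0"
              using i' by (intro IH) (auto simp: i'_def)
            show ?thesis
            proof (rule silentD[OF sil ev])
              have "N - i = (N + 1 - i') + (length (binary v) + 1)" using i' by (simp add: i'_def)
              then have "(N - i) * cost = (N + 1 - i') * cost + (length (binary v) + 1) * cost"
                by (simp only: add_mult_distrib)
              moreover have "(length (binary v) + 1) * 1 \<le> (length (binary v) + 1) * cost"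
                using cost_ge(3) by (intro mult_le_mono2) simp
              moreover have "c = a + d \<Longrightarrow> l * 1 \<le> d \<Longrightarrow> a + l \<le> c" for a c d l :: nat by simp
              ultimately show "(N + 1 - i') * cost + (length (binary v) + 1) \<le> (N - i) * cost" by blast
            qed
          next
            case False
            have s1: "silent 1 (cfg (BinderVar md) ?s None None (int i + 1)) (cfg (BinderBit md) ?s None None (int i + 2))"
              by (rule cfg_step) (use \<open>bas (int i + 1) = Tok VarTok\<close> in \<open>auto simp: tape_def\<close>)
            have "evals sat_machine 2 (cfg (BinderBit md) ?s None None (int i + 2)) 0"
            proof (cases bs)
              case Nil
              have "evals sat_machine (Suc 1) (cfg (BinderBit md) ?s None None (int i + 2)) 0"
                by (rule cfg_die[where c = "tape ?s None None (int i + 2)"]) (use r Nil in \<open>simp add: tape_def\<close>)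
              then show ?thesis by (simp add: numeral_2_eq_2)
            next
              case (Cons c cs)
              \<comment> \<open>Bits that are not a name begin with \<open>0\<close> and go on.\<close>
              have "c \<noteq> Bit1" using False binary_Bit1[of cs] Cons bs(1) by auto
              then have c: "c = Bit0" using Cons bs(1) by auto
              with False Cons binary.simps[of 0] have "cs \<noteq> []" by auto
              then obtain d ds where cs: "cs = d # ds" by (cases cs) auto
              have s2: "silent 1 (cfg (BinderBit md) ?s None None (int i + 2)) (cfg (BinderEnd md) ?s None None (int i + 3))"
                by (rule cfg_step) (use r Cons c in \<open>auto simp: tape_def\<close>)
              have "evals sat_machine (Suc 0) (cfg (BinderEnd md) ?s None None (int i + 3)) 0"
                by (rule cfg_die[where c = "tape ?s None None (int i + 3)"])
                   (use r Cons cs bs(1) in \<open>auto simp: tape_def add.assoc\<close>)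
              from silentD[OF s2 this] show ?thesis by (simp add: numeral_2_eq_2)
            qed
            from silentD[OF s1 this] have "evals sat_machine 3 (cfg (BinderVar md) ?s None None (int i + 1)) 0" by simp
            then show ?thesis by (rule small) (rule cost3)
          qed
        qed
      qed
      \<comment> \<open>The stack needs a variable even if the bits are not the name of one; then any variable will do.\<close>
      obtain v where "evals sat_machine ((N - i) * cost) (cfg (BinderVar md) ((int i, EBind v b) # stk) None None (int i + 1)) 0" for b
      proof -
        obtain bs where bs: "run (int (Suc (Suc i))) bs" using run_exists by blast
        have uniq: "run x bs \<Longrightarrow> run x bs' \<Longrightarrow> bs = bs'" for x bs bs'
        proof (induction bs arbitrary: x bs')
          case Nil
          then show ?case by (cases bs') auto
        next
          case (Cons c cs)
          then show ?case by (cases bs') auto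
        qed
        from bs have r: "run (int i + 2) bs" by (simp add: add.commute)
        define v where "v = (THE v. binary v = bs)"
        have v: "v = v'" if "run (int i + 2) bs'" "binary v' = bs'" for bs' v'
        proof -
          have "binary v' = bs" using uniq[OF r] that by simp
          then have "(THE v. binary v = bs) = v'" by (intro the_equality) (auto dest: binary_inj)
          then show ?thesis by (simp add: v_def)
        qed
        show thesis by (rule that, rule claim, rule v)
      qed
      from operand_quantifier[OF b wf op this] have "evals sat_machine (Suc ((N - i) * cost)) (cfg q stk None None (int i)) 0"
        by (simp only: add_0_left if_cancel)
      from evals_mono[OF this Suc_cost(1)] show ?thesis .
    next
      case 3
      with Tok have b: "bas (int i) = Tok VarTok" by simp
      obtain bs where bs: "run (int (Suc i)) bs" using run_exists by blast
      then have r: "run (int i + 1) bs" by (simp add: add.commute)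
      have "lookup bs stk = None"
      proof (rule ccontr)
        assume "lookup bs stk \<noteq> None"
        then obtain v where "binary v = bs" using lookup_Some by blast
        with good_literal[OF b] bs bad show False by blast
      qed
      from literal(1)[OF wf b r _ _ this] run_length[OF bs] i
      have "evals sat_machine cost (cfg (Seek True md) stk (Some (int i)) None (int i - 1)) 0" by simp
      from operand_variable[OF b wf op this]
      show ?thesis
      proof (rule evals_mono)
        have "2 * cost \<le> (N + 1 - i) * cost" using i by (intro mult_le_mono1) simp
        moreover have "Suc cost \<le> 2 * cost" using cost_ge(1) by simp
        ultimately show "Suc cost \<le> (N + 1 - i) * cost" by (rule order_trans[rotated])
      qed
    next
      case 4
      with Tok have b: "bas (int i) = Tok NegTok" by simp
      show ?thesis
      proof (cases "bas (int (Suc i)) = Tok VarTok")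
        case False
        have s: "silent 1 (cfg q stk None None (int i)) (cfg (Negated md) stk None None (int i + 1))"
          by (rule cfg_step) (use b op in \<open>auto simp: opens_def operand_def tape_def\<close>)
        have "evals sat_machine (Suc 0) (cfg (Negated md) stk None None (int i + 1)) 0"
          by (rule cfg_die[where c = "tape stk None None (int i + 1)"]) (use False in \<open>simp add: tape_def add.commute\<close>)
        from silentD[OF s this, of 2] have "evals sat_machine 2 (cfg q stk None None (int i)) 0" by simp
        from enough[OF less.prems(2) this] cost_ge(1) show ?thesis by simp
      next
        case True
        then have i': "Suc i < N" by (rule bas_Tok_less)
        obtain bs where bs: "run (int (Suc (Suc i))) bs" using run_exists by blast
        then have r: "run (int (Suc i) + 1) bs" by (simp add: add.commute)
        have "lookup bs stk = None"
        proof (rule ccontr)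
          assume "lookup bs stk \<noteq> None"
          then obtain v where "binary v = bs" using lookup_Some by blast
          with good_negated[OF b True] bs bad show False by blast
        qed
        from literal(1)[OF _ True r _ _ this, of False md] run_length[OF bs] i' wfs_mono[OF wf, of "int (Suc i)"]
        have "evals sat_machine cost (cfg (Seek False md) stk (Some (int i + 1)) None (int i)) 0"
          by (simp add: add.commute)
        from operand_negated[OF b _ wf op this] True
        have "evals sat_machine (cost + 2) (cfg q stk None None (int i)) 0" by (simp add: add.commute)
        then show ?thesis
        proof (rule evals_mono)
          have "2 * cost \<le> (N + 1 - i) * cost" using i by (intro mult_le_mono1) simp
          moreover have "cost + 2 \<le> 2 * cost" using cost_ge(1) by simp
          ultimately show "cost + 2 \<le> (N + 1 - i) * cost" by (rule order_trans[rotated])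
        qed
      qed
    next
      case 5
      then show ?thesis using Tok by (intro die) (simp add: operand_def)
    qed
  qed
qed

lemma initial_cfg: "initial_config sat_machine w = cfg (Operand True) [] None None 0"
proof -
  have sel: "start_state sat_machine = to_nat (Operand True)" "placeholder sat_machine = 10" "blank sat_machine = 11"
    by (simp_all add: sat_machine_def)
  have cell: "(if 0 \<le> i \<and> i < int N then case w ! nat i of Inl a \<Rightarrow> (a, 0) | Inr k \<Rightarrow> (10, k) else (11, 0))
      = (enc_cell (tape [] None None i), vals i)" for i
  proof (cases "0 \<le> i \<and> i < int N")
    case True
    then have "nat i < N" by (simp add: nat_less_iff)
    from word_tok[OF this] True show ?thesis by (auto simp: tape_def bas_def vals_def)
  next
    case False
    then have "bas i = Blank" "vals i = 0" by (auto simp: bas_def vals_def)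
    then show ?thesis using False by (auto simp: tape_def)
  qed
  show ?thesis
    unfolding initial_config_def cfg_def gcfg_def sel cell ..
qed

text \<open>
  A formula that begins at the first position has to extend over the whole input. If it ends before,
  then the machine does not find a blank at its end and gives \<open>0\<close>.
\<close>

lemma evals_SAT: "evals sat_machine ((N + 1) * cost + B + 1) (initial_config sat_machine w) (SAT w)"
proof (cases "\<exists>\<alpha> j. good 0 \<alpha> j")
  case True
  then obtain \<alpha> j where g: "good 0 \<alpha> j" by blast
  then have j: "j \<le> N" and "drop 0 w = encode \<alpha> @ drop j w" and nb: "no_bit (drop j w)" "only_sum_quantifiers \<alpha>"
    unfolding good_def by blast+
  then have dw: "encode \<alpha> @ drop j w = w" by (metis drop0)
  have uniq: "\<beta> = \<alpha> \<and> j = N" if "encode \<beta> = w" for \<beta>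
  proof -
    have "encode \<beta> @ [] = encode \<alpha> @ drop j w" using that dw by simp
    from encode_append_inject[OF this _ nb(1)] j show ?thesis by (simp add: no_bit_def)
  qed
  have "evals sat_machine (B + 1) (cfgC (unbind []) (int j)) (if j = N then 1 else 0)"
    using finish finish_die[of "int j"] j by simp
  from operand_evals[OF g _ opens_Operand this, of True]
  have 1: "evals sat_machine (B + 1 + j * cost) (initial_config sat_machine w) (vl True \<alpha> [] (if j = N then 1 else 0))"
    by (simp add: initial_cfg)
  have 2: "vl True \<alpha> [] (if j = N then 1 else 0) = SAT w"
  proof (cases "j = N \<and> free_vars \<alpha> = {}")
    case True
    with dw nb have "sum_BF \<alpha>" "encode \<alpha> = w" by (simp_all add: sum_BF_def)
    then have "SAT w = sem \<alpha> {}" using SAT_encode by blast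
    with True sem_closed[of \<alpha> "{}" "env []"] show ?thesis by (simp add: vl_def)
  next
    case False
    have "\<not> (sum_BF \<beta> \<and> encode \<beta> = w)" for \<beta>
      using uniq[of \<beta>] False by (auto simp: sum_BF_def)
    then have "SAT w = 0" unfolding SAT_def by (metis (no_types))
    with False show ?thesis by (simp add: vl_def)
  qed
  have 3: "B + 1 + j * cost \<le> (N + 1) * cost + B + 1"
    using mult_le_mono1[of j "N + 1" cost] j by simp
  show ?thesis by (rule evals_mono[OF 1[unfolded 2] 3])
next
  case False
  have "evals sat_machine ((N + 1 - 0) * cost) (cfg (Operand True) [] None None (int 0)) 0"
    by (rule operand_fails[where md = True]) (use False in auto)
  then have "evals sat_machine ((N + 1) * cost) (initial_config sat_machine w) 0"
    by (simp add: initial_cfg)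
  then have "evals sat_machine ((N + 1) * cost + B + 1) (initial_config sat_machine w) 0"
    by (rule evals_mono) simp
  moreover have "\<not> (sum_BF \<beta> \<and> encode \<beta> = w)" for \<beta>
  proof
    assume "sum_BF \<beta> \<and> encode \<beta> = w"
    then have "good 0 \<beta> N" by (auto simp: good_def sum_BF_def no_bit_def)
    with False show False by blast
  qed
  then have "SAT w = 0" unfolding SAT_def by (metis (no_types))
  ultimately show ?thesis by simp
qed

end

theorem SAT_in_NP_inf: "NP_inf sat_alphabet (SAT :: 'r::comm_semiring_1 word \<Rightarrow> 'r)"
proof -
  let ?M = "sat_machine :: 'r srtm"
  define p :: "nat poly" where
    "p = [:1, 1:] * ([:2, 1:] * ([:4:] * [:2, 1:] * [:2, 1:]) + [:4:] * [:2, 1:]) + [:3, 1:]"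
  have ev: "evals ?M (poly p (length w)) (initial_config ?M w) (SAT w)" if "w \<in> words_over sat_alphabet" for w
  proof -
    interpret sat_input w using that by unfold_locales
    have "poly p (length w) = (length w + 1) * cost + B + 1"
      by (simp add: p_def cost_def seek_cost_def algebra_simps)
    with evals_SAT show ?thesis by simp
  qed
  have alphabet: "input_alphabet ?M = sat_alphabet" by (simp add: sat_machine_def)
  have bound: "path_bound ?M (\<lambda>w. poly p (length w))"
    unfolding path_bound_def alphabet using evals_bounded[OF ev] by blast
  have "SAT w = machine_output ?M w" if "w \<in> words_over sat_alphabet" for w :: "'r word"
    unfolding machine_output_def using evals_val[OF ev[OF that]] by simp
  then show ?thesis
    unfolding NP_inf_def using srtm_sat_machine alphabet bound by blast
qed


section \<open>Blocks of sum quantifiers, and templates for the cells of a tableau\<close>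

lemma esem_zero_SumQs:
  "(\<And>A'. (\<And>v. v \<notin> set vs \<Longrightarrow> A' v = A v) \<Longrightarrow> esem \<phi> A' = 0) \<Longrightarrow> esem (foldr SumQ vs \<phi>) A = 0"
proof (induction vs arbitrary: A)
  case (Cons v vs)
  have "esem (foldr SumQ vs \<phi>) (A(v := b)) = 0" for b
    by (rule Cons.IH, rule Cons.prems) auto
  then show ?case by simp
qed simp

text \<open>
  If only one assignment \<open>T\<close> of the variables \<open>vs\<close> gives a value different from \<open>0\<close>, then the block of
  quantifiers has the effect of assigning \<open>T\<close>.
\<close>

lemma esem_unique_SumQs:
  assumes "distinct vs"
    and "\<And>A'. (\<And>v. v \<notin> set vs \<Longrightarrow> A' v = A v) \<Longrightarrow> (\<exists>v\<in>set vs. A' v \<noteq> T v) \<Longrightarrow> esem \<phi> A' = 0"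
  shows "esem (foldr SumQ vs \<phi>) A = esem \<phi> (\<lambda>v. if v \<in> set vs then T v else A v)"
  using assms
proof (induction vs arbitrary: A)
  case (Cons v vs)
  have zero: "esem (foldr SumQ vs \<phi>) (A(v := \<not> T v)) = 0"
  proof (rule esem_zero_SumQs, rule Cons.prems(2))
    fix A' assume *: "\<And>x. x \<notin> set vs \<Longrightarrow> A' x = (A(v := \<not> T v)) x"
    show "\<exists>x\<in>set (v # vs). A' x \<noteq> T x" using *[of v] Cons.prems(1) by auto
    show "A' x = A x" if "x \<notin> set (v # vs)" for x using *[of x] that by auto
  qed
  have "esem (foldr SumQ vs \<phi>) (A(v := T v)) = esem \<phi> (\<lambda>x. if x \<in> set vs then T x else (A(v := T v)) x)"
    by (rule Cons.IH, use Cons.prems(1) in simp, rule Cons.prems(2)) auto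
  also have "(\<lambda>x. if x \<in> set vs then T x else (A(v := T v)) x) = (\<lambda>x. if x \<in> set (v # vs) then T x else A x)"
    by auto
  finally have main: "esem (foldr SumQ vs \<phi>) (A(v := T v)) = esem \<phi> (\<lambda>x. if x \<in> set (v # vs) then T x else A x)" .
  have "esem (foldr SumQ (v # vs) \<phi>) A
      = esem (foldr SumQ vs \<phi>) (A(v := T v)) + esem (foldr SumQ vs \<phi>) (A(v := \<not> T v))"
    by (cases "T v") (simp_all add: add.commute)
  then show ?case by (simp only: main zero add_0_right)
qed simp

lemma esem_sum_SumQs:
  assumes "\<And>A. esem \<phi> A = (\<Sum>t\<in>S. esem (\<psi> t) A)"
  shows "esem (foldr SumQ vs \<phi>) A = (\<Sum>t\<in>S. esem (foldr SumQ vs (\<psi> t)) A)"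
  by (induction vs arbitrary: A) (simp_all add: assms sum.distrib)

text \<open>
  The variable of copy \<open>b\<close>, kind \<open>k\<close> and index \<open>j\<close> is the number with the binary representation
  \<open>1 b 1\<^sup>k 0 1\<^sup>j\<close>. In this way the names of the variables can be written without any arithmetic.
\<close>

definition vn :: "bool \<Rightarrow> nat \<Rightarrow> nat \<Rightarrow> nat" where
  "vn b k j = (SOME n. binary n = Bit1 # (if b then Bit1 else Bit0) # replicate k Bit1 @ Bit0 # replicate j Bit1)"

lemma binary_vn: "binary (vn b k j) = Bit1 # (if b then Bit1 else Bit0) # replicate k Bit1 @ Bit0 # replicate j Bit1"
proof -
  have "set ((if b then Bit1 else Bit0) # replicate k Bit1 @ Bit0 # replicate j Bit1) \<subseteq> {Bit0, Bit1}"
    by auto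
  from binary_Bit1[OF this]
  have "\<exists>n. binary n = Bit1 # (if b then Bit1 else Bit0) # replicate k Bit1 @ Bit0 # replicate j Bit1"
    by blast
  then show ?thesis unfolding vn_def by (rule someI_ex)
qed

lemma vn_eq [simp]: "vn b k j = vn b' k' j' \<longleftrightarrow> b = b' \<and> k = k' \<and> j = j'"
proof
  assume "vn b k j = vn b' k' j'"
  then have eq: "Bit1 # (if b then Bit1 else Bit0) # replicate k Bit1 @ Bit0 # replicate j Bit1
      = Bit1 # (if b' then Bit1 else Bit0) # replicate k' Bit1 @ Bit0 # replicate j' Bit1"
    using binary_vn by metis
  have un: "replicate k Bit1 @ Bit0 # xs = replicate k' Bit1 @ Bit0 # ys \<Longrightarrow> k = k' \<and> xs = ys" for xs ys k k'
  proof (induction k arbitrary: k')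
    case 0
    then show ?case by (cases k') auto
  next
    case (Suc k)
    then show ?case by (cases k') auto
  qed
  from eq have "b = b'" by (auto split: if_splits)
  moreover from eq have "k = k' \<and> replicate j Bit1 = replicate j' Bit1" by (intro un) simp
  ultimately show "b = b' \<and> k = k' \<and> j = j'" by (simp add: replicate_eq_replicate)
qed simp

text \<open>
  Constants of formulas of type \<^typ>\<open>nat wqbf\<close> are indices of semiring values; a valuation \<open>\<sigma>\<close> turns such
  a formula into the formula \<^term>\<open>map_wqbf \<sigma> \<phi>\<close> over the semiring. The index \<open>e\<close> is meant to be that of
  \<open>1\<close>.
\<close>

definition prods :: "nat \<Rightarrow> nat wqbf list \<Rightarrow> nat wqbf" where
  "prods e fs = foldr Times fs (Const e)"

text \<open>
  Templates of formulas that are instantiated at each cell \<open>j\<close> of a row: \<open>TLit s b k d\<close> is a literal of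
  sign \<open>s\<close> of the variable of copy \<open>b\<close>, kind \<open>k\<close> and index \<open>j + d\<close>, and \<open>TWeight\<close> is the constant
  whose index is attached to the cell.
\<close>

datatype tmpl = TLit bool bool nat nat | TConst nat | TWeight | TPlus tmpl tmpl | TTimes tmpl tmpl

fun inst :: "nat \<Rightarrow> nat \<Rightarrow> tmpl \<Rightarrow> nat wqbf" where
  "inst j w (TLit s b k d) = Lit ((if s then PosLit else NegLit) (vn b k (j + d)))"
| "inst j w (TConst c) = Const c"
| "inst j w TWeight = Const w"
| "inst j w (TPlus t u) = Plus (inst j w t) (inst j w u)"
| "inst j w (TTimes t u) = Times (inst j w t) (inst j w u)"

text \<open>
  Descriptions of a row of the tape by segments: a single cell, \<open>D\<close> equal cells, or one cell per symbol of
  the input. The latter depend on the letter in the cell, or on \<open>None\<close> if it holds a semiring value.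
\<close>

datatype 'x seg = One 'x | Loop 'x | Input "nat option \<Rightarrow> 'x"

text \<open>
  A machine and a list of semiring values that contains all the constants needed. In a formula such a
  constant is represented by its index in the list.
\<close>

locale tableau =
  fixes M :: "'r::comm_semiring_1 srtm" and rs :: "'r list"
  assumes srtm: "srtm M" and rs: "distinct rs" "insert 0 (insert 1 (weights M)) \<subseteq> set rs"
begin

definition ci :: "'r \<Rightarrow> nat" where
  "ci r = (SOME i. i < length rs \<and> rs ! i = r)"

lemma ci: "r \<in> insert 0 (insert 1 (weights M)) \<Longrightarrow> ci r < length rs \<and> rs ! ci r = r"
proof -
  assume "r \<in> insert 0 (insert 1 (weights M))"
  then have "\<exists>i. i < length rs \<and> rs ! i = r" using rs(2) by (metis in_set_conv_nth subset_eq)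
  then show ?thesis unfolding ci_def by (rule someI_ex)
qed

definition \<Gamma> :: "nat list" where "\<Gamma> = sorted_list_of_set (tape_alphabet M)"
definition Qs :: "nat list" where "Qs = sorted_list_of_set (states M)"

lemma set_\<Gamma>: "set \<Gamma> = tape_alphabet M" and set_Qs: "set Qs = states M"
  and distinct_\<Gamma>: "distinct \<Gamma>" and distinct_Qs: "distinct Qs"
  using srtm by (simp_all add: \<Gamma>_def Qs_def srtm_def)

text \<open>
  The transitions, and a loop without movement and of weight \<open>1\<close> for each pair of state and letter that
  halts.
\<close>

definition ext :: "'r transition set" where
  "ext = transitions M \<union>
     {((q, a), (q, a), 0, Inr 1) | q a. q \<in> states M \<and> a \<in> tape_alphabet M \<and>
        (\<nexists>y. ((q, a), y) \<in> transitions M)}"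

lemma finite_ext: "finite ext"
proof -
  have "finite ((states M \<times> tape_alphabet M) \<times> (states M \<times> tape_alphabet M) \<times> {-1, 1 :: int} \<times>
       (Inr ` weights M \<union> {Inl (placeholder M)}))"
    using srtm by (auto simp: srtm_def)
  then have "finite (transitions M)" using srtm finite_subset unfolding srtm_def by blast
  moreover have "finite ((\<lambda>(q, a). ((q, a), (q, a), 0 :: int, Inr 1 :: nat + 'r)) ` (states M \<times> tape_alphabet M))"
    using srtm by (auto simp: srtm_def)
  then have "finite {((q, a), (q, a), 0 :: int, Inr 1 :: nat + 'r) | q a. q \<in> states M \<and> a \<in> tape_alphabet M \<and>
        (\<nexists>y. ((q, a), y) \<in> transitions M)}" by (rule finite_subset[rotated]) auto
  ultimately show ?thesis by (simp add: ext_def)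
qed

definition etrans :: "'r transition list" where
  "etrans = (SOME ts. set ts = ext \<and> distinct ts)"

lemma etrans: "set etrans = ext" "distinct etrans"
proof -
  have "\<exists>ts. set ts = ext \<and> distinct ts" using finite_distinct_list[OF finite_ext] .
  then have "set etrans = ext \<and> distinct etrans" unfolding etrans_def by (rule someI_ex)
  then show "set etrans = ext" "distinct etrans" by auto
qed

lemma ext_cases:
  assumes "((q, a), (q', a'), d, r) \<in> ext"
  shows "q \<in> states M" "a \<in> tape_alphabet M" "q' \<in> states M" "a' \<in> tape_alphabet M" "d \<in> {-1, 0, 1}"
    "r \<in> Inr ` insert 1 (weights M) \<union> {Inl (placeholder M)}"
  using assms srtm unfolding ext_def srtm_def by blast+

text \<open>
  The extended transitions that are applicable.
\<close>

definition eapp :: "'r config \<Rightarrow> 'r transition set" where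
  "eapp c = (case c of (q, x, n) \<Rightarrow> {t \<in> ext. fst t = (q, fst (x n))})"

definition wf_config :: "'r config \<Rightarrow> bool" where
  "wf_config c \<longleftrightarrow> (case c of (q, x, n) \<Rightarrow> q \<in> states M \<and> (\<forall>i. fst (x i) \<in> tape_alphabet M))"

lemma eapp_applicable: "applicable M c \<noteq> {} \<Longrightarrow> eapp c = applicable M c"
  by (cases c) (auto simp: eapp_def applicable_def ext_def)

lemma eapp_halting:
  "applicable M (q, x, n) = {} \<Longrightarrow> wf_config (q, x, n) \<Longrightarrow>
   eapp (q, x, n) = {((q, fst (x n)), (q, fst (x n)), 0, Inr 1)}"
  by (auto simp: eapp_def applicable_def ext_def wf_config_def)

lemma wf_successor: "t \<in> eapp c \<Longrightarrow> wf_config c \<Longrightarrow> wf_config (successor t c)"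
proof -
  assume t: "t \<in> eapp c" and c: "wf_config c"
  obtain q a q' a' d r where t': "t = ((q, a), (q', a'), d, r)" by (metis prod.exhaust)
  with t have "t \<in> ext" by (cases c) (auto simp: eapp_def)
  from ext_cases[OF this[unfolded t']] c show ?thesis
    by (cases c) (auto simp: t' wf_config_def)
qed

end


section \<open>The tableau formula of a machine\<close>

text \<open>
  Two variables have the same truth value.
\<close>

definition iff_tmpl :: "bool \<times> nat \<times> nat \<Rightarrow> bool \<times> nat \<times> nat \<Rightarrow> tmpl" where
  "iff_tmpl = (\<lambda>(b, k, d) (b', k', d'). TPlus (TTimes (TLit True b k d) (TLit True b' k' d'))
                                          (TTimes (TLit False b k d) (TLit False b' k' d')))"

text \<open>
  The entries of a row together with the indices of the semiring values in the cells. The index of a value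
  in the input \<open>u\<close> is found there; the other cells hold \<open>0\<close>, whose index is \<open>z\<close>.
\<close>

fun seg_cells :: "nat \<Rightarrow> nat \<Rightarrow> (nat + nat) list \<Rightarrow> 'x seg \<Rightarrow> ('x \<times> nat) list" where
  "seg_cells z D u (One f) = [(f, z)]"
| "seg_cells z D u (Loop f) = replicate D (f, z)"
| "seg_cells z D u (Input g) = map (\<lambda>s. case s of Inl a \<Rightarrow> (g (Some a), z) | Inr k \<Rightarrow> (g None, k)) u"

definition cells :: "nat \<Rightarrow> nat \<Rightarrow> (nat + nat) list \<Rightarrow> 'x seg list \<Rightarrow> ('x \<times> nat) list" where
  "cells z D u segs = concat (map (seg_cells z D u) segs)"

definition row :: "nat \<Rightarrow> nat \<Rightarrow> (nat + nat) list \<Rightarrow> (nat \<Rightarrow> nat \<Rightarrow> 'x \<Rightarrow> 'y) \<Rightarrow> 'x seg list \<Rightarrow> 'y list" where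
  "row z D u f segs = map (\<lambda>(j, x, w). f j w x) (List.enumerate 0 (cells z D u segs))"

text \<open>
  The tape has \<open>width D u\<close> cells: \<open>D\<close> cells on each side of the input, and two outermost cells, which the
  head never enters. The cell number \<open>j\<close> is at position \<open>j - D - 1\<close>.
\<close>

definition std :: "'x \<Rightarrow> 'x \<Rightarrow> (nat option \<Rightarrow> 'x) \<Rightarrow> 'x \<Rightarrow> 'x seg list" where
  "std f c g e = [One f, Loop c, Input g, Loop c, One e]"

definition width :: "nat \<Rightarrow> (nat + nat) list \<Rightarrow> nat" where
  "width D u = 2 * D + 2 + length u"

text \<open>
  The index of the value in the cell \<open>j\<close>, and the entry of a standard row there.
\<close>

definition cell_index :: "nat \<Rightarrow> nat \<Rightarrow> (nat + nat) list \<Rightarrow> nat \<Rightarrow> nat" where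
  "cell_index z D u j =
     (if D < j \<and> j \<le> D + length u then case u ! (j - D - 1) of Inl a \<Rightarrow> z | Inr k \<Rightarrow> k else z)"

definition cell_sym :: "(nat option \<Rightarrow> 'x) \<Rightarrow> 'x \<Rightarrow> nat \<Rightarrow> (nat + nat) list \<Rightarrow> nat \<Rightarrow> 'x" where
  "cell_sym g c D u j =
     (if D < j \<and> j \<le> D + length u then case u ! (j - D - 1) of Inl a \<Rightarrow> g (Some a) | Inr k \<Rightarrow> g None else c)"

lemma row_std:
  "row z D u f (std x c g e) = map (\<lambda>j. f j (cell_index z D u j)
     (if j = 0 then x else if j = width D u - 1 then e else cell_sym g c D u j)) [0..<width D u]"
proof -
  have "length (cells z D u (std x c g e)) = width D u"
    by (simp add: cells_def std_def width_def)
  moreover have "cells z D u (std x c g e) ! j =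
      (if j = 0 then x else if j = width D u - 1 then e else cell_sym g c D u j, cell_index z D u j)"
    if "j < width D u" for j
    using that
    by (auto simp: cells_def std_def width_def nth_append nth_Cons' cell_index_def cell_sym_def
        split: sum.splits)
  ultimately show ?thesis
    by (intro nth_equalityI) (simp_all add: row_def nth_enumerate_eq)
qed

context tableau begin

definition tprods :: "tmpl list \<Rightarrow> tmpl" where
  "tprods ts = foldr TTimes ts (TConst (ci 1))"

text \<open>
  Variables of kind \<open>0\<close> tell whether the head is on a cell, those of kind \<open>2 * c + 1\<close> whether the letter
  in the cell is \<open>c\<close>, and those of kind \<open>2 * q + 2\<close>, which exist for the first cell only, whether the
  state is \<open>q\<close>. The cell \<open>j\<close> has the index \<open>j + 1\<close>; in a template, the offsets \<open>0\<close>, \<open>1\<close> and \<open>2\<close> hence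
  refer to the left neighbour, to the cell itself and to the right neighbour.

  The copy \<open>b\<close> describes the present configuration and the copy \<open>\<not> b\<close> the next one.
\<close>

definition copy_tmpl :: "bool \<Rightarrow> tmpl" where
  "copy_tmpl b = tprods (map (\<lambda>c. iff_tmpl (\<not> b, 2 * c + 1, 1) (b, 2 * c + 1, 1)) \<Gamma>)"

definition symbol_tmpl :: "bool \<Rightarrow> nat \<Rightarrow> tmpl" where
  "symbol_tmpl b a = tprods (map (\<lambda>c. TLit (c = a) b (2 * c + 1) 1) \<Gamma>)"

definition state_tmpl :: "bool \<Rightarrow> nat \<Rightarrow> tmpl" where
  "state_tmpl b q = tprods (map (\<lambda>p. TLit (p = q) b (2 * p + 2) 1) Qs)"

fun weight_tmpl :: "nat + 'r \<Rightarrow> tmpl" where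
  "weight_tmpl (Inr k) = TConst (ci k)" | "weight_tmpl (Inl s) = TWeight"

text \<open>
  The outermost cells: the head will not be there, and the letter stays the same. The first of them
  also takes care of the state.
\<close>

definition edge_tmpl :: "bool \<Rightarrow> tmpl" where
  "edge_tmpl b = TTimes (TLit False (\<not> b) 0 1) (copy_tmpl b)"

fun first_tmpl :: "bool \<Rightarrow> 'r transition \<Rightarrow> tmpl" where
  "first_tmpl b ((q, a), (q', a'), d, r) =
     TTimes (TLit True b (2 * q + 2) 1) (TTimes (state_tmpl (\<not> b) q') (edge_tmpl b))"

text \<open>
  The head will be on the cell \<open>j\<close> if it is now on the cell \<open>j - d\<close>, which has the index \<open>j + (1 - d)\<close>. A
  cell without the head is copied; the cell with the head contributes the weight of the transition.
\<close>

fun cell_tmpl :: "bool \<Rightarrow> 'r transition \<Rightarrow> tmpl" where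
  "cell_tmpl b ((q, a), (q', a'), d, r) =
     TTimes (iff_tmpl (\<not> b, 0, 1) (b, 0, nat (1 - d)))
       (TPlus (TTimes (TLit False b 0 1) (copy_tmpl b))
              (TTimes (TLit True b 0 1)
                 (TTimes (TLit True b (2 * a + 1) 1) (TTimes (symbol_tmpl (\<not> b) a') (weight_tmpl r)))))"

definition step_segs :: "bool \<Rightarrow> 'r transition \<Rightarrow> tmpl seg list" where
  "step_segs b t = std (first_tmpl b t) (cell_tmpl b t) (\<lambda>_. cell_tmpl b t) (edge_tmpl b)"

definition row_formula :: "nat \<Rightarrow> (nat + nat) list \<Rightarrow> tmpl seg list \<Rightarrow> nat wqbf" where
  "row_formula D u segs = prods (ci 1) (row (ci 0) D u inst segs)"

text \<open>
  The sum over all transitions of the products over all cells.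
\<close>

definition step_formula :: "nat \<Rightarrow> (nat + nat) list \<Rightarrow> bool \<Rightarrow> nat wqbf" where
  "step_formula D u b = foldr Plus (map (\<lambda>t. row_formula D u (step_segs b t)) etrans) (Const (ci 0))"

definition var_kinds :: "nat list" where
  "var_kinds = 0 # map (\<lambda>c. 2 * c + 1) \<Gamma>"

definition var_segs :: "(nat list) seg list" where
  "var_segs = std (map (\<lambda>q. 2 * q + 2) Qs @ var_kinds) var_kinds (\<lambda>_. var_kinds) var_kinds"

text \<open>
  All the variables of the copy \<open>b\<close>, in the order in which a program can list them cell by cell.
\<close>

definition vars :: "nat \<Rightarrow> (nat + nat) list \<Rightarrow> bool \<Rightarrow> nat list" where
  "vars D u b = concat (row (ci 0) D u (\<lambda>j w ks. map (\<lambda>k. vn b k (j + 1)) ks) var_segs)"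

text \<open>
  The values of the configurations described by the copy \<open>b\<close>, for runs of at most \<open>m\<close> steps. Each stage
  occurs once, so that the length is linear in \<open>m\<close>.
\<close>

fun run_formula :: "nat \<Rightarrow> (nat + nat) list \<Rightarrow> nat \<Rightarrow> bool \<Rightarrow> nat wqbf" where
  "run_formula D u 0 b = Const (ci 1)"
| "run_formula D u (Suc m) b =
     foldr SumQ (vars D u (\<not> b)) (Times (step_formula D u b) (run_formula D u m (\<not> b)))"

text \<open>
  The initial configuration: the head is on the first cell of the input, and the letters are those of the
  input or blank.
\<close>

definition head_segs :: "tmpl seg list" where
  "head_segs = [One (TLit False False 0 1), Loop (TLit False False 0 1), One (TLit True False 0 1),
     Input (\<lambda>_. TLit False False 0 1), Loop (TLit False False 0 1)]"

definition init_segs :: "tmpl seg list" where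
  "init_segs = std (TTimes (state_tmpl False (start_state M)) (symbol_tmpl False (blank M)))
     (symbol_tmpl False (blank M))
     (\<lambda>s. symbol_tmpl False (case s of Some a \<Rightarrow> a | None \<Rightarrow> placeholder M))
     (symbol_tmpl False (blank M))"

definition machine_formula :: "nat \<Rightarrow> (nat + nat) list \<Rightarrow> nat wqbf" where
  "machine_formula D u = foldr SumQ (vars D u False)
     (Times (row_formula D u head_segs) (Times (row_formula D u init_segs) (run_formula D u (2 * D) False)))"

lemma set_vars:
  "set (vars D u b) = {vn b (2 * q + 2) 1 | q. q \<in> set Qs} \<union> {vn b 0 (j + 1) | j. j < width D u} \<union>
     {vn b (2 * c + 1) (j + 1) | c j. c \<in> set \<Gamma> \<and> j < width D u}"
proof -
  have "0 < width D u" by (simp add: width_def)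
  then show ?thesis
    unfolding vars_def var_segs_def row_std var_kinds_def cell_sym_def
    by (auto split: if_splits sum.splits) 
qed

lemma distinct_concat_map:
  "distinct xs \<Longrightarrow> (\<And>x. x \<in> set xs \<Longrightarrow> distinct (f x)) \<Longrightarrow>
   (\<And>x y. x \<in> set xs \<Longrightarrow> y \<in> set xs \<Longrightarrow> x \<noteq> y \<Longrightarrow> set (f x) \<inter> set (f y) = {}) \<Longrightarrow> distinct (concat (map f xs))"
  by (induction xs) auto

lemma distinct_vars: "distinct (vars D u b)"
proof -
  have "distinct (map (\<lambda>q. 2 * q + 2) Qs @ var_kinds)" "distinct var_kinds"
    using distinct_\<Gamma> distinct_Qs by (auto simp: var_kinds_def distinct_map inj_on_def) presburger+
  then have *: "distinct (if j = 0 then map (\<lambda>q. 2 * q + 2) Qs @ var_kinds else if j = width D u - 1 then var_kinds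
          else cell_sym (\<lambda>_. var_kinds) var_kinds D u j)" for j
    by (simp add: cell_sym_def split: sum.splits)
  show ?thesis
    unfolding vars_def var_segs_def row_std
  proof (rule distinct_concat_map)
    fix j show "distinct (map (\<lambda>k. vn b k (j + 1)) (if j = 0 then map (\<lambda>q. 2 * q + 2) Qs @ var_kinds else if j = width D u - 1 then var_kinds
          else cell_sym (\<lambda>_. var_kinds) var_kinds D u j))"
      using *[of j] by (simp only: distinct_map) (simp add: inj_on_def)
  qed auto
qed

end


section \<open>The value of one stage of the tableau\<close>

lemma prod_indicator:
  "finite S \<Longrightarrow> (\<Prod>j\<in>S. if P j then w j else 0) = (if \<forall>j\<in>S. P j then \<Prod>j\<in>S. w j else (0 :: 'a::comm_semiring_1))"
  by (induction S rule: finite_induct) auto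

lemma prod_list_indicator:
  "prod_list (map (\<lambda>x. if P x then 1 else 0) xs) = (if \<forall>x\<in>set xs. P x then 1 else (0 :: 'a::comm_semiring_1))"
  by (induction xs) auto

text \<open>
  An input \<open>u\<close>, with indices in place of semiring values, and a valuation of the indices. The valuation
  is as required of the reserved indices.
\<close>

locale tableau_sem = tableau M rs for M :: "'r::comm_semiring_1 srtm" and rs +
  fixes \<sigma> :: "nat \<Rightarrow> 'r" and u :: "(nat + nat) list" and D :: nat
  assumes \<sigma>: "\<And>i. i < length rs \<Longrightarrow> \<sigma> i = rs ! i"
    and u: "u \<in> words_over (input_alphabet M)"
begin

abbreviation fsem :: "nat wqbf \<Rightarrow> (nat \<Rightarrow> bool) \<Rightarrow> 'r" where
  "fsem \<phi> \<equiv> esem (map_wqbf \<sigma> \<phi>)"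

abbreviation tsem :: "nat \<Rightarrow> nat \<Rightarrow> tmpl \<Rightarrow> (nat \<Rightarrow> bool) \<Rightarrow> 'r" where
  "tsem j w t \<equiv> fsem (inst j w t)"

lemma \<sigma>_ci: "r \<in> insert 0 (insert 1 (weights M)) \<Longrightarrow> \<sigma> (ci r) = r"
  using ci[of r] \<sigma> by simp

lemma \<sigma>_ci01 [simp]: "\<sigma> (ci 0) = 0" "\<sigma> (ci 1) = 1"
  by (simp_all add: \<sigma>_ci)

lemma tsem_TLit [simp]: "tsem j w (TLit s b k d) A = (if A (vn b k (j + d)) = s then 1 else 0)"
  by auto

lemma tsem_iff [simp]:
  "tsem j w (iff_tmpl (b, k, d) (b', k', d')) A = (if A (vn b k (j + d)) = A (vn b' k' (j + d')) then 1 else 0)"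
  by (simp add: iff_tmpl_def)

lemma tsem_tprods [simp]: "tsem j w (tprods ts) A = prod_list (map (\<lambda>t. tsem j w t A) ts)"
  unfolding tprods_def by (induction ts) simp_all

lemma fsem_prods: "fsem (prods (ci 1) fs) A = prod_list (map (\<lambda>f. fsem f A) fs)"
  unfolding prods_def by (induction fs) simp_all

lemma fsem_SumQs: "map_wqbf \<sigma> (foldr SumQ vs \<phi>) = foldr SumQ vs (map_wqbf \<sigma> \<phi>)"
  by (induction vs) simp_all

lemma tsem_copy: "tsem j w (copy_tmpl b) A =
    (if \<forall>c\<in>set \<Gamma>. A (vn (\<not> b) (2 * c + 1) (j + 1)) = A (vn b (2 * c + 1) (j + 1)) then 1 else 0)"
  unfolding copy_tmpl_def by (simp add: o_def prod_list_indicator del: inst.simps)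

lemma tsem_symbol: "tsem j w (symbol_tmpl b a) A =
    (if \<forall>c\<in>set \<Gamma>. A (vn b (2 * c + 1) (j + 1)) = (a = c) then 1 else 0)"
  unfolding symbol_tmpl_def by (auto simp add: o_def prod_list_indicator simp del: inst.simps)

lemma tsem_state: "tsem j w (state_tmpl b q) A =
    (if \<forall>p\<in>set Qs. A (vn b (2 * p + 2) (j + 1)) = (q = p) then 1 else 0)"
  unfolding state_tmpl_def by (auto simp add: o_def prod_list_indicator simp del: inst.simps)

lemma tsem_TTimes [simp]: "tsem j w (TTimes s t) A = tsem j w s A * tsem j w t A"
  and tsem_TPlus [simp]: "tsem j w (TPlus s t) A = tsem j w s A + tsem j w t A"
  by simp_all

abbreviation W :: nat where "W \<equiv> width D u"

definition pos :: "nat \<Rightarrow> int" where "pos j = int j - (int D + 1)"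

text \<open>
  The copy \<open>b\<close> of the variables describes the configuration \<open>c\<close>. The semiring values of the tape never
  change, so they are not described by variables (\<open>vals_ok\<close>).
\<close>

definition agree :: "bool \<Rightarrow> 'r config \<Rightarrow> (nat \<Rightarrow> bool) \<Rightarrow> bool" where
  "agree b c A \<longleftrightarrow> (case c of (q, x, n) \<Rightarrow>
     (\<forall>p\<in>set Qs. A (vn b (2 * p + 2) 1) = (q = p)) \<and>
     (\<forall>j<W. A (vn b 0 (j + 1)) = (pos j = n)) \<and>
     (\<forall>j<W. \<forall>c\<in>set \<Gamma>. A (vn b (2 * c + 1) (j + 1)) = (fst (x (pos j)) = c)))"

definition vals_ok :: "'r config \<Rightarrow> bool" where
  "vals_ok c \<longleftrightarrow> (case c of (q, x, n) \<Rightarrow> \<forall>j<W. snd (x (pos j)) = \<sigma> (cell_index (ci 0) D u j))"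

lemma fsem_row:
  "fsem (row_formula D u (std x c g e)) A =
     (\<Prod>j<W. tsem j (cell_index (ci 0) D u j)
        (if j = 0 then x else if j = W - 1 then e else cell_sym g c D u j) A)"
  unfolding row_formula_def fsem_prods row_std map_map o_def
  by (subst prod.distinct_set_conv_list[symmetric]) (simp_all add: atLeast0LessThan)

lemma fsem_step_formula:
  "fsem (step_formula D u b) A = (\<Sum>t\<in>ext. fsem (row_formula D u (step_segs b t)) A)"
proof -
  have "fsem (foldr Plus (map f ts) (Const (ci 0))) A = (\<Sum>t\<leftarrow>ts. fsem (f t) A)" for f and ts :: "'r transition list"
    by (induction ts) simp_all
  then show ?thesis
    unfolding step_formula_def using etrans by (simp add: sum_list_distinct_conv_sum_set)
qed

text \<open>
  In the summand of the transition \<open>t\<close>, the product over the cells is the weight of \<open>t\<close> if \<open>t\<close> is applicable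
  to the configuration described by the copy \<open>b\<close> and leads to the one described by the other copy;
  otherwise it is \<open>0\<close>. The head has to stay away from the outermost cells.
\<close>

lemma step_segs_sem:
  assumes "agree b (q0, x, n) A" "pos h = n" "0 < h" "h < W - 1"
    "wf_config (q0, x, n)" "vals_ok (q0, x, n)" "t \<in> ext"
  shows "t \<notin> eapp (q0, x, n) \<Longrightarrow> fsem (row_formula D u (step_segs b t)) A = 0"
    and "t \<in> eapp (q0, x, n) \<Longrightarrow> 0 < pos h + fst (snd (snd t)) + int D + 1 \<Longrightarrow>
      pos h + fst (snd (snd t)) + int D + 1 < int W - 1 \<Longrightarrow>
      fsem (row_formula D u (step_segs b t)) A =
        (if agree (\<not> b) (successor t (q0, x, n)) A then wt t (q0, x, n) else 0)"
proof -
  obtain q a q' a' d r where t: "t = ((q, a), (q', a'), d, r)" by (metis prod.exhaust)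
  note ext = ext_cases[OF assms(7)[unfolded t]]
  let ?f = "\<lambda>j. tsem j (cell_index (ci 0) D u j)
        (if j = 0 then first_tmpl b t else if j = W - 1 then edge_tmpl b else cell_tmpl b t) A"
  have F: "fsem (row_formula D u (step_segs b t)) A = (\<Prod>j<W. ?f j)"
    unfolding step_segs_def fsem_row cell_sym_def by (intro prod.cong) (auto split: sum.splits)
  have st: "A (vn b (2 * p + 2) 1) = (q0 = p)" if "p \<in> set Qs" for p
    using assms(1) that by (simp add: agree_def)
  have hd: "A (vn b 0 (j + 1)) = (j = h)" if "j < W" for j
    using assms(1,2) that by (auto simp: agree_def pos_def)
  have sy: "A (vn b (2 * c + 1) (j + 1)) = (fst (x (pos j)) = c)" if "j < W" "c \<in> set \<Gamma>" for j c
    using assms(1) that by (simp add: agree_def)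
  have hW: "h < W" using assms(4) by simp
  { assume "t \<notin> eapp (q0, x, n)"
    then consider "q0 \<noteq> q" | "fst (x n) \<noteq> a" using assms(7) by (auto simp: eapp_def t)
    then have ex0: "\<exists>j<W. ?f j = 0"
    proof cases
      case 1
      have "q \<in> set Qs" using ext set_Qs by simp
      then have "\<not> A (vn b (2 * q + 2) 1)" using st 1 by simp
      then have "?f 0 = 0" by (simp add: t)
      with hW show ?thesis by (intro exI[of _ 0]) auto
    next
      case 2
      have "a \<in> set \<Gamma>" using ext set_\<Gamma> by simp
      then have "\<not> A (vn b (2 * a + 1) (h + 1))" using sy[OF hW] 2 assms(2) by simp
      moreover have "A (vn b 0 (h + 1))" using hd[OF hW] by simp
      ultimately have "?f h = 0" using assms(3,4) by (simp add: t)
      with hW show ?thesis by blast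
    qed
    show "fsem (row_formula D u (step_segs b t)) A = 0"
      unfolding F by (rule prod_zero) (simp, use ex0 in \<open>blast intro: lessThan_iff[THEN iffD2]\<close>) }
  assume "t \<in> eapp (q0, x, n)"
    and bounds: "0 < pos h + fst (snd (snd t)) + int D + 1" "pos h + fst (snd (snd t)) + int D + 1 < int W - 1"
  then have t': "q = q0" "a = fst (x n)" by (auto simp: eapp_def t)
  have d: "d \<in> {-1, 0, 1}" using ext by simp
  have bd: "0 < int h + d" "int h + d < int W - 1" using bounds by (simp_all add: t pos_def)
  let ?x = "x(n := (a', snd (x n)))"
  define ok where "ok j \<longleftrightarrow> A (vn (\<not> b) 0 (j + 1)) = (int j = int h + d) \<and>
     (\<forall>c\<in>set \<Gamma>. A (vn (\<not> b) (2 * c + 1) (j + 1)) = (fst (?x (pos j)) = c)) \<and>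
     (j = 0 \<longrightarrow> (\<forall>p\<in>set Qs. A (vn (\<not> b) (2 * p + 2) 1) = (q' = p)))" for j
  define wj where "wj j = (if j = h then wt t (q0, x, n) else 1)" for j
  have q: "q0 \<in> set Qs" using ext t' set_Qs by simp
  have a: "a \<in> set \<Gamma>" using ext set_\<Gamma> by simp
  have pos_h: "pos j = n \<longleftrightarrow> j = h" for j using assms(2) by (auto simp: pos_def)
  have copy: "tsem j w (copy_tmpl b) A = (if \<forall>c\<in>set \<Gamma>. A (vn (\<not> b) (2 * c + 1) (j + 1)) = (fst (?x (pos j)) = c) then 1 else 0)"
    if "j < W" "j \<noteq> h" for j w
    unfolding tsem_copy using sy[OF that(1)] that(2) pos_h by simp
  have "?f j = (if ok j then wj j else 0)" if j: "j < W" for j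
  proof -
    consider "j = 0" | "j = W - 1" "j \<noteq> 0" | "0 < j" "j < W - 1" using j by linarith
    then show ?thesis
    proof cases
      case 1
      have "A (vn b (2 * q0 + 2) (0 + 1))" using st[OF q] by simp
      then show ?thesis
        using copy[of 0] assms(3) hW 1 bd unfolding 1
        by (simp add: t t' ok_def wj_def edge_tmpl_def tsem_state del: inst.simps)
    next
      case 2
      then show ?thesis
        using copy[of j] assms(4) j bd by (simp add: t t' ok_def wj_def edge_tmpl_def del: inst.simps)
    next
      case 3
      have "A (vn b 0 (j + nat (1 - d))) = (int j = int h + d)"
      proof -
        have e: "j + nat (1 - d) = nat (int j - d) + 1" "nat (int j - d) < W" using d 3 by auto
        show ?thesis unfolding e(1) hd[OF e(2)] using d 3 by auto
      qed
      then have iff: "tsem j w (iff_tmpl (\<not> b, 0, 1) (b, 0, nat (1 - d))) A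
          = (if A (vn (\<not> b) 0 (j + 1)) = (int j = int h + d) then 1 else 0)" for w
        by simp
      have wt: "tsem h (cell_index (ci 0) D u h) (weight_tmpl r) A = wt t (q0, x, n)"
      proof (cases r)
        case (Inl s)
        have "snd (x n) = \<sigma> (cell_index (ci 0) D u h)"
          using assms(6) hW unfolding vals_ok_def assms(2)[symmetric] by simp
        with Inl show ?thesis by (simp add: t)
      next
        case (Inr k)
        with ext have "k \<in> insert 0 (insert 1 (weights M))" by auto
        then show ?thesis using \<sigma>_ci Inr by (simp add: t)
      qed
      show ?thesis
      proof (cases "j = h")
        case True
        have "A (vn b (2 * a + 1) (h + 1))" using sy[OF hW a] t' assms(2) by simp
        moreover have "A (vn b 0 (h + 1))" using hd[OF hW] by simp
        ultimately show ?thesis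
          using 3 True assms(2) by (simp add: t iff[unfolded True] tsem_symbol ok_def wj_def wt[unfolded t] del: inst.simps tsem_iff One_nat_def)
      next
        case False
        then have "\<not> A (vn b 0 (j + 1))" using hd[OF j] by simp
        then show ?thesis
          using 3 False copy[OF j False] by (simp add: t iff ok_def wj_def del: inst.simps tsem_iff One_nat_def)
      qed
    qed
  qed
  then have "(\<Prod>j<W. ?f j) = (\<Prod>j<W. if ok j then wj j else 0)" by simp
  also have "\<dots> = (if \<forall>j<W. ok j then \<Prod>j<W. wj j else 0)"
    by (subst prod_indicator) auto
  also have "(\<Prod>j<W. wj j) = wt t (q0, x, n)"
    using hW by (simp add: wj_def)
  also have "(\<forall>j<W. ok j) \<longleftrightarrow> agree (\<not> b) (successor t (q0, x, n)) A"
  proof -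
    have "successor t (q0, x, n) = (q', ?x, n + d)" by (simp add: t)
    moreover have "pos j = n + d \<longleftrightarrow> int j = int h + d" for j
      using assms(2) by (auto simp: pos_def)
    moreover have "0 < W" using hW by simp
    ultimately show ?thesis by (auto simp: agree_def ok_def)
  qed
  finally show "fsem (row_formula D u (step_segs b t)) A =
        (if agree (\<not> b) (successor t (q0, x, n)) A then wt t (q0, x, n) else 0)"
    unfolding F .
qed

end


section \<open>The value of the stages\<close>

context tableau_sem begin

text \<open>
  The assignment of the variables of the copy \<open>b\<close> that describes \<open>c\<close>.
\<close>

definition target :: "bool \<Rightarrow> 'r config \<Rightarrow> nat \<Rightarrow> bool" where
  "target b c v \<longleftrightarrow> (case c of (q, x, n) \<Rightarrow>
     v = vn b (2 * q + 2) 1 \<or>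
     (\<exists>j. v = vn b 0 (j + 1) \<and> pos j = n) \<or>
     (\<exists>j. v = vn b (2 * fst (x (pos j)) + 1) (j + 1)))"

lemma agree_iff_target: "agree b c A \<longleftrightarrow> (\<forall>v\<in>set (vars D u b). A v = target b c v)"
proof (cases c)
  case (fields q x n)
  have par: "2 * p + 2 \<noteq> 2 * m + 1" "2 * m + 1 \<noteq> 2 * p + (2 :: nat)" for p m :: nat by presburger+
  have "target b c (vn b (2 * p + 2) 1) \<longleftrightarrow> q = p"
    and "target b c (vn b 0 (j + 1)) \<longleftrightarrow> pos j = n"
    and "target b c (vn b (2 * m + 1) (j + 1)) \<longleftrightarrow> fst (x (pos j)) = m" for p j m
    using par by (auto simp: target_def fields)
  then show ?thesis
    unfolding agree_def fields set_vars prod.case by (auto simp: fields simp del: One_nat_def)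
qed

lemma agree_override: "agree b c (\<lambda>v. if v \<in> set (vars D u b) then target b c v else A v)"
  by (simp add: agree_iff_target)

lemma agree_cong:
  "(\<And>v. v \<in> set (vars D u b) \<Longrightarrow> A v = A' v) \<Longrightarrow> agree b c A \<longleftrightarrow> agree b c A'"
  by (simp add: agree_iff_target)

lemma vars_disjoint: "v \<in> set (vars D u b) \<Longrightarrow> v \<notin> set (vars D u (\<not> b))"
  by (auto simp: set_vars)

text \<open>
  One stage performs one step of the recursion that defines the value: summation over transitions
  and assignments leaves one term for each transition that is applicable.
\<close>

lemma run_step:
  assumes "agree b c A" "c = (q0, x, n)" "pos h = n" "0 < h" "h < W - 1" "wf_config c" "vals_ok c"
    and bounds: "\<And>t. t \<in> eapp c \<Longrightarrow> 0 < pos h + fst (snd (snd t)) + int D + 1 \<and> pos h + fst (snd (snd t)) + int D + 1 < int W - 1"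
    and V: "\<And>t A'. t \<in> eapp c \<Longrightarrow> agree (\<not> b) (successor t c) A' \<Longrightarrow> fsem (run_formula D u m (\<not> b)) A' = V t"
  shows "fsem (run_formula D u (Suc m) b) A = (\<Sum>t\<in>eapp c. wt t c * V t)"
proof -
  let ?vs = "vars D u (\<not> b)"
  let ?body = "\<lambda>t. Times (map_wqbf \<sigma> (row_formula D u (step_segs b t))) (map_wqbf \<sigma> (run_formula D u m (\<not> b)))"
  have "fsem (run_formula D u (Suc m) b) A =
      esem (foldr SumQ ?vs (Times (map_wqbf \<sigma> (step_formula D u b)) (map_wqbf \<sigma> (run_formula D u m (\<not> b))))) A"
    by (simp add: fsem_SumQs)
  also have "\<dots> = (\<Sum>t\<in>ext. esem (foldr SumQ ?vs (?body t)) A)"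
    by (rule esem_sum_SumQs) (simp add: fsem_step_formula sum_distrib_right)
  also have "\<dots> = (\<Sum>t\<in>ext. if t \<in> eapp c then wt t c * V t else 0)"
  proof (rule sum.cong[OF refl])
    fix t assume t: "t \<in> ext"
    have old: "agree b c A'" if "\<And>v. v \<notin> set ?vs \<Longrightarrow> A' v = A v" for A'
      using assms(1) agree_cong[of b A' A c] that vars_disjoint by blast
    show "esem (foldr SumQ ?vs (?body t)) A = (if t \<in> eapp c then wt t c * V t else 0)"
    proof (cases "t \<in> eapp c")
      case False
      have "esem (foldr SumQ ?vs (?body t)) A = 0"
      proof (rule esem_zero_SumQs)
        fix A' assume "\<And>v. v \<notin> set ?vs \<Longrightarrow> A' v = A v"
        with step_segs_sem(1)[OF _ assms(3-5) _ _ t] old[of A'] assms(6,7) False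
        show "esem (?body t) A' = 0" unfolding assms(2) by simp
      qed
      with False show ?thesis by simp
    next
      case True
      let ?T = "target (\<not> b) (successor t c)"
      have val: "fsem (row_formula D u (step_segs b t)) A' =
          (if agree (\<not> b) (successor t c) A' then wt t c else 0)" if "\<And>v. v \<notin> set ?vs \<Longrightarrow> A' v = A v" for A'
        using step_segs_sem(2)[OF _ assms(3-5) _ _ t, of b q0 x A'] old[of A'] assms(6,7) True that bounds[OF True]
        unfolding assms(2) by blast
      have "esem (foldr SumQ ?vs (?body t)) A = esem (?body t) (\<lambda>v. if v \<in> set ?vs then ?T v else A v)"
      proof (rule esem_unique_SumQs[OF distinct_vars])
        fix A' assume A': "\<And>v. v \<notin> set ?vs \<Longrightarrow> A' v = A v" and "\<exists>v\<in>set ?vs. A' v \<noteq> ?T v"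
        then have "\<not> agree (\<not> b) (successor t c) A'" by (simp add: agree_iff_target)
        with val[OF A'] show "esem (?body t) A' = 0" by simp
      qed
      also have "\<dots> = wt t c * V t"
        using val[of "\<lambda>v. if v \<in> set ?vs then ?T v else A v"] V[OF True agree_override] agree_override by simp
      finally show ?thesis using True by simp
    qed
  qed
  also have "\<dots> = (\<Sum>t\<in>eapp c. wt t c * V t)"
  proof -
    have "eapp c \<subseteq> ext" by (cases c) (auto simp: eapp_def)
    then show ?thesis using finite_ext by (simp add: sum.inter_restrict[symmetric] Int_absorb1)
  qed
  finally show ?thesis .
qed

lemma vals_ok_successor: "vals_ok c \<Longrightarrow> vals_ok (successor t c)"
proof -
  obtain q a q' a' d r where "t = ((q, a), (q', a'), d, r)" by (metis prod.exhaust)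
  then show "vals_ok c \<Longrightarrow> vals_ok (successor t c)" by (cases c) (auto simp: vals_ok_def)
qed

lemma run_halted:
  assumes "applicable M c = {}" "wf_config c" "vals_ok c" "c = (q, x, n)" "\<bar>n\<bar> < int D"
  shows "agree b c A \<Longrightarrow> fsem (run_formula D u m b) A = 1"
proof (induction m arbitrary: b A)
  case (Suc m)
  \<comment> \<open>The added loop is the only transition that is applicable.\<close>
  let ?t = "((q, fst (x n)), (q, fst (x n)), 0, Inr 1) :: 'r transition"
  have e: "eapp c = {?t}" using eapp_halting assms by simp
  have s: "successor ?t c = c" by (simp add: assms(4))
  define h where "h = nat (n + int D + 1)"
  have h: "pos h = n" "0 < h" "h < W - 1" using assms(5) by (auto simp: h_def pos_def width_def)
  have "fsem (run_formula D u (Suc m) b) A = (\<Sum>t\<in>eapp c. wt t c * 1)"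
  proof (rule run_step[OF Suc.prems assms(4) h assms(2,3)])
    fix t A' assume t: "t \<in> eapp c"
    show "0 < pos h + fst (snd (snd t)) + int D + 1 \<and> pos h + fst (snd (snd t)) + int D + 1 < int W - 1"
      using t assms(5) unfolding e h(1) by (auto simp: width_def)
    assume "agree (\<not> b) (successor t c) A'"
    with t have "agree (\<not> b) c A'" using e s by auto
    then show "fsem (run_formula D u m (\<not> b)) A' = 1" by (rule Suc.IH)
  qed
  also have "(\<Sum>t\<in>eapp c. wt t c * 1) = 1" unfolding e using assms(4) by simp
  finally show ?case .
qed simp

text \<open>
  Each step moves the head by at most one cell, so that a run of less than \<open>D\<close> steps from position \<open>0\<close>
  does not reach the outermost cells.
\<close>

lemma run_evals:
  "evals M k c v \<Longrightarrow> k \<le> m \<Longrightarrow> wf_config c \<Longrightarrow> vals_ok c \<Longrightarrow> \<bar>snd (snd c)\<bar> + int k < int D \<Longrightarrow> agree b c A \<Longrightarrow>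
   fsem (run_formula D u m b) A = v"
proof (induction arbitrary: m b A rule: evals.induct)
  case (halt c k)
  then show ?case by (intro run_halted[of c "fst c" "fst (snd c)" "snd (snd c)"]) auto
next
  case (step c k V)
  then obtain m' where m: "m = Suc m'" "k \<le> m'" by (cases m) auto
  obtain q x n where c: "c = (q, x, n)" by (metis prod.exhaust)
  define h where "h = nat (n + int D + 1)"
  have h: "pos h = n" "0 < h" "h < W - 1" using step.prems(4) by (auto simp: c h_def pos_def width_def)
  have e: "eapp c = applicable M c" using eapp_applicable step.hyps(1) .
  have d: "fst (snd (snd t)) \<in> {-1, 0, 1}" "snd (snd (successor t c)) = n + fst (snd (snd t))" if "t \<in> eapp c" for t
  proof -
    obtain q a q' a' d r where t: "t = ((q, a), (q', a'), d, r)" by (metis prod.exhaust)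
    with that have "((q, a), (q', a'), d, r) \<in> ext" by (auto simp: eapp_def c)
    from ext_cases(5)[OF this] show "fst (snd (snd t)) \<in> {-1, 0, 1}" by (simp add: t)
    show "snd (snd (successor t c)) = n + fst (snd (snd t))" by (simp add: t c)
  qed
  have "fsem (run_formula D u (Suc m') b) A = (\<Sum>t\<in>eapp c. wt t c * V t)"
  proof (rule run_step[OF step.prems(5) c h step.prems(2,3)])
    fix t A' assume t: "t \<in> eapp c"
    show "0 < pos h + fst (snd (snd t)) + int D + 1 \<and> pos h + fst (snd (snd t)) + int D + 1 < int W - 1"
      using d(1)[OF t] step.prems(4) unfolding h(1) by (auto simp: c width_def)
    assume "agree (\<not> b) (successor t c) A'"
    then show "fsem (run_formula D u m' (\<not> b)) A' = V t"
      using t t[unfolded e] step.prems(4) d[OF t] wf_successor[OF t step.prems(2)] vals_ok_successor[OF step.prems(3)] m(2)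
      by (intro step.IH) (auto simp: e c)
  qed
  then show ?case by (simp add: m e)
qed

end


section \<open>The initial stage, and the value of the tableau formula\<close>

context tableau begin

lemma row_head:
  "row z D u inst head_segs = map (\<lambda>j. Lit ((if j = D + 1 then PosLit else NegLit) (vn False 0 (j + 1)))) [0..<width D u]"
proof -
  let ?f = "\<lambda>j. TLit (j = D + 1) False 0 1"
  have len: "length (cells z D u head_segs) = width D u"
    by (simp add: cells_def head_segs_def width_def)
  have "fst (cells z D u head_segs ! j) = ?f j" if "j < width D u" for j
    using that
    by (auto simp: cells_def head_segs_def width_def nth_append nth_Cons' split: sum.splits)
  then have "inst j w (fst (cells z D u head_segs ! j)) = Lit ((if j = D + 1 then PosLit else NegLit) (vn False 0 (j + 1)))"
    if "j < width D u" for j w using that by simp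
  with len show ?thesis
    by (intro nth_equalityI) (simp_all add: row_def nth_enumerate_eq case_prod_beta)
qed

end

context tableau_sem begin

definition input_word :: "'r word" where
  "input_word = map (map_sum id \<sigma>) u"

lemma init_cell:
  assumes "j < W" "initial_config M input_word = (q, x, n)"
  shows "snd (x (pos j)) = \<sigma> (cell_index (ci 0) D u j)"
    and "fst (x (pos j)) = cell_sym (\<lambda>s. case s of Some a \<Rightarrow> a | None \<Rightarrow> placeholder M) (blank M) D u j"
proof -
  have x: "x i = (if 0 \<le> i \<and> i < int (length u)
          then (case map_sum id \<sigma> (u ! nat i) of Inl a \<Rightarrow> (a, 0) | Inr k \<Rightarrow> (placeholder M, k))
          else (blank M, 0))" for i
    using assms(2) by (auto simp: initial_config_def input_word_def nat_less_iff)
  have p: "0 \<le> pos j \<and> pos j < int (length u) \<longleftrightarrow> D < j \<and> j \<le> D + length u" "nat (pos j) = j - D - 1"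
    by (auto simp: pos_def)
  show "snd (x (pos j)) = \<sigma> (cell_index (ci 0) D u j)"
    and "fst (x (pos j)) = cell_sym (\<lambda>s. case s of Some a \<Rightarrow> a | None \<Rightarrow> placeholder M) (blank M) D u j"
    unfolding x p cell_index_def cell_sym_def by (auto split: sum.splits)
qed

lemma init_sem:
  "fsem (row_formula D u head_segs) A * fsem (row_formula D u init_segs) A =
     (if agree False (initial_config M input_word) A then 1 else 0)"
proof -
  obtain x where c: "initial_config M input_word = (start_state M, x, 0)"
    by (simp add: initial_config_def)
  have W: "0 < W" by (simp add: width_def)
  have pos0: "pos j = 0 \<longleftrightarrow> j = D + 1" for j by (auto simp: pos_def)
  have head: "fsem (row_formula D u head_segs) A = (if \<forall>j<W. A (vn False 0 (j + 1)) = (pos j = 0) then 1 else 0)"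
  proof -
    have "fsem (row_formula D u head_segs) A
        = prod_list (map (\<lambda>j. if A (vn False 0 (j + 1)) = (pos j = 0) then 1 else 0) [0..<W])"
      unfolding row_formula_def fsem_prods row_head map_map o_def pos0
      by (intro arg_cong[of _ _ prod_list] map_cong) auto
    also have "\<dots> = (if \<forall>j\<in>set [0..<W]. A (vn False 0 (j + 1)) = (pos j = 0) then 1 else 0)"
      by (rule prod_list_indicator)
    finally show ?thesis by (simp add: Ball_def)
  qed
  have init: "fsem (row_formula D u init_segs) A =
      (if \<forall>j<W. (\<forall>m\<in>set \<Gamma>. A (vn False (2 * m + 1) (j + 1)) = (fst (x (pos j)) = m)) \<and>
         (j = 0 \<longrightarrow> (\<forall>p\<in>set Qs. A (vn False (2 * p + 2) 1) = (start_state M = p))) then 1 else 0)"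
    (is "_ = (if \<forall>j<W. ?ok j then 1 else 0)")
  proof -
    have "tsem j (cell_index (ci 0) D u j)
        (if j = 0 then TTimes (state_tmpl False (start_state M)) (symbol_tmpl False (blank M)) else if j = W - 1 then symbol_tmpl False (blank M)
         else cell_sym (\<lambda>s. symbol_tmpl False (case s of Some a \<Rightarrow> a | None \<Rightarrow> placeholder M)) (symbol_tmpl False (blank M)) D u j) A
      = (if ?ok j then 1 else 0)" if j: "j < W" for j
    proof -
      have s: "cell_sym (\<lambda>s. symbol_tmpl False (case s of Some a \<Rightarrow> a | None \<Rightarrow> placeholder M)) (symbol_tmpl False (blank M)) D u j
          = symbol_tmpl False (fst (x (pos j)))"
        unfolding init_cell(2)[OF j c] cell_sym_def by (simp split: sum.split)
      have e: "fst (x (pos j)) = blank M" if "j = 0 \<or> j = W - 1"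
        unfolding init_cell(2)[OF j c] using that by (auto simp: cell_sym_def width_def)
      consider "j = 0" | "j = W - 1" "j \<noteq> 0" | "j \<noteq> 0" "j \<noteq> W - 1" by blast
      then show ?thesis
      proof cases
        case 1
        with e have "fst (x (pos 0)) = blank M" by simp
        then show ?thesis unfolding 1 by (simp add: tsem_symbol tsem_state del: inst.simps)
      next
        case 2
        with e have "fst (x (pos j)) = blank M" by simp
        with 2 show ?thesis by (simp add: tsem_symbol del: inst.simps)
      next
        case 3
        then show ?thesis by (simp add: s tsem_symbol del: inst.simps)
      qed
    qed
    then have "fsem (row_formula D u init_segs) A = (\<Prod>j<W. if ?ok j then 1 else 0)"
      unfolding init_segs_def fsem_row by (intro prod.cong) auto
    also have "\<dots> = (if \<forall>j\<in>{..<W}. ?ok j then \<Prod>j<W. 1 else 0)" by (rule prod_indicator) simp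
    finally show ?thesis by (simp only: Ball_def lessThan_iff prod.neutral_const)
  qed
  have "agree False (initial_config M input_word) A \<longleftrightarrow>
      (\<forall>j<W. A (vn False 0 (j + 1)) = (pos j = 0)) \<and> (\<forall>j<W. ?ok j)"
    unfolding agree_def c prod.case using W by blast
  moreover have "(if P then 1 else 0) * (if Q then 1 else 0) = (if P \<and> Q then 1 else (0 :: 'r))" for P Q by simp
  ultimately show ?thesis by (simp only: head init)
qed

theorem machine_formula_sem:
  assumes "evals M k (initial_config M input_word) v" "k < D"
  shows "fsem (machine_formula D u) A = v"
proof -
  let ?c = "initial_config M input_word" and ?vs = "vars D u False"
  let ?T = "target False ?c"
  let ?body = "map_wqbf \<sigma> (Times (row_formula D u head_segs) (Times (row_formula D u init_segs) (run_formula D u (2 * D) False)))"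
  have body: "esem ?body A' = (if agree False ?c A' then fsem (run_formula D u (2 * D) False) A' else 0)" for A'
    by (simp add: mult.assoc[symmetric] init_sem)
  obtain x where c: "?c = (start_state M, x, 0)"
    by (simp add: initial_config_def)
  have "wf_config ?c"
  proof -
    have letters: "a \<in> tape_alphabet M" if "Inl a \<in> set u" for a
      using u that srtm by (auto simp: words_over_def lists_eq_set srtm_def)
    have "fst (x i) \<in> tape_alphabet M" for i
    proof (cases "0 \<le> i \<and> i < int (length u)")
      case True
      then have "nat i < length u" by (simp add: nat_less_iff)
      then have "u ! nat i \<in> set u" by simp
      with c True srtm letters show ?thesis
        by (cases "u ! nat i") (auto simp: initial_config_def input_word_def srtm_def)
    next
      case False
      with c srtm show ?thesis by (auto simp: initial_config_def input_word_def srtm_def)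
    qed
    with srtm show ?thesis by (simp add: wf_config_def c srtm_def)
  qed
  moreover have "vals_ok ?c"
    unfolding vals_ok_def c prod.case using init_cell(1)[OF _ c] by blast
  ultimately have run: "agree False ?c A' \<Longrightarrow> fsem (run_formula D u (2 * D) False) A' = v" for A'
    using assms(2) by (intro run_evals[OF assms(1)]) (auto simp: c)
  have "fsem (machine_formula D u) A = esem (foldr SumQ ?vs ?body) A"
    by (simp add: machine_formula_def fsem_SumQs)
  also have "\<dots> = esem ?body (\<lambda>v. if v \<in> set ?vs then ?T v else A v)"
  proof (rule esem_unique_SumQs[OF distinct_vars])
    fix A' assume "\<exists>v\<in>set ?vs. A' v \<noteq> ?T v"
    then have "\<not> agree False ?c A'" by (simp add: agree_iff_target)
    then show "esem ?body A' = 0" by (simp only: body if_False)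
  qed
  also have "\<dots> = v" unfolding body using run agree_override by simp
  finally show ?thesis .
qed

end


section \<open>The tableau formula is closed\<close>

fun tvars :: "tmpl \<Rightarrow> (bool \<times> nat \<times> nat) set" where
  "tvars (TLit s b k d) = {(b, k, d)}"
| "tvars (TConst c) = {}"
| "tvars TWeight = {}"
| "tvars (TPlus t u) = tvars t \<union> tvars u"
| "tvars (TTimes t u) = tvars t \<union> tvars u"

lemma free_vars_inst: "free_vars (inst j w t) = (\<lambda>(b, k, d). vn b k (j + d)) ` tvars t"
proof (induction t)
  case (TLit s b k d)
  then show ?case by (cases s) auto
qed (simp_all add: image_Un)

lemma only_sum_inst: "only_sum_quantifiers (inst j w t)"
  by (induction t) auto

lemma free_vars_SumQs: "free_vars (foldr SumQ vs \<phi>) = free_vars \<phi> - set vs"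
  by (induction vs) auto

lemma only_sum_SumQs: "only_sum_quantifiers (foldr SumQ vs \<phi>) = only_sum_quantifiers \<phi>"
  by (induction vs) auto

lemma free_vars_prods: "free_vars (prods e fs) = \<Union> (free_vars ` set fs)"
  unfolding prods_def by (induction fs) auto

lemma only_sum_prods: "only_sum_quantifiers (prods e fs) = (\<forall>f\<in>set fs. only_sum_quantifiers f)"
  unfolding prods_def by (induction fs) auto

lemma free_vars_map: "free_vars (map_wqbf \<sigma> \<phi>) = free_vars \<phi>"
proof (induction \<phi>)
  case (Lit l)
  then show ?case by (cases l) auto
qed auto

lemma only_sum_map: "only_sum_quantifiers (map_wqbf \<sigma> \<phi>) = only_sum_quantifiers \<phi>"
  by (induction \<phi>) auto

context tableau begin

lemma only_sum_row: "only_sum_quantifiers (row_formula D u segs)"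
  by (auto simp: row_formula_def only_sum_prods row_def only_sum_inst)

lemma only_sum_run: "only_sum_quantifiers (run_formula D u m b)"
proof -
  have "only_sum_quantifiers (foldr Plus (map (\<lambda>t. row_formula D u (step_segs b t)) ts) (Const z))" for b ts z
    by (induction ts) (auto simp: only_sum_row)
  then show ?thesis
    by (induction m arbitrary: b) (auto simp: only_sum_SumQs step_formula_def)
qed

lemma tvars_tprods [simp]: "tvars (tprods ts) = \<Union> (tvars ` set ts)"
  unfolding tprods_def by (induction ts) auto

lemma tvars_iff [simp]: "tvars (iff_tmpl x y) = {x, y}"
  by (cases x; cases y) (auto simp: iff_tmpl_def)

lemma tvars_weight [simp]: "tvars (weight_tmpl r) = {}"
  by (cases r) auto

lemma tvars_tmpls [simp]:
  "tvars (copy_tmpl b) = {(b', 2 * c + 1, 1) | b' c. c \<in> set \<Gamma>}"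
  "tvars (symbol_tmpl b a) = {(b, 2 * c + 1, 1) | c. c \<in> set \<Gamma>}"
  "tvars (state_tmpl b q) = {(b, 2 * p + 2, 1) | p. p \<in> set Qs}"
  by (auto simp: copy_tmpl_def symbol_tmpl_def state_tmpl_def) 

lemma free_vars_row_std:
  "free_vars (row_formula D u (std x c g e)) = (\<Union>j<width D u. (\<lambda>(b, k, d). vn b k (j + d)) `
     tvars (if j = 0 then x else if j = width D u - 1 then e else cell_sym g c D u j))"
  unfolding row_formula_def free_vars_prods row_std
  by (simp add: free_vars_inst atLeast0LessThan image_image)

lemma cell_sym_const: "cell_sym (\<lambda>_. c) c D u j = c"
  by (simp add: cell_sym_def split: sum.split)

lemma free_vars_step:
  assumes "t \<in> ext"
  shows "free_vars (row_formula D u (step_segs b t)) \<subseteq> set (vars D u b) \<union> set (vars D u (\<not> b))"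
proof -
  obtain q a q' a' d r where t: "t = ((q, a), (q', a'), d, r)" by (metis prod.exhaust)
  note ext = ext_cases[OF assms[unfolded t]]
  define V where "V = set (vars D u b) \<union> set (vars D u (\<not> b))"
  have qs: "q \<in> set Qs" "a \<in> set \<Gamma>" using ext set_Qs set_\<Gamma> by auto
  have var: "vn b' (2 * c + 1) (j + 1) \<in> V" 
    "vn b' 0 (j + 1) \<in> V"
    if "c \<in> set \<Gamma>" "j < width D u" for b' c j
    using that unfolding V_def set_vars by (cases "b' = b"; force)+
  have stv: "vn b' (2 * p + 2) 1 \<in> V" if "p \<in> set Qs" for b' p
    using that unfolding V_def set_vars by (cases "b' = b"; force)
  have e: "j + nat (1 - d) = (j + nat (1 - d) - 1) + 1" "j + nat (1 - d) - 1 < width D u"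
    if "0 < j" "j < width D u - 1" for j
    using that ext(5) by auto
  have "(\<lambda>(b, k, d). vn b k (j + d)) ` tvars (if j = 0 then first_tmpl b t else if j = width D u - 1 then edge_tmpl b else cell_tmpl b t)
      \<subseteq> V" if j: "j < width D u" for j
  proof -
    consider "j = 0" | "j = width D u - 1" "j \<noteq> 0" | "0 < j" "j < width D u - 1" using j by linarith
    then show ?thesis
    proof cases
      case 1
      then show ?thesis using var[OF qs(2) j] var(1)[OF _ j] stv qs
        by (auto simp: t edge_tmpl_def simp del: One_nat_def)
    next
      case 2
      then show ?thesis using var[OF qs(2) j] var(1)[OF _ j]
        by (auto simp: t edge_tmpl_def simp del: One_nat_def)
    next
      case 3
      then show ?thesis using var[OF qs(2) j] var(1)[OF _ j] var(2)[OF qs(2) e(2)[OF 3]] e(1)[OF 3]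
        by (auto simp: t simp del: One_nat_def)
    qed
  qed
  then show ?thesis
    unfolding V_def[symmetric] step_segs_def free_vars_row_std cell_sym_const by (intro UN_least) simp
qed

lemma free_vars_run: "free_vars (run_formula D u m b) \<subseteq> set (vars D u b)"
proof (induction m arbitrary: b)
  case (Suc m)
  have "free_vars (foldr Plus (map f ts) (Const z)) = (\<Union>t\<in>set ts. free_vars (f t))" for f :: "'r transition \<Rightarrow> nat wqbf" and ts z
    by (induction ts) auto
  then have "free_vars (step_formula D u b) \<subseteq> set (vars D u b) \<union> set (vars D u (\<not> b))"
    unfolding step_formula_def by (simp only:) (intro UN_least, use free_vars_step etrans(1) in simp)
  then show ?case using Suc[of "\<not> b"] by (auto simp: free_vars_SumQs)
qed simp

lemma sum_BF_machine_formula: "sum_BF (map_wqbf \<sigma> (machine_formula D u))"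
proof -
  have W: "0 < width D u" by (simp add: width_def)
  have "free_vars (row_formula D u head_segs) \<subseteq> set (vars D u False)"
    unfolding row_formula_def free_vars_prods row_head set_vars by (auto split: if_splits)
  moreover have "free_vars (row_formula D u init_segs) \<subseteq> set (vars D u False)"
    unfolding init_segs_def free_vars_row_std
  proof (intro UN_least)
    fix j assume j: "j \<in> {..<width D u}"
    have "\<exists>a. cell_sym (\<lambda>s. symbol_tmpl False (case s of Some a \<Rightarrow> a | None \<Rightarrow> placeholder M)) (symbol_tmpl False (blank M)) D u j
        = symbol_tmpl False a"
      by (cases "u ! (j - D - 1)") (auto simp: cell_sym_def)
    then obtain a where "cell_sym (\<lambda>s. symbol_tmpl False (case s of Some a \<Rightarrow> a | None \<Rightarrow> placeholder M)) (symbol_tmpl False (blank M)) D u j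
        = symbol_tmpl False a" ..
    then show "(\<lambda>(b, k, d). vn b k (j + d)) ` tvars (if j = 0 then TTimes (state_tmpl False (start_state M)) (symbol_tmpl False (blank M))
        else if j = width D u - 1 then symbol_tmpl False (blank M)
        else cell_sym (\<lambda>s. symbol_tmpl False (case s of Some a \<Rightarrow> a | None \<Rightarrow> placeholder M)) (symbol_tmpl False (blank M)) D u j)
      \<subseteq> set (vars D u False)"
      using j by (auto simp: set_vars width_def)
  qed
  ultimately show ?thesis
    using free_vars_run[of D u "2 * D" False]
    by (auto simp: sum_BF_def only_sum_map free_vars_map machine_formula_def free_vars_SumQs only_sum_SumQs only_sum_row only_sum_run)
qed

end


section \<open>A programming language with counters, compiled to Turing machines\<close>

text \<open>
  Programs have an input tape with a two-way head, counters and an output to which letters are appended. A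
  state consists of the position of the head, the counters and the output. A counter with
  the value \<open>0\<close> cannot be decremented.
\<close>

datatype test = NonZero nat | Sym "sletter set"

datatype com = SKIP | Emit sletter | Inc nat | Dec nat | Move int | Seq com com | While test com | If test com com

type_synonym cstate = "int \<times> (nat \<Rightarrow> nat) \<times> sletter list"

fun holds :: "(int \<Rightarrow> sletter) \<Rightarrow> test \<Rightarrow> cstate \<Rightarrow> bool" where
  "holds inp (NonZero i) (p, c, w) \<longleftrightarrow> c i \<noteq> 0"
| "holds inp (Sym X) (p, c, w) \<longleftrightarrow> inp p \<in> X"

text \<open>
  Big-step execution; the number is the time that the compiled program takes.
\<close>

inductive big :: "(int \<Rightarrow> sletter) \<Rightarrow> com \<Rightarrow> cstate \<Rightarrow> nat \<Rightarrow> cstate \<Rightarrow> bool" for inp where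
  big_SKIP: "big inp SKIP s 0 s"
| big_Emit: "big inp (Emit a) (p, c, w) 1 (p, c, w @ [a])"
| big_Inc: "big inp (Inc i) (p, c, w) 1 (p, c(i := Suc (c i)), w)"
| big_Dec: "c i = Suc n \<Longrightarrow> big inp (Dec i) (p, c, w) 1 (p, c(i := n), w)"
| big_Move: "d \<in> {-1, 1} \<Longrightarrow> big inp (Move d) (p, c, w) 1 (p + d, c, w)"
| big_Seq: "big inp a s t s' \<Longrightarrow> big inp b s' t' s'' \<Longrightarrow> big inp (Seq a b) s (t + t') s''"
| big_WhileF: "\<not> holds inp b s \<Longrightarrow> big inp (While b a) s 1 s"
| big_WhileT: "holds inp b s \<Longrightarrow> big inp a s t s' \<Longrightarrow> big inp (While b a) s' t' s'' \<Longrightarrow>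
    big inp (While b a) s (1 + t + 1 + t') s''"
| big_IfT: "holds inp b s \<Longrightarrow> big inp a s t s' \<Longrightarrow> big inp (If b a a') s (1 + t + 1) s'"
| big_IfF: "\<not> holds inp b s \<Longrightarrow> big inp a' s t s' \<Longrightarrow> big inp (If b a a') s (1 + t) s'"

text \<open>
  Programs are flattened to lists of instructions with relative jumps; the position in the list is the
  state of the Turing machine.
\<close>

datatype instr = IMark | IEmit sletter | IInc nat | IDec nat | IMove int | IBranch test nat | IJump int

fun code :: "com \<Rightarrow> instr list" where
  "code SKIP = []"
| "code (Emit a) = [IEmit a]"
| "code (Inc i) = [IInc i]"
| "code (Dec i) = [IDec i]"
| "code (Move d) = [IMove d]"
| "code (Seq a b) = code a @ code b"
| "code (While b a) = IBranch b (length (code a) + 1) # code a @ [IJump (- int (length (code a)) - 2)]"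
| "code (If b a a') = IBranch b (length (code a) + 1) # code a @ IJump (int (length (code a'))) # code a'"

fun counters :: "com \<Rightarrow> nat set" where
  "counters (Inc i) = {i}" | "counters (Dec i) = {i}"
| "counters (Seq a b) = counters a \<union> counters b"
| "counters (While b a) = (case b of NonZero i \<Rightarrow> {i} | _ \<Rightarrow> {}) \<union> counters a"
| "counters (If b a a') = (case b of NonZero i \<Rightarrow> {i} | _ \<Rightarrow> {}) \<union> counters a \<union> counters a'"
| "counters _ = {}"

fun symbols :: "com \<Rightarrow> sletter set" where
  "symbols (Emit a) = {a}"
| "symbols (Seq a b) = symbols a \<union> symbols b"
| "symbols (While b a) = symbols a"
| "symbols (If b a a') = symbols a \<union> symbols a'"
| "symbols _ = {}"

fun holds_letters :: "test \<Rightarrow> sletter list \<Rightarrow> bool" where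
  "holds_letters (NonZero i) as \<longleftrightarrow> as ! (i + 2) \<noteq> S_sym"
| "holds_letters (Sym X) as \<longleftrightarrow> as ! 0 \<in> X"

text \<open>
  The next state and the actions of the instruction at the position \<open>q\<close> when the letters \<open>as\<close> are read.
\<close>

fun act_of :: "instr \<Rightarrow> nat \<Rightarrow> sletter list \<Rightarrow> nat \<times> (sletter \<times> int) list" where
  "act_of IMark q as = (q + 1, map (\<lambda>a. (a, 0)) (take 2 as) @ map (\<lambda>a. (S_sym, 0)) (drop 2 as))"
| "act_of (IEmit a) q as = (q + 1, (map (\<lambda>a. (a, 0)) as)[1 := (a, 1)])"
| "act_of (IInc i) q as = (q + 1, (map (\<lambda>a. (a, 0)) as)[i + 2 := (as ! (i + 2), 1)])"
| "act_of (IDec i) q as = (q + 1, (map (\<lambda>a. (a, 0)) as)[i + 2 := (as ! (i + 2), -1)])"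
| "act_of (IMove d) q as = (q + 1, (map (\<lambda>a. (a, 0)) as)[0 := (as ! 0, d)])"
| "act_of (IBranch b n) q as = (if holds_letters b as then q + 1 else q + 1 + n, map (\<lambda>a. (a, 0)) as)"
| "act_of (IJump n) q as = (nat (int q + 1 + n), map (\<lambda>a. (a, 0)) as)"

text \<open>
  Tape \<open>0\<close> is the input and tape \<open>1\<close> the output. The counter \<open>i\<close> is the head position on tape \<open>i + 2\<close>, on
  which only cell \<open>0\<close> carries a mark; the first instruction puts these marks. The machine
  halts behind the last instruction. Actions outside the alphabet are excluded, as the type of
  commands does not bound the movements.
\<close>

definition compile :: "sletter \<Rightarrow> sletter set \<Rightarrow> nat \<Rightarrow> com \<Rightarrow> sletter tm" where
  "compile bl Al K c = (let P = IMark # code c in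
     \<lparr>tm_tapes = K + 2, tm_states = {..length P}, tm_alphabet = Al, tm_start = 0, tm_blank = bl,
      tm_action = \<lambda>q as. if q < length P \<and> fst (act_of (P ! q) q as) \<le> length P \<and>
            set (snd (act_of (P ! q) q as)) \<subseteq> Al \<times> {-1, 0, 1}
          then Some (act_of (P ! q) q as) else None\<rparr>)"

lemma length_act_of: "length (snd (act_of i q as)) = length as"
  by (cases i) auto

lemma tm_compile:
  assumes "finite Al" "bl \<in> Al"
  shows "tm (compile bl Al K c)"
proof -
  have "q' \<le> length (IMark # code c) \<and> length acts = length as \<and> set acts \<subseteq> Al \<times> {-1, 0, 1}"
    if "tm_action (compile bl Al K c) q as = Some (q', acts)" for q as q' acts
    using that length_act_of[of "(IMark # code c) ! q" q as]
    by (auto simp: compile_def Let_def split: if_splits)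
  moreover have "tm_states (compile bl Al K c) = {..length (IMark # code c)}"
    "tm_tapes (compile bl Al K c) = K + 2" "tm_alphabet (compile bl Al K c) = Al"
    "tm_start (compile bl Al K c) = 0" "tm_blank (compile bl Al K c) = bl"
    by (simp_all add: compile_def Let_def)
  ultimately show ?thesis
    using assms unfolding tm_def by (simp add: lists_eq_set)
qed

locale compiled =
  fixes bl :: sletter and Al :: "sletter set" and K :: nat and c :: com and xs :: "sletter list"
  assumes Al: "bl \<in> Al" "S_sym \<in> Al" "set xs \<subseteq> Al" "symbols c \<subseteq> Al" and bl: "bl \<noteq> S_sym"
    and K: "counters c \<subseteq> {..<K}"
begin

definition inp :: "int \<Rightarrow> sletter" where "inp = tape_of bl xs"

definition P :: "instr list" where "P = IMark # code c"

abbreviation M :: "sletter tm" where "M \<equiv> compile bl Al K c"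

definition mtape :: "int \<Rightarrow> sletter" where "mtape i = (if i = 0 then S_sym else bl)"

text \<open>
  The configuration of the Turing machine that corresponds to a state of the program.
\<close>

definition conf :: "nat \<Rightarrow> cstate \<Rightarrow> sletter tm_config" where
  "conf q s = (case s of (p, cn, w) \<Rightarrow>
     (q, (inp, p) # (tape_of bl w, int (length w)) # map (\<lambda>i. (mtape, int (cn i))) [0..<K]))"

definition letters :: "cstate \<Rightarrow> sletter list" where
  "letters s = (case s of (p, cn, w) \<Rightarrow> inp p # bl # map (\<lambda>i. mtape (int (cn i))) [0..<K])"

lemma inp_Al: "inp p \<in> Al"
  using Al nth_mem[of "nat p" xs] by (auto simp: inp_def tape_of_def nat_less_iff)

lemma letters_Al: "set (letters s) \<subseteq> Al"
  using inp_Al Al by (cases s) (auto simp: letters_def mtape_def)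

lemma tape_of_append: "(tape_of bl w)(int (length w) := a) = tape_of bl (w @ [a])"
  by (auto simp: fun_eq_iff tape_of_def nth_append nat_less_iff)

lemma tape_of_id: "(tape_of bl w)(int (length w) := bl) = tape_of bl w"
  by (auto simp: fun_eq_iff tape_of_def)

lemma length_letters: "length (letters s) = K + 2"
  by (cases s) (simp add: letters_def)

lemma step_conf:
  assumes "q < length P" "act_of (P ! q) q (letters s) = (q', acts)" "q' \<le> length P" "set acts \<subseteq> Al \<times> {-1, 0, 1}"
  shows "tm_step M (conf q s) = Some (q', map2 (\<lambda>(x, n) (a, d). (x(n := a), n + d)) (snd (conf q s)) acts)"
proof -
  have "map (\<lambda>(x, n). x n) (snd (conf q s)) = letters s"
    by (cases s) (simp add: conf_def letters_def tape_of_def o_def)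
  then show ?thesis
    using assms by (cases s) (auto simp: tm_step_def conf_def compile_def Let_def P_def)
qed

lemma id_acts: "set (map (\<lambda>a. (a, 0 :: int)) (letters s)) \<subseteq> Al \<times> {-1, 0, 1}"
  using letters_Al[of s] by auto

lemma update_acts: "a \<in> Al \<Longrightarrow> d \<in> {-1, 0, 1} \<Longrightarrow> set ((map (\<lambda>a. (a, 0 :: int)) (letters s))[k := (a, d)]) \<subseteq> Al \<times> {-1, 0, 1}"
  using set_update_subset_insert[of "map (\<lambda>a. (a, 0 :: int)) (letters s)" k "(a, d)"] id_acts[of s] by blast

lemma map2_id:
  "map2 (\<lambda>(x, n) (a, d). (x(n := a), n + d)) (snd (conf q s)) (map (\<lambda>a. (a, 0)) (letters s)) = snd (conf q' s)"
  by (cases s) (auto simp: conf_def letters_def tape_of_id map2_map_map)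

lemma map2_counter:
  "i < K \<Longrightarrow> map2 (\<lambda>(x, n) (a, d). (x(n := a), n + d)) (snd (conf q (p, cn, w)))
     ((map (\<lambda>a. (a, 0)) (letters (p, cn, w)))[i + 2 := (letters (p, cn, w) ! (i + 2), d)])
   = (inp, p) # (tape_of bl w, int (length w)) # map (\<lambda>j. (mtape, if j = i then int (cn j) + d else int (cn j))) [0..<K]"
  by (auto simp: conf_def letters_def tape_of_id intro!: nth_equalityI simp: nth_list_update)

lemma map2_emit:
  "map2 (\<lambda>(x, n) (a, d). (x(n := a), n + d)) (snd (conf q (p, cn, w))) ((map (\<lambda>a. (a, 0)) (letters (p, cn, w)))[1 := (a, 1)])
   = snd (conf q' (p, cn, w @ [a]))"
  by (auto simp: conf_def letters_def map2_map_map tape_of_append)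

lemma map2_move:
  "map2 (\<lambda>(x, n) (a, d). (x(n := a), n + d)) (snd (conf q (p, cn, w)))
     ((map (\<lambda>a. (a, 0)) (letters (p, cn, w)))[0 := (letters (p, cn, w) ! 0, d)])
   = snd (conf q' (p + d, cn, w))"
  by (auto simp: conf_def letters_def map2_map_map tape_of_id)

lemma step_to:
  assumes "q < length P" "act_of (P ! q) q (letters s) = (q', acts)" "q' \<le> length P" "set acts \<subseteq> Al \<times> {-1, 0, 1}"
    "map2 (\<lambda>(x, n) (a, d). (x(n := a), n + d)) (snd (conf q s)) acts = snd (conf q' s')"
  shows "(conf q s, conf q' s') \<in> {(c, c'). tm_step M c = Some c'} ^^ 1"
  using step_conf[OF assms(1-4)] assms(5) by (cases s') (simp add: conf_def)

abbreviation steps :: "nat \<Rightarrow> (sletter tm_config \<times> sletter tm_config) set" where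
  "steps t \<equiv> {(c, c'). tm_step M c = Some c'} ^^ t"

lemma steps_trans: "(x, y) \<in> steps m \<Longrightarrow> (y, z) \<in> steps n \<Longrightarrow> (x, z) \<in> steps (m + n)"
  by (auto simp: relpow_add)

lemma exec_instr:
  assumes "P = pre @ i # post"
  shows "i = IEmit a \<Longrightarrow> a \<in> Al \<Longrightarrow> (conf (length pre) (p, cn, w), conf (length pre + 1) (p, cn, w @ [a])) \<in> steps 1"
    and "i = IInc k \<Longrightarrow> k < K \<Longrightarrow> (conf (length pre) (p, cn, w), conf (length pre + 1) (p, cn(k := Suc (cn k)), w)) \<in> steps 1"
    and "i = IDec k \<Longrightarrow> k < K \<Longrightarrow> cn k = Suc n \<Longrightarrow> (conf (length pre) (p, cn, w), conf (length pre + 1) (p, cn(k := n), w)) \<in> steps 1"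
    and "i = IMove d \<Longrightarrow> d \<in> {-1, 1} \<Longrightarrow> (conf (length pre) (p, cn, w), conf (length pre + 1) (p + d, cn, w)) \<in> steps 1"
    and "i = IBranch b m \<Longrightarrow> (case b of NonZero k \<Rightarrow> k < K | _ \<Rightarrow> True) \<Longrightarrow> holds inp b s \<Longrightarrow> (conf (length pre) s, conf (length pre + 1) s) \<in> steps 1"
    and "i = IBranch b m \<Longrightarrow> (case b of NonZero k \<Rightarrow> k < K | _ \<Rightarrow> True) \<Longrightarrow> \<not> holds inp b s \<Longrightarrow> m \<le> length post \<Longrightarrow>
          (conf (length pre) s, conf (length pre + 1 + m) s) \<in> steps 1"
    and "i = IJump j \<Longrightarrow> int (length pre) + 1 + j = int q \<Longrightarrow> q \<le> length P \<Longrightarrow> (conf (length pre) s, conf q s) \<in> steps 1"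
proof -
  have q: "length pre < length P" "P ! length pre = i" using assms by auto
  have mem: "k < K \<Longrightarrow> letters s ! (k + 2) \<in> Al" "letters s ! 0 \<in> Al" for k s
    using letters_Al[of s] nth_mem[of _ "letters s"] length_letters[of s] by (auto simp: subset_iff)
  { assume i: "i = IEmit a" "a \<in> Al"
    show "(conf (length pre) (p, cn, w), conf (length pre + 1) (p, cn, w @ [a])) \<in> steps 1"
      by (rule step_to[OF q(1) _ _ update_acts map2_emit]) (use q i in auto) }
  { assume i: "i = IInc k" "k < K"
    have "(mtape, if j = k then int (cn j) + 1 else int (cn j)) = (mtape, int ((cn(k := Suc (cn k))) j))" for j by simp
    then show "(conf (length pre) (p, cn, w), conf (length pre + 1) (p, cn(k := Suc (cn k)), w)) \<in> steps 1"
      by (intro step_to[OF q(1) _ _ update_acts[OF mem(1)[OF i(2)]]])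
         (use q i map2_counter[OF i(2), of _ p cn w 1] in \<open>auto simp: conf_def simp del: fun_upd_apply\<close>) }
  { assume i: "i = IDec k" "k < K" "cn k = Suc n"
    have "(mtape, if j = k then int (cn j) + -1 else int (cn j)) = (mtape, int ((cn(k := n)) j))" for j using i by simp
    then show "(conf (length pre) (p, cn, w), conf (length pre + 1) (p, cn(k := n), w)) \<in> steps 1"
      by (intro step_to[OF q(1) _ _ update_acts[OF mem(1)[OF i(2)]]])
         (use q i map2_counter[OF i(2), of _ p cn w "-1"] in \<open>auto simp: conf_def simp del: fun_upd_apply\<close>) }
  { assume i: "i = IMove d" "d \<in> {-1, 1}"
    show "(conf (length pre) (p, cn, w), conf (length pre + 1) (p + d, cn, w)) \<in> steps 1"
      by (rule step_to[OF q(1) _ _ update_acts[OF mem(2)] map2_move]) (use q i in auto) }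
  have hl: "holds_letters b (letters s) = holds inp b s" if "case b of NonZero k \<Rightarrow> k < K | _ \<Rightarrow> True"
    using that bl by (cases "(inp, b, s)" rule: holds.cases) (auto simp: letters_def mtape_def)
  { assume i: "i = IBranch b m" "case b of NonZero k \<Rightarrow> k < K | _ \<Rightarrow> True" "holds inp b s"
    show "(conf (length pre) s, conf (length pre + 1) s) \<in> steps 1"
      by (rule step_to[OF q(1) _ _ id_acts map2_id]) (use q i(1,3) hl[OF i(2)] in auto) }
  { assume i: "i = IBranch b m" "case b of NonZero k \<Rightarrow> k < K | _ \<Rightarrow> True" "\<not> holds inp b s" "m \<le> length post"
    show "(conf (length pre) s, conf (length pre + 1 + m) s) \<in> steps 1"
      by (rule step_to[OF q(1) _ _ id_acts map2_id]) (use q i(1,3,4) hl[OF i(2)] assms in auto) }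
  { assume i: "i = IJump j" "int (length pre) + 1 + j = int q" "q \<le> length P"
    show "(conf (length pre) s, conf q s) \<in> steps 1"
      by (rule step_to[OF q(1) _ _ id_acts map2_id]) (use q i in auto) }
qed

lemma exec_com:
  "big inp a s t s' \<Longrightarrow> counters a \<subseteq> {..<K} \<Longrightarrow> symbols a \<subseteq> Al \<Longrightarrow> P = pre @ code a @ post \<Longrightarrow>
   (conf (length pre) s, conf (length pre + length (code a)) s') \<in> steps t"
proof (induction arbitrary: pre post rule: big.induct)
  case (big_SKIP s)
  then show ?case by simp
next
  case (big_Emit a p c w)
  then show ?case using exec_instr(1)[of pre "IEmit a" post a p c w] by simp
next
  case (big_Inc i p c w)
  then show ?case using exec_instr(2)[of pre "IInc i" post i p c w] by simp
next
  case (big_Dec c i n p w)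
  then show ?case using exec_instr(3)[of pre "IDec i" post i c n p w] by simp
next
  case (big_Move d p c w)
  then show ?case using exec_instr(4)[of pre "IMove d" post d p c w] by simp
next
  case (big_Seq a s t s' b t' s'')
  from big_Seq.IH(1)[of pre "code b @ post"] big_Seq.prems
  have 1: "(conf (length pre) s, conf (length pre + length (code a)) s') \<in> steps t" by simp
  from big_Seq.IH(2)[of "pre @ code a" post] big_Seq.prems
  have 2: "(conf (length pre + length (code a)) s', conf (length pre + (length (code a) + length (code b))) s'') \<in> steps t'"
    by (simp add: add.assoc)
  from steps_trans[OF 1 2] show ?case by simp
next
  case (big_WhileF b s a)
  from exec_instr(6)[of pre _ "code a @ IJump (- int (length (code a)) - 2) # post" b "length (code a) + 1" s] big_WhileF
  show ?case by (auto split: test.splits)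
next
  case (big_WhileT b s a t s' t' s'')
  let ?pre = "pre @ [IBranch b (length (code a) + 1)]"
  have 1: "(conf (length pre) s, conf (length pre + 1) s) \<in> steps 1"
    using exec_instr(5)[of pre _ "code a @ IJump (- int (length (code a)) - 2) # post" b "length (code a) + 1" s] big_WhileT
    by (auto split: test.splits)
  have 2: "(conf (length pre + 1) s, conf (length pre + 1 + length (code a)) s') \<in> steps t"
    using big_WhileT.IH(1)[of ?pre "IJump (- int (length (code a)) - 2) # post"] big_WhileT.prems by simp
  have 3: "(conf (length pre + 1 + length (code a)) s', conf (length pre) s') \<in> steps 1"
    using exec_instr(7)[of "?pre @ code a" _ post "- int (length (code a)) - 2" "length pre" s'] big_WhileT.prems by simp
  have 4: "(conf (length pre) s', conf (length pre + length (code (While b a))) s'') \<in> steps t'"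
    using big_WhileT.IH(2)[of pre post] big_WhileT.prems by simp
  from steps_trans[OF steps_trans[OF steps_trans[OF 1 2] 3] 4] show ?case .
next
  case (big_IfT b s a t s' a')
  let ?pre = "pre @ [IBranch b (length (code a) + 1)]"
  have 1: "(conf (length pre) s, conf (length pre + 1) s) \<in> steps 1"
    using exec_instr(5)[of pre _ "code a @ IJump (int (length (code a'))) # code a' @ post" b "length (code a) + 1" s] big_IfT
    by (auto split: test.splits)
  have 2: "(conf (length pre + 1) s, conf (length pre + 1 + length (code a)) s') \<in> steps t"
    using big_IfT.IH[of ?pre "IJump (int (length (code a'))) # code a' @ post"] big_IfT.prems by simp
  have 3: "(conf (length pre + 1 + length (code a)) s', conf (length pre + length (code (com.If b a a'))) s') \<in> steps 1"
    using exec_instr(7)[of "?pre @ code a" _ "code a' @ post" "int (length (code a'))" "length pre + length (code (com.If b a a'))" s'] big_IfT.prems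
    by simp
  from steps_trans[OF steps_trans[OF 1 2] 3] show ?case .
next
  case (big_IfF b s a' t s' a)
  let ?pre = "pre @ IBranch b (length (code a) + 1) # code a @ [IJump (int (length (code a')))]"
  have 1: "(conf (length pre) s, conf (length pre + 1 + (length (code a) + 1)) s) \<in> steps 1"
    using exec_instr(6)[of pre _ "code a @ IJump (int (length (code a'))) # code a' @ post" b "length (code a) + 1" s] big_IfF
    by (auto split: test.splits)
  have 2: "(conf (length pre + 1 + (length (code a) + 1)) s, conf (length pre + length (code (com.If b a a'))) s') \<in> steps t"
    using big_IfF.IH[of ?pre post] big_IfF.prems by (simp add: add.assoc)
  from steps_trans[OF 1 2] show ?case .
qed

lemma initial_step: "(tm_initial M xs, conf 1 (0, (\<lambda>_. 0), [])) \<in> steps 1"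
proof -
  have blank: "tape_of bl [] = (\<lambda>_. bl)" by (auto simp: tape_of_def fun_eq_iff)
  have reads: "map (\<lambda>(x, n). x n) (snd (tm_initial M xs)) = inp 0 # bl # replicate K bl"
    by (simp add: tm_initial_def compile_def Let_def inp_def blank map_replicate)
  have upd: "(\<lambda>_. bl)(0 := S_sym) = mtape" by (auto simp: mtape_def)
  have inp0: "inp(0 := inp 0) = inp" by simp
  have al: "inp 0 \<in> Al" by (rule inp_Al)
  have "tm_step M (tm_initial M xs) = Some (conf 1 (0, (\<lambda>_. 0), []))"
    using Al(1,2) al
    by (auto simp: tm_step_def tm_initial_def compile_def Let_def conf_def inp_def[symmetric] blank map_replicate upd
         zip_replicate map_replicate_const mtape_def[abs_def] fun_eq_iff)
  then show ?thesis by simp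
qed

lemma compiled_computes:
  assumes "big inp c (0, (\<lambda>_. 0), []) t (p, cn, w)"
  shows "tm_computes_within M (t + 1) xs w"
proof -
  have "(conf 1 (0, (\<lambda>_. 0), []), conf (length P) (p, cn, w)) \<in> steps t"
    using exec_com[OF assms K Al(4), of "[IMark]" "[]"] by (simp add: P_def)
  from steps_trans[OF initial_step this]
  have "(tm_initial M xs, conf (length P) (p, cn, w)) \<in> steps (1 + t)" .
  moreover have "tm_step M (conf (length P) (p, cn, w)) = None"
    by (simp add: tm_step_def compile_def Let_def conf_def P_def)
  moreover have "tm_blank M = bl" by (simp add: compile_def Let_def)
  moreover obtain ts where "conf (length P) (p, cn, w) = (length P, ts)" "fst (ts ! 1) = tape_of bl w"
    by (simp add: conf_def)
  ultimately have "(tm_initial M xs, (length P, ts)) \<in> steps (1 + t) \<and> tm_step M (length P, ts) = None \<and>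
      fst (ts ! 1) = tape_of (tm_blank M) w" by simp
  then show ?thesis
    unfolding tm_computes_within_def
    by - (rule exI[of _ "1 + t"], rule conjI, simp, rule exI[of _ "length P"], rule exI[of _ ts])
qed

end


section \<open>Running times, loops, and words as strings\<close>

text \<open>
  Execution with an upper bound of the time.
\<close>

definition runs :: "(int \<Rightarrow> sletter) \<Rightarrow> com \<Rightarrow> cstate \<Rightarrow> cstate \<Rightarrow> nat \<Rightarrow> bool" where
  "runs inp c s s' T \<longleftrightarrow> (\<exists>t\<le>T. big inp c s t s')"

lemma runs_mono: "runs inp c s s' T \<Longrightarrow> T \<le> U \<Longrightarrow> runs inp c s s' U"
  unfolding runs_def by (meson le_trans)

lemma runs_SKIP: "runs inp SKIP s s T"
  unfolding runs_def using big_SKIP by blast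

lemma runs_Emit: "runs inp (Emit a) (p, c, w) (p, c, w @ [a]) 1"
  unfolding runs_def using big_Emit by blast

lemma runs_Inc: "runs inp (Inc i) (p, c, w) (p, c(i := Suc (c i)), w) 1"
  unfolding runs_def using big_Inc by blast

lemma runs_Dec: "c i = Suc n \<Longrightarrow> runs inp (Dec i) (p, c, w) (p, c(i := n), w) 1"
  unfolding runs_def using big_Dec by blast

lemma runs_Move: "d \<in> {-1, 1} \<Longrightarrow> runs inp (Move d) (p, c, w) (p + d, c, w) 1"
  unfolding runs_def using big_Move by blast

lemma runs_Seq: "runs inp a s s' T \<Longrightarrow> runs inp b s' s'' U \<Longrightarrow> runs inp (Seq a b) s s'' (T + U)"
  unfolding runs_def by (meson add_mono big_Seq)

lemma runs_WhileF: "\<not> holds inp b s \<Longrightarrow> runs inp (While b a) s s 1"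
  unfolding runs_def using big_WhileF by blast

lemma runs_WhileT:
  assumes "holds inp b s" "runs inp a s s' T" "runs inp (While b a) s' s'' U"
  shows "runs inp (While b a) s s'' (T + U + 2)"
proof -
  obtain t u where "t \<le> T" "big inp a s t s'" "u \<le> U" "big inp (While b a) s' u s''"
    using assms(2,3) unfolding runs_def by blast
  with big_WhileT[OF assms(1), of a t s' u s''] have "big inp (While b a) s (1 + t + 1 + u) s''" "1 + t + 1 + u \<le> T + U + 2"
    by simp_all
  then show ?thesis unfolding runs_def by blast
qed

lemma runs_IfT:
  assumes "holds inp b s" "runs inp a s s' T"
  shows "runs inp (com.If b a a') s s' (T + 2)"
proof -
  obtain t where "t \<le> T" "big inp a s t s'"
    using assms(2) unfolding runs_def by blast
  with big_IfT[OF assms(1), of a t s' a'] have "big inp (com.If b a a') s (1 + t + 1) s'" "1 + t + 1 \<le> T + 2"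
    by simp_all
  then show ?thesis unfolding runs_def by blast
qed

lemma runs_IfF:
  assumes "\<not> holds inp b s" "runs inp a' s s' T"
  shows "runs inp (com.If b a a') s s' (T + 2)"
proof -
  obtain t where "t \<le> T" "big inp a' s t s'"
    using assms(2) unfolding runs_def by blast
  with big_IfF[OF assms(1), of a' t s' a] have "big inp (com.If b a a') s (1 + t) s'" "1 + t \<le> T + 2"
    by simp_all
  then show ?thesis unfolding runs_def by blast
qed

lemma runs_While:
  assumes "\<And>i. i < n \<Longrightarrow> holds inp b (S i)" "\<And>i. i < n \<Longrightarrow> runs inp a (S i) (S (Suc i)) T" "\<not> holds inp b (S n)"
  shows "runs inp (While b a) (S 0) (S n) (n * (T + 2) + 1)"
  using assms
proof (induction n arbitrary: S)
  case 0
  then show ?case by (simp add: runs_WhileF[unfolded One_nat_def])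
next
  case (Suc n)
  have "runs inp (While b a) (S (Suc 0)) (S (Suc n)) (n * (T + 2) + 1)"
    using Suc.IH[of "\<lambda>i. S (Suc i)"] Suc.prems by simp
  from runs_WhileT[OF Suc.prems(1) Suc.prems(2) this] show ?case
    by (simp add: algebra_simps)
qed

text \<open>
  Executes the body as often as the counter \<open>i\<close> says. The counter is moved to \<open>k\<close> and back meanwhile, so it
  is preserved in the end.
\<close>

definition For :: "nat \<Rightarrow> nat \<Rightarrow> com \<Rightarrow> com" where
  "For i k body = Seq (While (NonZero i) (Seq (Dec i) (Inc k)))
                      (While (NonZero k) (Seq (Dec k) (Seq (Inc i) body)))"

lemma runs_For:
  assumes "i \<noteq> k"
    and body: "\<And>m x y. m < n \<Longrightarrow> runs inp body (p, (f m)(i := x, k := y), w m) (p, (f (Suc m))(i := x, k := y), w (Suc m)) T"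
  shows "runs inp (For i k body) (p, (f 0)(i := n, k := 0), w 0) (p, (f n)(i := n, k := 0), w n) (n * (T + 8) + 2)"
proof -
  have 1: "runs inp (While (NonZero i) (Seq (Dec i) (Inc k))) (p, (f 0)(i := n - 0, k := 0), w 0)
      (p, (f 0)(i := n - n, k := n), w 0) (n * (2 + 2) + 1)"
  proof (rule runs_While[where S = "\<lambda>m. (p, (f 0)(i := n - m, k := m), w 0)"])
    fix m assume m: "m < n"
    show "holds inp (NonZero i) (p, (f 0)(i := n - m, k := m), w 0)" using m assms(1) by simp
    have "runs inp (Dec i) (p, (f 0)(i := n - m, k := m), w 0) (p, ((f 0)(i := n - m, k := m))(i := n - Suc m), w 0) 1"
      by (rule runs_Dec) (use m assms(1) in simp)
    from runs_Seq[OF this runs_Inc[of inp k]]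
    show "runs inp (Seq (Dec i) (Inc k)) (p, (f 0)(i := n - m, k := m), w 0) (p, (f 0)(i := n - Suc m, k := Suc m), w 0) 2"
      using assms(1) by (simp add: fun_upd_twist numeral_2_eq_2)
  qed (use assms(1) in simp)
  have 2: "runs inp (While (NonZero k) (Seq (Dec k) (Seq (Inc i) body))) (p, (f 0)(i := 0, k := n - 0), w 0)
      (p, (f n)(i := n, k := n - n), w n) (n * (T + 2 + 2) + 1)"
  proof (rule runs_While[where S = "\<lambda>m. (p, (f m)(i := m, k := n - m), w m)"])
    fix m assume m: "m < n"
    show "holds inp (NonZero k) (p, (f m)(i := m, k := n - m), w m)" using m by simp
    have "runs inp (Dec k) (p, (f m)(i := m, k := n - m), w m) (p, ((f m)(i := m, k := n - m))(k := n - Suc m), w m) 1"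
      by (rule runs_Dec) (use m in simp)
    also have "((f m)(i := m, k := n - m))(k := n - Suc m) = (f m)(i := m, k := n - Suc m)" by simp
    finally have d: "runs inp (Dec k) (p, (f m)(i := m, k := n - m), w m) (p, (f m)(i := m, k := n - Suc m), w m) 1" .
    have "runs inp (Inc i) (p, (f m)(i := m, k := n - Suc m), w m) (p, (f m)(i := Suc m, k := n - Suc m), w m) 1"
      using runs_Inc[of inp i p "(f m)(i := m, k := n - Suc m)" "w m"] assms(1) by (simp add: fun_upd_twist)
    from runs_Seq[OF d runs_Seq[OF this body[OF m]]]
    show "runs inp (Seq (Dec k) (Seq (Inc i) body)) (p, (f m)(i := m, k := n - m), w m)
      (p, (f (Suc m))(i := Suc m, k := n - Suc m), w (Suc m)) (T + 2)"
      by (rule runs_mono) simp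
  qed simp
  have "runs inp (For i k body) (p, (f 0)(i := n, k := 0), w 0) (p, (f n)(i := n, k := 0), w n)
      ((n * (2 + 2) + 1) + (n * (T + 2 + 2) + 1))"
    unfolding For_def using runs_Seq[OF 1[simplified] 2[simplified]] by simp
  then show ?thesis by (rule runs_mono) (simp add: algebra_simps)
qed

lemma runs_For_emit:
  assumes "i \<noteq> k" "cn i = n" "cn k = 0"
    and body: "\<And>x y w. runs inp body (p, cn(i := x, k := y), w) (p, cn(i := x, k := y), w @ v) T"
  shows "runs inp (For i k body) (p, cn, w) (p, cn, w @ concat (replicate n v)) (n * (T + 8) + 2)"
proof -
  have "cn(i := n, k := 0) = cn" using assms(2,3) by auto
  moreover have "w @ concat (replicate m v) @ v = w @ concat (replicate (Suc m) v)" for m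
    by (induction m) simp_all
  ultimately show ?thesis
    using runs_For[of i k n inp body p "\<lambda>_. cn" "\<lambda>m. w @ concat (replicate m v)" T] assms(1) body
    by (metis append.assoc append_Nil2 concat.simps(1) replicate_0)
qed

text \<open>
  The string of a cell is a list of items: fixed letters, the index of the cell in unary, and the string
  of the value in the cell.
\<close>

datatype item = Ch sletter | Index | Wt

fun item_str :: "nat \<Rightarrow> sletter list \<Rightarrow> item \<Rightarrow> sletter list" where
  "item_str j v (Ch a) = [a]"
| "item_str j v Index = replicate j (Letter (letter Bit1))"
| "item_str j v Wt = v"

definition istr :: "nat \<Rightarrow> sletter list \<Rightarrow> item list \<Rightarrow> sletter list" where
  "istr j v is = concat (map (item_str j v) is)"

lemma istr_simps [simp]:
  "istr j v [] = []" "istr j v (x # xs) = item_str j v x @ istr j v xs" "istr j v (xs @ ys) = istr j v xs @ istr j v ys"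
  by (simp_all add: istr_def)

fun item_com :: "com \<Rightarrow> item \<Rightarrow> com" where
  "item_com wc (Ch a) = Emit a"
| "item_com wc Index = For 0 1 (Emit (Letter (letter Bit1)))"
| "item_com wc Wt = wc"

definition items_com :: "com \<Rightarrow> item list \<Rightarrow> com" where
  "items_com wc is = foldr (\<lambda>i. Seq (item_com wc i)) is SKIP"

lemma runs_items:
  assumes "cn 1 = 0" "cn 0 \<le> B" "\<And>w. runs inp wc (p, cn, w) (p, cn, w @ v) T"
  shows "runs inp (items_com wc is) (p, cn, w) (p, cn, w @ istr (cn 0) v is) (length is * (T + 9 * B + 3))"
proof (induction "is" arbitrary: w)
  case Nil
  then show ?case by (simp add: items_com_def runs_SKIP)
next
  case (Cons i xs)
  have "runs inp (item_com wc i) (p, cn, w) (p, cn, w @ item_str (cn 0) v i) (T + 9 * B + 3)"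
  proof (cases i)
    case (Ch a)
    show ?thesis unfolding Ch item_com.simps item_str.simps by (rule runs_mono[OF runs_Emit]) simp
  next
    case Index
    have "runs inp (For 0 1 (Emit (Letter (letter Bit1)))) (p, cn, w)
        (p, cn, w @ concat (replicate (cn 0) [Letter (letter Bit1)])) (cn 0 * (1 + 8) + 2)"
      by (rule runs_For_emit) (use assms(1) runs_Emit in auto)
    moreover have "concat (replicate n [a]) = replicate n a" for n and a :: sletter by (induction n) simp_all
    ultimately have "runs inp (item_com wc Index) (p, cn, w) (p, cn, w @ item_str (cn 0) v Index) (cn 0 * (1 + 8) + 2)"
      by (simp only: item_com.simps item_str.simps)
    then show ?thesis unfolding Index by (rule runs_mono) (use assms(2) in simp)
  next
    case Wt
    show ?thesis unfolding Wt item_com.simps item_str.simps by (rule runs_mono[OF assms(3)]) simp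
  qed
  from runs_Seq[OF this Cons.IH] show ?case by (simp add: items_com_def)
qed

definition emit_all :: "sletter list \<Rightarrow> com" where
  "emit_all xs = foldr (\<lambda>a. Seq (Emit a)) xs SKIP"

lemma runs_emit_all: "runs inp (emit_all xs) (p, cn, w) (p, cn, w @ xs) (length xs)"
proof (induction xs arbitrary: w)
  case Nil
  then show ?case by (simp add: emit_all_def runs_SKIP)
next
  case (Cons a xs)
  from runs_Seq[OF runs_Emit Cons.IH] show ?case by (simp add: emit_all_def)
qed

text \<open>
  Words over letters and indices of semiring values as strings: the index \<open>k\<close> becomes a block of
  \<open>k\<close> letters between delimiters.
\<close>

definition block :: "nat \<Rightarrow> sletter list" where
  "block k = S_sym # replicate k V_sym @ [E_sym]"

text \<open>
  Copies the block that begins under the head to the output, and returns to its beginning.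
\<close>

definition copy_block :: com where
  "copy_block = Seq (Emit S_sym) (Seq (Move 1) (Seq (While (Sym {V_sym}) (Seq (Emit V_sym) (Move 1)))
     (Seq (Emit E_sym) (Seq (Move (-1)) (While (Sym {V_sym}) (Move (-1)))))))"

lemma runs_copy_block:
  assumes "\<And>i. i < k \<Longrightarrow> inp (p + 1 + int i) = V_sym" "inp (p + 1 + int k) = E_sym" "inp p = S_sym"
  shows "runs inp copy_block (p, cn, w) (p, cn, w @ block k) (7 * k + 6)"
proof -
  have 1: "runs inp (While (Sym {V_sym}) (Seq (Emit V_sym) (Move 1))) (p + 1 + int 0, cn, (w @ [S_sym]) @ replicate 0 V_sym)
      (p + 1 + int k, cn, (w @ [S_sym]) @ replicate k V_sym) (k * (2 + 2) + 1)"
  proof (rule runs_While[where S = "\<lambda>i. (p + 1 + int i, cn, (w @ [S_sym]) @ replicate i V_sym)"])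
    fix i
    show "runs inp (Seq (Emit V_sym) (Move 1)) (p + 1 + int i, cn, (w @ [S_sym]) @ replicate i V_sym)
      (p + 1 + int (Suc i), cn, (w @ [S_sym]) @ replicate (Suc i) V_sym) 2"
      using runs_Seq[OF runs_Emit[of inp V_sym "p + 1 + int i" cn "(w @ [S_sym]) @ replicate i V_sym"] runs_Move[of 1]]
      by (simp add: numeral_2_eq_2 algebra_simps replicate_append_same)
  qed (use assms in auto)
  have 2: "runs inp (While (Sym {V_sym}) (Move (-1))) (p + int (k - 0), cn, w') (p + int (k - k), cn, w') (k * (1 + 2) + 1)" for w'
  proof (rule runs_While[where S = "\<lambda>i. (p + int (k - i), cn, w')"])
    fix i assume i: "i < k"
    have "p + int (k - i) = p + 1 + int (k - i - 1)" using i by simp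
    then show "holds inp (Sym {V_sym}) (p + int (k - i), cn, w')" using assms(1)[of "k - i - 1"] i by simp
    show "runs inp (Move (- 1)) (p + int (k - i), cn, w') (p + int (k - Suc i), cn, w') 1"
      using runs_Move[of "-1" inp "p + int (k - i)" cn w'] i by (simp add: algebra_simps of_nat_diff)
  qed (use assms in auto)
  have m: "runs inp (Move (-1)) (p + 1 + int k, cn, w') (p + int (k - 0), cn, w') 1" for w'
    using runs_Move[of "-1" inp "p + 1 + int k" cn w'] by (simp add: algebra_simps)
  have m1: "runs inp (Move 1) (p, cn, w') (p + 1 + int 0, cn, w' @ replicate 0 V_sym) 1" for w'
    using runs_Move[of 1 inp p cn w'] by simp
  note r = runs_Seq[OF runs_Emit runs_Seq[OF m1 runs_Seq[OF 1 runs_Seq[OF runs_Emit[of inp E_sym] runs_Seq[OF m 2]]]]]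
  show ?thesis using runs_mono[OF r, of "7 * k + 6"] unfolding copy_block_def block_def by simp
qed

fun tok_str :: "nat + nat \<Rightarrow> sletter list" where
  "tok_str (Inl a) = [Letter a]" | "tok_str (Inr k) = block k"

definition flat :: "(nat + nat) list \<Rightarrow> sletter list" where
  "flat u = concat (map tok_str u)"

lemma flat_simps [simp]: "flat [] = []" "flat (x # u) = tok_str x @ flat u" "flat (u @ v) = flat u @ flat v"
  by (simp_all add: flat_def)


section \<open>Programs that emit a row of cells\<close>

lemma tape_of_mid: "tape_of b (xs @ a # ys) (int (length xs)) = a"
  by (simp add: tape_of_def)

text \<open>
  The head returns from the end of the input to its beginning.
\<close>

lemma runs_rewind:
  assumes "\<And>i. 0 \<le> i \<Longrightarrow> i < int n \<Longrightarrow> inp i \<noteq> b" "inp (-1) = b"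
  shows "runs inp (Seq (Move (-1)) (Seq (While (Sym (- {b})) (Move (-1))) (Move 1))) (int n, cn, w) (0, cn, w) (3 * n + 3)"
proof -
  have 1: "runs inp (Move (-1)) (int n, cn, w) (int (n - 0) - 1, cn, w) 1"
    using runs_Move[of "-1" inp "int n" cn w] by simp
  have 2: "runs inp (While (Sym (- {b})) (Move (-1))) (int (n - 0) - 1, cn, w) (int (n - n) - 1, cn, w) (n * (1 + 2) + 1)"
  proof (rule runs_While[where S = "\<lambda>i. (int (n - i) - 1, cn, w)"])
    fix i assume i: "i < n"
    then show "holds inp (Sym (- {b})) (int (n - i) - 1, cn, w)" using assms(1)[of "int (n - i) - 1"] by auto
    show "runs inp (Move (- 1)) (int (n - i) - 1, cn, w) (int (n - Suc i) - 1, cn, w) 1"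
      using runs_Move[of "-1" inp "int (n - i) - 1" cn w] i by (simp add: algebra_simps of_nat_diff)
  qed (use assms in auto)
  have 3: "runs inp (Move 1) (int (n - n) - 1, cn, w) (0, cn, w) 1"
    using runs_Move[of 1 inp "-1" cn w] by simp
  from runs_Seq[OF 1 runs_Seq[OF 2 3]] show ?thesis by (rule runs_mono) simp
qed

definition seg_str :: "nat \<Rightarrow> nat \<Rightarrow> (nat + nat) list \<Rightarrow> nat \<Rightarrow> item list seg \<Rightarrow> sletter list" where
  "seg_str z D u j seg = concat (map (\<lambda>(i, is, k). istr i (block k) is) (List.enumerate j (seg_cells z D u seg)))"

definition row_str :: "nat \<Rightarrow> nat \<Rightarrow> (nat + nat) list \<Rightarrow> item list seg list \<Rightarrow> sletter list" where
  "row_str z D u segs = concat (row z D u (\<lambda>j k is. istr j (block k) is) segs)"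

text \<open>
  Programs over input words with letters from \<open>\<Sigma>s\<close>. The counter \<open>0\<close> is the number of the current cell, and
  the counter \<open>2\<close> is \<open>D\<close>. The counter \<open>1\<close> serves for loops over the counter \<open>0\<close>, and \<open>3\<close> for loops over
  the counter \<open>2\<close>.
\<close>

locale emission =
  fixes \<Sigma>s :: "nat list" and bl :: sletter and z :: nat
  assumes bl: "bl \<notin> Letter ` set \<Sigma>s" "bl \<notin> {S_sym, V_sym, E_sym}"
begin

text \<open>
  The tape of the input \<open>u\<close>, with blank \<open>bl\<close>.
\<close>

definition input :: "(nat + nat) list \<Rightarrow> int \<Rightarrow> sletter" where
  "input u = tape_of bl (flat u)"

abbreviation const_com :: com where "const_com \<equiv> emit_all (block z)"

text \<open>
  Emits the cell of the input symbol that begins under the head, and does nothing inside a block.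
\<close>

definition token_com :: "(nat option \<Rightarrow> item list) \<Rightarrow> com" where
  "token_com g = foldr (\<lambda>a c. com.If (Sym {Letter a}) (Seq (items_com const_com (g (Some a))) (Inc 0)) c) \<Sigma>s
     (com.If (Sym {S_sym}) (Seq (items_com copy_block (g None)) (Inc 0)) SKIP)"

fun seg_com :: "item list seg \<Rightarrow> com" where
  "seg_com (One is) = Seq (items_com const_com is) (Inc 0)"
| "seg_com (Loop is) = For 2 3 (Seq (items_com const_com is) (Inc 0))"
| "seg_com (Input g) = Seq (While (Sym (- {bl})) (Seq (token_com g) (Move 1)))
      (Seq (Move (-1)) (Seq (While (Sym (- {bl})) (Move (-1))) (Move 1)))"

text \<open>
  The counter of the cells is cleared after each row.
\<close>

definition row_com :: "item list seg list \<Rightarrow> com" where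
  "row_com segs = Seq (foldr (\<lambda>s. Seq (seg_com s)) segs SKIP) (While (NonZero 0) (Dec 0))"

lemma runs_const: "runs inp const_com (p, cn, w) (p, cn, w @ block z) (z + 2)"
  by (rule runs_mono[OF runs_emit_all]) (simp add: block_def)

lemma runs_const_cell:
  assumes "cn 1 = 0" "cn 0 \<le> B"
  shows "runs inp (Seq (items_com const_com is) (Inc 0)) (p, cn, w) (p, cn(0 := Suc (cn 0)), w @ istr (cn 0) (block z) is)
     (length is * (z + 2 + 9 * B + 3) + 1)"
  using runs_Seq[OF runs_items[OF assms runs_const] runs_Inc] .

lemma runs_Loop:
  assumes "cn 1 = 0" "cn 2 = D" "cn 3 = 0" "cn 0 + D \<le> B"
  shows "runs inp (seg_com (Loop is)) (p, cn, w) (p, cn(0 := cn 0 + D), w @ seg_str z D u (cn 0) (Loop is))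
     (D * (length is * (z + 2 + 9 * B + 3) + 1 + 8) + 2)"
proof -
  let ?f = "\<lambda>m. cn(0 := cn 0 + m)"
  let ?w = "\<lambda>m. w @ concat (map (\<lambda>i. istr i (block z) is) [cn 0..<cn 0 + m])"
  have "runs inp (For 2 3 (Seq (items_com const_com is) (Inc 0))) (p, (?f 0)(2 := D, 3 := 0), ?w 0) (p, (?f D)(2 := D, 3 := 0), ?w D)
      (D * (length is * (z + 2 + 9 * B + 3) + 1 + 8) + 2)"
  proof (rule runs_For)
    fix m x y assume m: "m < D"
    have "runs inp (Seq (items_com const_com is) (Inc 0)) (p, (?f m)(2 := x, 3 := y), ?w m)
        (p, ((?f m)(2 := x, 3 := y))(0 := Suc (((?f m)(2 := x, 3 := y)) 0)), ?w m @ istr (((?f m)(2 := x, 3 := y)) 0) (block z) is)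
        (length is * (z + 2 + 9 * B + 3) + 1)"
      by (rule runs_const_cell) (use assms m in auto)
    moreover have "((?f m)(2 := x, 3 := y))(0 := Suc (((?f m)(2 := x, 3 := y)) 0)) = (?f (Suc m))(2 := x, 3 := y)"
      by (auto simp: fun_eq_iff)
    ultimately show "runs inp (Seq (items_com const_com is) (Inc 0)) (p, (?f m)(2 := x, 3 := y), ?w m)
        (p, (?f (Suc m))(2 := x, 3 := y), ?w (Suc m)) (length is * (z + 2 + 9 * B + 3) + 1)" by simp
  qed simp
  moreover have "(?f 0)(2 := D, 3 := 0) = cn" "(?f D)(2 := D, 3 := 0) = cn(0 := cn 0 + D)"
    using assms by (auto simp: fun_eq_iff)
  moreover have "?w D = w @ seg_str z D u (cn 0) (Loop is)"
  proof -
    have "map (\<lambda>(i, is, k). istr i (block k) is) (List.enumerate j (replicate n (is, z))) = map (\<lambda>i. istr i (block z) is) [j..<j + n]" for j n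
      by (intro nth_equalityI) (simp_all add: nth_enumerate_eq)
    then show ?thesis by (simp add: seg_str_def)
  qed
  ultimately show ?thesis by simp
qed

definition token_cost :: "(nat option \<Rightarrow> item list) \<Rightarrow> nat \<Rightarrow> nat" where
  "token_cost g B = (sum_list (map (\<lambda>a. length (g (Some a))) \<Sigma>s) + length (g None)) * (z + 16 * B + 11) + 2 * length \<Sigma>s + 4"

lemma token_letter:
  assumes "inp p = Letter a" "a \<in> set \<Sigma>s" "cn 1 = 0" "cn 0 \<le> B"
  shows "runs inp (token_com g) (p, cn, w) (p, cn(0 := Suc (cn 0)), w @ istr (cn 0) (block z) (g (Some a))) (token_cost g B)"
proof -
  have "a \<in> set as \<Longrightarrow> runs inp (foldr (\<lambda>a c. com.If (Sym {Letter a}) (Seq (items_com const_com (g (Some a))) (Inc 0)) c) as last)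
      (p, cn, w) (p, cn(0 := Suc (cn 0)), w @ istr (cn 0) (block z) (g (Some a)))
      (length (g (Some a)) * (z + 2 + 9 * B + 3) + 1 + 2 * length as)" for as last
  proof (induction as)
    case (Cons b as)
    show ?case
    proof (cases "b = a")
      case True
      have "runs inp (com.If (Sym {Letter a}) (Seq (items_com const_com (g (Some a))) (Inc 0)) c)
        (p, cn, w) (p, cn(0 := Suc (cn 0)), w @ istr (cn 0) (block z) (g (Some a))) (length (g (Some a)) * (z + 2 + 9 * B + 3) + 1 + 2)" for c
        by (rule runs_IfT[OF _ runs_const_cell]) (use assms in auto)
      then show ?thesis unfolding foldr.simps o_apply True by (rule runs_mono) simp
    next
      case False
      then have "runs inp (foldr (\<lambda>a c. com.If (Sym {Letter a}) (Seq (items_com const_com (g (Some a))) (Inc 0)) c) (b # as) last)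
        (p, cn, w) (p, cn(0 := Suc (cn 0)), w @ istr (cn 0) (block z) (g (Some a))) (length (g (Some a)) * (z + 2 + 9 * B + 3) + 1 + 2 * length as + 2)"
        unfolding foldr.simps o_apply
        by (intro runs_IfF Cons.IH) (use assms(1) Cons.prems False in auto)
      then show ?thesis by (rule runs_mono) simp
    qed
  qed simp
  from this[OF assms(2)] have "runs inp (token_com g) (p, cn, w) (p, cn(0 := Suc (cn 0)), w @ istr (cn 0) (block z) (g (Some a)))
      (length (g (Some a)) * (z + 2 + 9 * B + 3) + 1 + 2 * length \<Sigma>s)" unfolding token_com_def .
  then show ?thesis
  proof (rule runs_mono)
    have "length (g (Some a)) \<le> sum_list (map (\<lambda>a. length (g (Some a))) \<Sigma>s)"
      using assms(2) by (intro member_le_sum_list) auto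
    then have "length (g (Some a)) * (z + 2 + 9 * B + 3)
        \<le> (sum_list (map (\<lambda>a. length (g (Some a))) \<Sigma>s) + length (g None)) * (z + 16 * B + 11)"
      by (intro mult_le_mono) auto
    then show "length (g (Some a)) * (z + 2 + 9 * B + 3) + 1 + 2 * length \<Sigma>s \<le> token_cost g B"
      by (simp add: token_cost_def)
  qed
qed

lemma token_other:
  assumes "inp p \<notin> Letter ` set \<Sigma>s"
    and "runs inp (com.If (Sym {S_sym}) (Seq (items_com copy_block (g None)) (Inc 0)) SKIP) (p, cn, w) s T"
  shows "runs inp (token_com g) (p, cn, w) s (T + 2 * length \<Sigma>s)"
proof -
  have "set as \<subseteq> set \<Sigma>s \<Longrightarrow> runs inp (foldr (\<lambda>a c. com.If (Sym {Letter a}) (Seq (items_com const_com (g (Some a))) (Inc 0)) c) as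
      (com.If (Sym {S_sym}) (Seq (items_com copy_block (g None)) (Inc 0)) SKIP)) (p, cn, w) s (T + 2 * length as)" for as
  proof (induction as)
    case Nil
    then show ?case using assms(2) by simp
  next
    case (Cons a as)
    have "runs inp (foldr (\<lambda>a c. com.If (Sym {Letter a}) (Seq (items_com const_com (g (Some a))) (Inc 0)) c) (a # as)
      (com.If (Sym {S_sym}) (Seq (items_com copy_block (g None)) (Inc 0)) SKIP)) (p, cn, w) s (T + 2 * length as + 2)"
      unfolding foldr.simps o_apply by (intro runs_IfF) (use assms(1) Cons in auto)
    then show ?case by (rule runs_mono) simp
  qed
  then show ?thesis unfolding token_com_def by simp
qed

lemma token_skip:
  assumes "inp p \<in> {V_sym, E_sym}"
  shows "runs inp (token_com g) (p, cn, w) (p, cn, w) (token_cost g B)"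
proof -
  have "runs inp (com.If (Sym {S_sym}) (Seq (items_com copy_block (g None)) (Inc 0)) SKIP) (p, cn, w) (p, cn, w) (0 + 2)"
    by (rule runs_IfF[OF _ runs_SKIP]) (use assms in auto)
  note r = token_other[where inp = inp and p = p and cn = cn and w = w and g = g, OF _ this]
  have "runs inp (token_com g) (p, cn, w) (p, cn, w) (0 + 2 + 2 * length \<Sigma>s)"
    by (rule r) (use assms in auto)
  then show ?thesis by (rule runs_mono) (simp add: token_cost_def)
qed

lemma token_block:
  assumes "\<And>i. i < k \<Longrightarrow> inp (p + 1 + int i) = V_sym" "inp (p + 1 + int k) = E_sym" "inp p = S_sym"
    and "cn 1 = 0" "cn 0 \<le> B" "k \<le> B"
  shows "runs inp (token_com g) (p, cn, w) (p, cn(0 := Suc (cn 0)), w @ istr (cn 0) (block k) (g None)) (token_cost g B)"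
proof -
  have "runs inp copy_block (p, cn, w) (p, cn, w @ block k) (7 * B + 6)" for w
    by (rule runs_mono[OF runs_copy_block]) (use assms in auto)
  from runs_Seq[OF runs_items[OF assms(4,5) this] runs_Inc]
  have "runs inp (Seq (items_com copy_block (g None)) (Inc 0)) (p, cn, w) (p, cn(0 := Suc (cn 0)), w @ istr (cn 0) (block k) (g None))
      (length (g None) * (7 * B + 6 + 9 * B + 3) + 1)" .
  from runs_IfT[OF _ this, of "Sym {S_sym}" SKIP] assms(3)
  have "runs inp (com.If (Sym {S_sym}) (Seq (items_com copy_block (g None)) (Inc 0)) SKIP) (p, cn, w)
      (p, cn(0 := Suc (cn 0)), w @ istr (cn 0) (block k) (g None)) (length (g None) * (7 * B + 6 + 9 * B + 3) + 1 + 2)" by simp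
  note r = token_other[where inp = inp and p = p and cn = cn and w = w and g = g, OF _ this]
  have "runs inp (token_com g) (p, cn, w) (p, cn(0 := Suc (cn 0)), w @ istr (cn 0) (block k) (g None))
     (length (g None) * (7 * B + 6 + 9 * B + 3) + 1 + 2 + 2 * length \<Sigma>s)"
    by (rule r) (use assms(3) in auto)
  then show ?thesis
  proof (rule runs_mono)
    have "length (g None) * (7 * B + 6 + 9 * B + 3)
        \<le> (sum_list (map (\<lambda>a. length (g (Some a))) \<Sigma>s) + length (g None)) * (z + 16 * B + 11)"
      by (intro mult_le_mono) auto
    then show "length (g None) * (7 * B + 6 + 9 * B + 3) + 1 + 2 + 2 * length \<Sigma>s \<le> token_cost g B"
      by (simp add: token_cost_def)
  qed
qed

end


section \<open>Polynomial running time of rows\<close>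

text \<open>
  Functions that are given by a polynomial with natural coefficients.
\<close>

definition polyfun :: "(nat \<Rightarrow> nat) \<Rightarrow> bool" where
  "polyfun f \<longleftrightarrow> (\<exists>q. f = poly q)"

lemma polyfun_const: "polyfun (\<lambda>_. c)"
  unfolding polyfun_def by (intro exI[of _ "[:c:]"]) (simp add: fun_eq_iff)

lemma polyfun_id: "polyfun (\<lambda>n. n)"
  unfolding polyfun_def by (intro exI[of _ "[:0, 1:]"]) (simp add: fun_eq_iff)

lemma polyfun_add: "polyfun f \<Longrightarrow> polyfun g \<Longrightarrow> polyfun (\<lambda>n. f n + g n)"
  unfolding polyfun_def
proof (elim exE)
  fix p q assume "f = poly p" "g = poly q"
  then show "\<exists>q. (\<lambda>n. f n + g n) = poly q" by (intro exI[of _ "p + q"]) (simp add: fun_eq_iff)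
qed

lemma polyfun_mult: "polyfun f \<Longrightarrow> polyfun g \<Longrightarrow> polyfun (\<lambda>n. f n * g n)"
  unfolding polyfun_def
proof (elim exE)
  fix p q assume "f = poly p" "g = poly q"
  then show "\<exists>q. (\<lambda>n. f n * g n) = poly q" by (intro exI[of _ "p * q"]) (simp add: fun_eq_iff)
qed

lemma polyfun_compose: "polyfun f \<Longrightarrow> polyfun g \<Longrightarrow> polyfun (\<lambda>n. f (g n))"
  unfolding polyfun_def
proof (elim exE)
  fix p q assume "f = poly p" "g = poly q"
  then show "\<exists>q. (\<lambda>n. f (g n)) = poly q" by (intro exI[of _ "p \<circ>\<^sub>p q"]) (simp add: fun_eq_iff poly_pcompose)
qed

lemmas polyfun_intros = polyfun_const polyfun_id polyfun_add polyfun_mult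

lemma enumerate_append: "List.enumerate n (xs @ ys) = List.enumerate n xs @ List.enumerate (n + length xs) ys"
  by (rule enumerate_append_eq)

lemma runs_reset: "runs inp (While (NonZero i) (Dec i)) (p, cn, w) (p, cn(i := 0), w) (3 * cn i + 1)"
proof -
  have "runs inp (While (NonZero i) (Dec i)) (p, cn(i := cn i - 0), w) (p, cn(i := cn i - cn i), w) (cn i * (1 + 2) + 1)"
  proof (rule runs_While[where S = "\<lambda>m. (p, cn(i := cn i - m), w)"])
    fix m assume m: "m < cn i"
    have "runs inp (Dec i) (p, cn(i := cn i - m), w) (p, (cn(i := cn i - m))(i := cn i - Suc m), w) 1"
      by (rule runs_Dec) (use m in simp)
    then show "runs inp (Dec i) (p, cn(i := cn i - m), w) (p, cn(i := cn i - Suc m), w) 1" by simp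
  qed simp_all
  then have "runs inp (While (NonZero i) (Dec i)) (p, cn, w) (p, cn(i := 0), w) (cn i * (1 + 2) + 1)" by simp
  then show ?thesis by (rule runs_mono) simp
qed

context emission begin

lemma input_at: "flat u = xs @ a # ys \<Longrightarrow> input u (int (length xs)) = a"
  by (simp add: input_def tape_of_mid)

lemma input_end: "input u (int (length (flat u))) = bl" "input u (-1) = bl"
  by (simp_all add: input_def tape_of_def)

lemma bl_notin_flat: "u \<in> words_over (set \<Sigma>s) \<Longrightarrow> bl \<notin> set (flat u)"
proof (induction u)
  case (Cons x u)
  then have "x \<in> Inl ` set \<Sigma>s \<union> range Inr" "bl \<notin> set (flat u)" by (auto simp: words_over_def)
  then show ?case using bl by (cases x) (auto simp: block_def)
qed simp

lemma input_inside: "u \<in> words_over (set \<Sigma>s) \<Longrightarrow> 0 \<le> i \<Longrightarrow> i < int (length (flat u)) \<Longrightarrow> input u i \<noteq> bl"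
  using bl_notin_flat[of u] nth_mem[of "nat i" "flat u"] by (auto simp: input_def tape_of_def nat_less_iff)

abbreviation scan_com :: "(nat option \<Rightarrow> item list) \<Rightarrow> com" where
  "scan_com g \<equiv> While (Sym (- {bl})) (Seq (token_com g) (Move 1))"

lemma scan_skip:
  "(\<And>i. i < m \<Longrightarrow> inp (q + int i) \<in> {V_sym, E_sym}) \<Longrightarrow> runs inp (scan_com g) (q + int m, cn, w) s U \<Longrightarrow>
   runs inp (scan_com g) (q, cn, w) s (m * (token_cost g B + 3) + U)"
proof (induction m arbitrary: q)
  case (Suc m)
  have q: "inp q \<in> {V_sym, E_sym}" using Suc.prems(1)[of 0] by simp
  have "runs inp (scan_com g) (q + 1, cn, w) s (m * (token_cost g B + 3) + U)"
  proof (rule Suc.IH)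
    fix i assume "i < m"
    then show "inp (q + 1 + int i) \<in> {V_sym, E_sym}" using Suc.prems(1)[of "Suc i"] by (simp add: add.assoc)
  qed (use Suc.prems(2) in \<open>simp add: add.assoc\<close>)
  moreover have "holds inp (Sym (- {bl})) (q, cn, w)" using q bl by auto
  moreover have "runs inp (Seq (token_com g) (Move 1)) (q, cn, w) (q + 1, cn, w) (token_cost g B + 1)"
    using runs_Seq[OF token_skip[of inp q, OF q] runs_Move[of 1]] by simp
  ultimately have "runs inp (scan_com g) (q, cn, w) s (token_cost g B + 1 + (m * (token_cost g B + 3) + U) + 2)"
    by (intro runs_WhileT)
  then show ?case by (rule runs_mono) simp
qed simp

lemma scan:
  "u = u1 @ u2 \<Longrightarrow> u \<in> words_over (set \<Sigma>s) \<Longrightarrow> length (flat u) \<le> B \<Longrightarrow> cn 1 = 0 \<Longrightarrow> cn 0 + length u2 \<le> B \<Longrightarrow>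
   runs (input u) (scan_com g) (int (length (flat u1)), cn, w)
     (int (length (flat u)), cn(0 := cn 0 + length u2), w @ seg_str z D u2 (cn 0) (Input g))
     (length (flat u2) * (token_cost g B + 3) + 1)"
proof (induction u2 arbitrary: u1 cn w)
  case Nil
  then show ?case using input_end(1)[of u] by (auto intro!: runs_WhileF[unfolded One_nat_def] simp: seg_str_def)
next
  case (Cons x u2)
  let ?p = "int (length (flat u1))"
  have fl: "flat u = flat u1 @ tok_str x @ flat u2" using Cons.prems(1) by simp
  let ?cn = "cn(0 := Suc (cn 0))"
  have IH: "runs (input u) (scan_com g) (int (length (flat (u1 @ [x]))), ?cn, w')
     (int (length (flat u)), cn(0 := cn 0 + length (x # u2)), w' @ seg_str z D u2 (Suc (cn 0)) (Input g))
     (length (flat u2) * (token_cost g B + 3) + 1)" for w'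
  proof -
    have "cn(0 := Suc (cn 0), 0 := Suc (cn 0) + length u2) = cn(0 := cn 0 + length (x # u2))" by simp
    moreover have "u = (u1 @ [x]) @ u2" "?cn 1 = 0" "?cn 0 + length u2 \<le> B" using Cons.prems by simp_all
    moreover have "?cn 0 = Suc (cn 0)" by simp
    ultimately show ?thesis using Cons.IH[of "u1 @ [x]" ?cn w'] Cons.prems(2,3) by metis
  qed
  show ?case
  proof (cases x)
    case (Inl a)
    have at: "input u ?p = Letter a" by (rule input_at) (use fl Inl in simp)
    have a: "a \<in> set \<Sigma>s" using Cons.prems(1,2) Inl by (auto simp: words_over_def)
    have body: "runs (input u) (Seq (token_com g) (Move 1)) (?p, cn, w) (?p + 1, ?cn, w @ istr (cn 0) (block z) (g (Some a))) (token_cost g B + 1)"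
      using runs_Seq[OF token_letter[of "input u" ?p, OF at a] runs_Move[of 1]] Cons.prems by simp
    have h: "holds (input u) (Sym (- {bl})) (?p, cn, w)" using at a bl by auto
    have p: "int (length (flat (u1 @ [x]))) = ?p + 1" by (simp add: Inl)
    note r = runs_WhileT[OF h body IH[unfolded p]]
    have "runs (input u) (scan_com g) (?p, cn, w)
       (int (length (flat u)), cn(0 := cn 0 + length (x # u2)),
         (w @ istr (cn 0) (block z) (g (Some a))) @ seg_str z D u2 (Suc (cn 0)) (Input g))
       (token_cost g B + 1 + (length (flat u2) * (token_cost g B + 3) + 1) + 2)"
      by (rule r)
    then have "runs (input u) (scan_com g) (?p, cn, w)
       (int (length (flat u)), cn(0 := cn 0 + length (x # u2)),
         (w @ istr (cn 0) (block z) (g (Some a))) @ seg_str z D u2 (Suc (cn 0)) (Input g))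
       (length (flat (x # u2)) * (token_cost g B + 3) + 1)" by (rule runs_mono) (simp add: Inl)
    moreover have "seg_str z D (x # u2) (cn 0) (Input g) = istr (cn 0) (block z) (g (Some a)) @ seg_str z D u2 (Suc (cn 0)) (Input g)"
      by (simp add: Inl seg_str_def)
    ultimately show ?thesis by (simp only: append_assoc)
  next
    case (Inr k)
    have S: "input u ?p = S_sym" by (rule input_at) (use fl Inr in \<open>simp add: block_def\<close>)
    have Vs: "input u (?p + 1 + int i) = V_sym" if "i < k" for i
    proof -
      have "replicate (i + Suc (k - i - 1)) V_sym = replicate i V_sym @ V_sym # replicate (k - i - 1) V_sym"
        unfolding replicate_add by simp
      moreover have "i + Suc (k - i - 1) = k" using that by simp
      ultimately have rep: "replicate k V_sym = replicate i V_sym @ V_sym # replicate (k - i - 1) V_sym" by simp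
      have "flat u = (flat u1 @ S_sym # replicate i V_sym) @ V_sym # (replicate (k - i - 1) V_sym @ [E_sym] @ flat u2)"
        using fl Inr rep by (simp add: block_def)
      from input_at[OF this] show ?thesis by (simp add: ac_simps)
    qed
    have E: "input u (?p + 1 + int k) = E_sym"
    proof -
      have "flat u = (flat u1 @ S_sym # replicate k V_sym) @ E_sym # flat u2"
        using fl Inr by (simp add: block_def)
      from input_at[OF this] show ?thesis by (simp add: ac_simps)
    qed
    have "k \<le> B" using fl Inr Cons.prems(3) by (simp add: block_def)
    then have body: "runs (input u) (Seq (token_com g) (Move 1)) (?p, cn, w) (?p + 1, ?cn, w @ istr (cn 0) (block k) (g None)) (token_cost g B + 1)"
      using runs_Seq[OF token_block[of k "input u" ?p, OF Vs E S] runs_Move[of 1]] Cons.prems by simp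
    have skip: "runs (input u) (scan_com g) (?p + 1, ?cn, w')
      (int (length (flat u)), cn(0 := cn 0 + length (x # u2)), w' @ seg_str z D u2 (Suc (cn 0)) (Input g))
      (Suc k * (token_cost g B + 3) + (length (flat u2) * (token_cost g B + 3) + 1))" for w'
    proof (rule scan_skip)
      show "input u (?p + 1 + int i) \<in> {V_sym, E_sym}" if "i < Suc k" for i
        using Vs[of i] E that by (cases "i = k") auto
      have "?p + 1 + int (Suc k) = int (length (flat (u1 @ [x])))" by (simp add: Inr block_def)
      then show "runs (input u) (scan_com g) (?p + 1 + int (Suc k), ?cn, w')
         (int (length (flat u)), cn(0 := cn 0 + length (x # u2)), w' @ seg_str z D u2 (Suc (cn 0)) (Input g))
         (length (flat u2) * (token_cost g B + 3) + 1)" by (simp only: IH)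
    qed
    have "holds (input u) (Sym (- {bl})) (?p, cn, w)" using S bl by auto
    from runs_WhileT[OF this body skip]
    have "runs (input u) (scan_com g) (?p, cn, w)
       (int (length (flat u)), cn(0 := cn 0 + length (x # u2)),
         (w @ istr (cn 0) (block k) (g None)) @ seg_str z D u2 (Suc (cn 0)) (Input g))
       (length (flat (x # u2)) * (token_cost g B + 3) + 1)" by (rule runs_mono) (simp add: Inr block_def add_mult_distrib)
    moreover have "seg_str z D (x # u2) (cn 0) (Input g) = istr (cn 0) (block k) (g None) @ seg_str z D u2 (Suc (cn 0)) (Input g)"
      by (simp add: Inr seg_str_def)
    ultimately show ?thesis by (simp only: append_assoc)
  qed
qed

lemma runs_seg:
  "\<exists>f. polyfun f \<and> (\<forall>B u D cn w. u \<in> words_over (set \<Sigma>s) \<and> length (flat u) \<le> B \<and> cn 1 = 0 \<and> cn 2 = D \<and> cn 3 = 0 \<and>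
       cn 0 + length (seg_cells z D u seg) \<le> B \<longrightarrow>
     runs (input u) (seg_com seg) (0, cn, w)
       (0, cn(0 := cn 0 + length (seg_cells z D u seg)), w @ seg_str z D u (cn 0) seg) (f B))"
proof (cases seg)
  case (One xs)
  have p: "polyfun (\<lambda>B. length xs * (z + 2 + 9 * B + 3) + 1)" by (intro polyfun_intros)
  have "runs (input u) (seg_com seg) (0, cn, w)
       (0, cn(0 := cn 0 + length (seg_cells z D u seg)), w @ seg_str z D u (cn 0) seg) (length xs * (z + 2 + 9 * B + 3) + 1)"
    if "cn 1 = 0" "cn 0 + length (seg_cells z D u seg) \<le> B" for B u D cn w
    using runs_const_cell[of cn B "input u" xs 0 w] that by (simp add: One seg_str_def)
  with p show ?thesis by blast
next
  case (Loop xs)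
  have p: "polyfun (\<lambda>B. B * (length xs * (z + 2 + 9 * B + 3) + 1 + 8) + 2)" by (intro polyfun_intros)
  have "runs (input u) (seg_com seg) (0, cn, w)
       (0, cn(0 := cn 0 + length (seg_cells z D u seg)), w @ seg_str z D u (cn 0) seg) (B * (length xs * (z + 2 + 9 * B + 3) + 1 + 8) + 2)"
    if "cn 1 = 0" "cn 2 = D" "cn 3 = 0" "cn 0 + length (seg_cells z D u seg) \<le> B" for B u D cn w
  proof -
    have "cn 0 + D \<le> B" using that Loop by simp
    from runs_Loop[OF that(1-3) this, of "input u" xs 0 w u]
    have "runs (input u) (seg_com seg) (0, cn, w)
       (0, cn(0 := cn 0 + length (seg_cells z D u seg)), w @ seg_str z D u (cn 0) seg) (D * (length xs * (z + 2 + 9 * B + 3) + 1 + 8) + 2)"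
      by (simp add: Loop)
    then show ?thesis
    proof (rule runs_mono)
      show "D * (length xs * (z + 2 + 9 * B + 3) + 1 + 8) + 2 \<le> B * (length xs * (z + 2 + 9 * B + 3) + 1 + 8) + 2"
        using \<open>cn 0 + D \<le> B\<close> by (intro add_mono mult_le_mono1) auto
    qed
  qed
  with p show ?thesis by blast
next
  case (Input g)
  have p: "polyfun (\<lambda>B. (B * (token_cost g B + 3) + 1) + (3 * B + 3))"
    unfolding token_cost_def by (intro polyfun_intros)
  have "runs (input u) (seg_com seg) (0, cn, w)
       (0, cn(0 := cn 0 + length (seg_cells z D u seg)), w @ seg_str z D u (cn 0) seg) ((B * (token_cost g B + 3) + 1) + (3 * B + 3))"
    if "u \<in> words_over (set \<Sigma>s)" "length (flat u) \<le> B" "cn 1 = 0" "cn 0 + length (seg_cells z D u seg) \<le> B" for B u D cn w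
  proof -
    have 1: "runs (input u) (scan_com g) (0, cn, w)
       (int (length (flat u)), cn(0 := cn 0 + length u), w @ seg_str z D u (cn 0) (Input g)) (length (flat u) * (token_cost g B + 3) + 1)"
      using scan[of u "[]" u B cn g w D] that by (simp add: Input)
    have 2: "runs (input u) (Seq (Move (-1)) (Seq (While (Sym (- {bl})) (Move (-1))) (Move 1)))
        (int (length (flat u)), cn(0 := cn 0 + length u), w @ seg_str z D u (cn 0) (Input g))
        (0, cn(0 := cn 0 + length u), w @ seg_str z D u (cn 0) (Input g)) (3 * length (flat u) + 3)"
      by (rule runs_rewind) (use input_inside[OF that(1)] input_end in auto)
    have "runs (input u) (seg_com seg) (0, cn, w)
       (0, cn(0 := cn 0 + length (seg_cells z D u seg)), w @ seg_str z D u (cn 0) seg)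
       ((length (flat u) * (token_cost g B + 3) + 1) + (3 * length (flat u) + 3))"
      using runs_Seq[OF 1 2] by (simp add: Input)
    then show ?thesis
    proof (rule runs_mono)
      show "(length (flat u) * (token_cost g B + 3) + 1) + (3 * length (flat u) + 3) \<le> (B * (token_cost g B + 3) + 1) + (3 * B + 3)"
        using that(2) by (intro add_mono mult_le_mono1) auto
    qed
  qed
  with p show ?thesis by blast
qed

lemma runs_segs:
  "\<exists>f. polyfun f \<and> (\<forall>B u D cn w. u \<in> words_over (set \<Sigma>s) \<and> length (flat u) \<le> B \<and> cn 1 = 0 \<and> cn 2 = D \<and> cn 3 = 0 \<and>
       cn 0 + length (cells z D u segs) \<le> B \<longrightarrow>
     runs (input u) (foldr (\<lambda>s. Seq (seg_com s)) segs SKIP) (0, cn, w)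
       (0, cn(0 := cn 0 + length (cells z D u segs)),
        w @ concat (map (\<lambda>(i, is, k). istr i (block k) is) (List.enumerate (cn 0) (cells z D u segs)))) (f B))"
proof (induction segs)
  case Nil
  have "polyfun (\<lambda>_. 0)" by (rule polyfun_const)
  then show ?case by (auto simp: cells_def intro!: runs_SKIP)
next
  case (Cons s segs)
  obtain f where f: "polyfun f" "\<And>B u D cn w. u \<in> words_over (set \<Sigma>s) \<Longrightarrow> length (flat u) \<le> B \<Longrightarrow> cn 1 = 0 \<Longrightarrow> cn 2 = D \<Longrightarrow> cn 3 = 0 \<Longrightarrow>
       cn 0 + length (seg_cells z D u s) \<le> B \<Longrightarrow> runs (input u) (seg_com s) (0, cn, w)
       (0, cn(0 := cn 0 + length (seg_cells z D u s)), w @ seg_str z D u (cn 0) s) (f B)"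
    using runs_seg[of s] by blast
  obtain g where g: "polyfun g" "\<And>B u D cn w. u \<in> words_over (set \<Sigma>s) \<Longrightarrow> length (flat u) \<le> B \<Longrightarrow> cn 1 = 0 \<Longrightarrow> cn 2 = D \<Longrightarrow> cn 3 = 0 \<Longrightarrow>
       cn 0 + length (cells z D u segs) \<le> B \<Longrightarrow> runs (input u) (foldr (\<lambda>s. Seq (seg_com s)) segs SKIP) (0, cn, w)
       (0, cn(0 := cn 0 + length (cells z D u segs)),
        w @ concat (map (\<lambda>(i, is, k). istr i (block k) is) (List.enumerate (cn 0) (cells z D u segs)))) (g B)"
    using Cons.IH by blast
  have cs: "cells z D u (s # segs) = seg_cells z D u s @ cells z D u segs" for D u by (simp add: cells_def)
  have "runs (input u) (foldr (\<lambda>s. Seq (seg_com s)) (s # segs) SKIP) (0, cn, w)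
       (0, cn(0 := cn 0 + length (cells z D u (s # segs))),
        w @ concat (map (\<lambda>(i, is, k). istr i (block k) is) (List.enumerate (cn 0) (cells z D u (s # segs))))) (f B + g B)"
    if a: "u \<in> words_over (set \<Sigma>s)" "length (flat u) \<le> B" "cn 1 = 0" "cn 2 = D" "cn 3 = 0"
       "cn 0 + length (cells z D u (s # segs)) \<le> B" for B u D cn w
  proof -
    let ?n = "length (seg_cells z D u s)"
    let ?cn = "cn(0 := cn 0 + ?n)"
    have 1: "runs (input u) (seg_com s) (0, cn, w) (0, ?cn, w @ seg_str z D u (cn 0) s) (f B)"
      by (rule f(2)) (use a cs in auto)
    have 2: "runs (input u) (foldr (\<lambda>s. Seq (seg_com s)) segs SKIP) (0, ?cn, w @ seg_str z D u (cn 0) s)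
       (0, ?cn(0 := ?cn 0 + length (cells z D u segs)),
        (w @ seg_str z D u (cn 0) s) @ concat (map (\<lambda>(i, is, k). istr i (block k) is) (List.enumerate (?cn 0) (cells z D u segs)))) (g B)"
      by (rule g(2)) (use a cs in auto)
    have "?cn(0 := ?cn 0 + length (cells z D u segs)) = cn(0 := cn 0 + length (cells z D u (s # segs)))"
      by (simp add: cs add.assoc)
    moreover have "(w @ seg_str z D u (cn 0) s) @ concat (map (\<lambda>(i, is, k). istr i (block k) is) (List.enumerate (?cn 0) (cells z D u segs)))
       = w @ concat (map (\<lambda>(i, is, k). istr i (block k) is) (List.enumerate (cn 0) (cells z D u (s # segs))))"
      by (simp add: cs enumerate_append seg_str_def)
    ultimately show ?thesis using runs_Seq[OF 1 2] by simp
  qed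
  then show ?case using polyfun_add[OF f(1) g(1)] by (intro exI[of _ "\<lambda>B. f B + g B"]) blast
qed

lemma runs_row:
  "\<exists>f. polyfun f \<and> (\<forall>B u D cn w. u \<in> words_over (set \<Sigma>s) \<and> length (flat u) \<le> B \<and> cn 0 = 0 \<and> cn 1 = 0 \<and> cn 2 = D \<and> cn 3 = 0 \<and>
       length (cells z D u segs) \<le> B \<longrightarrow>
     runs (input u) (row_com segs) (0, cn, w) (0, cn, w @ row_str z D u segs) (f B))"
proof -
  obtain g where g: "polyfun g" "\<And>B u D cn w. u \<in> words_over (set \<Sigma>s) \<Longrightarrow> length (flat u) \<le> B \<Longrightarrow> cn 1 = 0 \<Longrightarrow> cn 2 = D \<Longrightarrow> cn 3 = 0 \<Longrightarrow>
       cn 0 + length (cells z D u segs) \<le> B \<Longrightarrow> runs (input u) (foldr (\<lambda>s. Seq (seg_com s)) segs SKIP) (0, cn, w)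
       (0, cn(0 := cn 0 + length (cells z D u segs)),
        w @ concat (map (\<lambda>(i, is, k). istr i (block k) is) (List.enumerate (cn 0) (cells z D u segs)))) (g B)"
    using runs_segs[of segs] by blast
  have "runs (input u) (row_com segs) (0, cn, w) (0, cn, w @ row_str z D u segs) (g B + (3 * B + 1))"
    if a: "u \<in> words_over (set \<Sigma>s)" "length (flat u) \<le> B" "cn 0 = 0" "cn 1 = 0" "cn 2 = D" "cn 3 = 0"
       "length (cells z D u segs) \<le> B" for B u D cn w
  proof -
    let ?w = "w @ row_str z D u segs" and ?n = "length (cells z D u segs)"
    have "concat (map (\<lambda>(i, is, k). istr i (block k) is) (List.enumerate (cn 0) (cells z D u segs))) = row_str z D u segs"
      by (simp add: row_str_def row_def a(3))
    then have 1: "runs (input u) (foldr (\<lambda>s. Seq (seg_com s)) segs SKIP) (0, cn, w) (0, cn(0 := ?n), ?w) (g B)"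
      using g(2)[OF a(1,2,4,5,6), of w] a(3,7) by simp
    have 2: "runs (input u) (While (NonZero 0) (Dec 0)) (0, cn(0 := ?n), ?w) (0, cn(0 := ?n, 0 := 0), ?w) (3 * B + 1)"
      by (rule runs_mono[OF runs_reset]) (use a(7) in simp)
    have "cn(0 := ?n, 0 := 0) = cn" using a(3) by auto
    with runs_Seq[OF 1 2] show ?thesis unfolding row_com_def by (simp only:)
  qed
  moreover have "polyfun (\<lambda>B. g B + (3 * B + 1))" by (intro polyfun_intros g(1))
  ultimately show ?thesis by (intro exI[of _ "\<lambda>B. g B + (3 * B + 1)"]) blast
qed

end


section \<open>Evaluating a polynomial; programs for a whole formula\<close>

lemma runs_For_add:
  assumes "i \<noteq> k" "t \<noteq> i" "t \<noteq> k" "cn k = 0"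
    and body: "\<And>cn' w. (\<And>j. j \<notin> {i, k, t} \<Longrightarrow> cn' j = cn j) \<Longrightarrow> runs inp body (p, cn', w) (p, cn'(t := cn' t + a), w) T"
  shows "runs inp (For i k body) (p, cn, w) (p, cn(t := cn t + cn i * a), w) (cn i * (T + 8) + 2)"
proof -
  let ?f = "\<lambda>m. cn(t := cn t + m * a)"
  have "runs inp (For i k body) (p, (?f 0)(i := cn i, k := 0), w) (p, (?f (cn i))(i := cn i, k := 0), w) (cn i * (T + 8) + 2)"
  proof (rule runs_For[OF assms(1)])
    fix m x y
    let ?g = "(?f m)(i := x, k := y)"
    have "runs inp body (p, ?g, w) (p, ?g(t := ?g t + a), w) T" by (rule body) (auto simp: fun_upd_apply)
    moreover have "?g(t := ?g t + a) = (?f (Suc m))(i := x, k := y)"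
      using assms(2,3) by (auto simp: fun_eq_iff)
    ultimately show "runs inp body (p, ?g, w) (p, (?f (Suc m))(i := x, k := y), w) T" by simp
  qed
  moreover have "(?f 0)(i := cn i, k := 0) = cn" "(?f (cn i))(i := cn i, k := 0) = cn(t := cn t + cn i * a)"
    using assms(2-4) by (auto simp: fun_eq_iff)
  ultimately show ?thesis by simp
qed

lemma runs_add:
  "i \<noteq> k \<Longrightarrow> t \<noteq> i \<Longrightarrow> t \<noteq> k \<Longrightarrow> cn k = 0 \<Longrightarrow>
   runs inp (For i k (Inc t)) (p, cn, w) (p, cn(t := cn t + cn i), w) (cn i * 9 + 2)"
proof -
  assume a: "i \<noteq> k" "t \<noteq> i" "t \<noteq> k" "cn k = 0"
  have "runs inp (Inc t) (p, cn', w) (p, cn'(t := cn' t + 1), w) 1" for cn' w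
    using runs_Inc[of inp t p cn' w] by simp
  with runs_For_add[of i k t cn inp "Inc t" p 1 1 w] a show ?thesis by simp
qed

lemma runs_add_const: "runs inp ((Seq (Inc i) ^^ a) SKIP) (p, cn, w) (p, cn(i := cn i + a), w) a"
proof (induction a arbitrary: cn)
  case 0
  then show ?case by (simp add: runs_SKIP)
next
  case (Suc a)
  from runs_Seq[OF runs_Inc[of inp i p cn w] Suc.IH[of "cn(i := Suc (cn i))"]] show ?case by (simp add: fun_upd_upd del: fun_upd_apply) (simp add: fun_upd_same)
qed

text \<open>
  Horner's rule: the counter \<open>2\<close> gets the value of the polynomial at the counter \<open>6\<close>.
\<close>

lemma runs_poly:
  fixes q :: "nat poly"
  shows "\<exists>c f. polyfun f \<and> (\<forall>inp p cn w. cn 2 = 0 \<and> cn 3 = 0 \<and> cn 4 = 0 \<and> cn 7 = 0 \<longrightarrow>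
     runs inp c (p, cn, w) (p, cn(2 := poly q (cn 6)), w) (f (cn 6)))"
proof (induction q)
  case 0
  have "runs inp SKIP (p, cn, w) (p, cn(2 := poly 0 (cn 6)), w) 0" if "cn 2 = 0" for inp p cn w
    using runs_SKIP[of inp "(p, cn, w)"] that by (simp add: fun_upd_idem)
  then show ?case using polyfun_const[of 0] by (intro exI[of _ SKIP] exI[of _ "\<lambda>_. 0"]) blast
next
  case (pCons a q)
  then obtain c f where f: "polyfun f" and c: "\<And>inp p cn w. cn 2 = 0 \<Longrightarrow> cn 3 = 0 \<Longrightarrow> cn 4 = 0 \<Longrightarrow> cn 7 = 0 \<Longrightarrow>
     runs inp c (p, cn, w) (p, cn(2 := poly q (cn 6)), w) (f (cn 6))" by blast
  let ?c = "Seq c (Seq (For 2 3 (For 6 7 (Inc 4))) (Seq (While (NonZero 2) (Dec 2))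
      (Seq (For 4 3 (Inc 2)) (Seq (While (NonZero 4) (Dec 4)) ((Seq (Inc 2) ^^ a) SKIP)))))"
  let ?f = "\<lambda>n. f n + ((poly q n * (n * 9 + 2 + 8) + 2) + ((3 * poly q n + 1) + ((poly q n * n * 9 + 2) + ((3 * (poly q n * n) + 1) + a))))"
  have "polyfun (poly q)" unfolding polyfun_def by blast
  with f have "polyfun ?f" by (intro polyfun_intros)
  moreover have "runs inp ?c (p, cn, w) (p, cn(2 := poly (pCons a q) (cn 6)), w) (?f (cn 6))"
    if z: "cn 2 = 0" "cn 3 = 0" "cn 4 = 0" "cn 7 = 0" for inp p cn w
  proof -
    define n where "n = cn 6"
    define y where "y = poly q n"
    have 1: "runs inp c (p, cn, w) (p, cn(2 := y), w) (f n)"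
      using c[OF z] by (simp add: n_def y_def)
    have "runs inp (For 2 3 (For 6 7 (Inc 4))) (p, cn(2 := y), w)
        (p, (cn(2 := y))(4 := (cn(2 := y)) 4 + (cn(2 := y)) 2 * n), w) ((cn(2 := y)) 2 * (n * 9 + 2 + 8) + 2)"
    proof (rule runs_For_add)
      fix cn' w assume *: "\<And>j. j \<notin> {2, 3, 4 :: nat} \<Longrightarrow> cn' j = (cn(2 := y)) j"
      have "cn' 7 = 0" "cn' 6 = n" using *[of 7] *[of 6] z by (auto simp: n_def)
      with runs_add[of 6 7 4 cn' inp p w]
      show "runs inp (For 6 7 (Inc 4)) (p, cn', w) (p, cn'(4 := cn' 4 + n), w) (n * 9 + 2)" by simp
    qed (use z in auto)
    then have 2: "runs inp (For 2 3 (For 6 7 (Inc 4))) (p, cn(2 := y), w) (p, cn(2 := y, 4 := y * n), w) (y * (n * 9 + 2 + 8) + 2)"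
      using z by simp
    have "cn(2 := y, 4 := y * n, 2 := 0) = cn(4 := y * n)" using z by (auto simp: fun_eq_iff)
    with runs_reset[of inp 2 p "cn(2 := y, 4 := y * n)" w]
    have 3: "runs inp (While (NonZero 2) (Dec 2)) (p, cn(2 := y, 4 := y * n), w) (p, cn(4 := y * n), w) (3 * y + 1)" by simp
    have 4: "runs inp (For 4 3 (Inc 2)) (p, cn(4 := y * n), w) (p, cn(4 := y * n, 2 := y * n), w) (y * n * 9 + 2)"
      using runs_add[of 4 3 2 "cn(4 := y * n)" inp p w] z by simp
    have "cn(4 := y * n, 2 := y * n, 4 := 0) = cn(2 := y * n)" using z by (auto simp: fun_eq_iff)
    with runs_reset[of inp 4 p "cn(4 := y * n, 2 := y * n)" w]
    have 5: "runs inp (While (NonZero 4) (Dec 4)) (p, cn(4 := y * n, 2 := y * n), w) (p, cn(2 := y * n), w) (3 * (y * n) + 1)" by simp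
    have "cn(2 := y * n, 2 := y * n + a) = cn(2 := poly (pCons a q) (cn 6))" by (simp add: y_def n_def algebra_simps)
    with runs_add_const[of inp a 2 p "cn(2 := y * n)" w]
    have 6: "runs inp ((Seq (Inc 2) ^^ a) SKIP) (p, cn(2 := y * n), w) (p, cn(2 := poly (pCons a q) (cn 6)), w) a" by simp
    from runs_Seq[OF 1 runs_Seq[OF 2 runs_Seq[OF 3 runs_Seq[OF 4 runs_Seq[OF 5 6]]]]]
    show ?thesis by (simp only: y_def n_def)
  qed
  ultimately show ?case by (intro exI[of _ ?c] exI[of _ ?f]) blast
qed

context emission begin

definition length_com :: com where
  "length_com = Seq (While (Sym (- {bl})) (Seq (Inc 6) (Move 1)))
     (Seq (Move (-1)) (Seq (While (Sym (- {bl})) (Move (-1))) (Move 1)))"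

lemma runs_length:
  assumes "u \<in> words_over (set \<Sigma>s)" "cn 6 = 0"
  shows "runs (input u) length_com (0, cn, w) (0, cn(6 := length (flat u)), w) (7 * length (flat u) + 4)"
proof -
  let ?n = "length (flat u)"
  have 1: "runs (input u) (While (Sym (- {bl})) (Seq (Inc 6) (Move 1))) (int 0, cn(6 := 0), w) (int ?n, cn(6 := ?n), w) (?n * (2 + 2) + 1)"
  proof (rule runs_While[where S = "\<lambda>m. (int m, cn(6 := m), w)"])
    fix m assume "m < ?n"
    then show "holds (input u) (Sym (- {bl})) (int m, cn(6 := m), w)" using input_inside[OF assms(1), of "int m"] by auto
    show "runs (input u) (Seq (Inc 6) (Move 1)) (int m, cn(6 := m), w) (int (Suc m), cn(6 := Suc m), w) 2"
      using runs_Seq[OF runs_Inc[of "input u" 6 "int m" "cn(6 := m)" w] runs_Move[of 1]]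
      by (simp add: numeral_2_eq_2 add.commute)
  qed (simp add: input_end)
  have 2: "runs (input u) (Seq (Move (-1)) (Seq (While (Sym (- {bl})) (Move (-1))) (Move 1)))
      (int ?n, cn(6 := ?n), w) (0, cn(6 := ?n), w) (3 * ?n + 3)"
    by (rule runs_rewind) (use input_inside[OF assms(1)] input_end in auto)
  have "cn(6 := 0) = cn" using assms(2) by auto
  with runs_Seq[OF 1 2] have "runs (input u) length_com (0, cn, w) (0, cn(6 := ?n), w) ((?n * (2 + 2) + 1) + (3 * ?n + 3))"
    unfolding length_com_def by (simp only: of_nat_0)
  then show ?thesis by (rule runs_mono) simp
qed

text \<open>
  The program appends the string \<open>h D u\<close> and restores all the counters, in time polynomial in any bound
  \<open>B\<close> of the input and of the width of the tape. The flag \<open>loop\<close> tells whether the counters \<open>4\<close> and \<open>5\<close> are at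
  the program's disposal for a loop of \<open>D\<close> rounds; inside of such a loop they are not.
\<close>

definition emits :: "bool \<Rightarrow> com \<Rightarrow> (nat \<Rightarrow> (nat + nat) list \<Rightarrow> sletter list) \<Rightarrow> bool" where
  "emits loop c h \<longleftrightarrow> (\<exists>f. polyfun f \<and> (\<forall>B u D cn w.
     u \<in> words_over (set \<Sigma>s) \<and> length (flat u) \<le> B \<and> width D u \<le> B \<and>
     cn 0 = 0 \<and> cn 1 = 0 \<and> cn 2 = D \<and> cn 3 = 0 \<and> (loop \<longrightarrow> cn 4 = D \<and> cn 5 = 0) \<longrightarrow>
     runs (input u) c (0, cn, w) (0, cn, w @ h D u) (f B)))"

lemma emitsI:
  assumes "polyfun f"
    and "\<And>B u D cn w. u \<in> words_over (set \<Sigma>s) \<Longrightarrow> length (flat u) \<le> B \<Longrightarrow> width D u \<le> B \<Longrightarrow>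
     cn 0 = 0 \<Longrightarrow> cn 1 = 0 \<Longrightarrow> cn 2 = D \<Longrightarrow> cn 3 = 0 \<Longrightarrow> (loop \<Longrightarrow> cn 4 = D \<and> cn 5 = 0) \<Longrightarrow>
     runs (input u) c (0, cn, w) (0, cn, w @ h D u) (f B)"
  shows "emits loop c h"
  using assms unfolding emits_def by blast

lemma emitsE:
  assumes "emits loop c h"
  obtains f where "polyfun f"
    and "\<And>B u D cn w. u \<in> words_over (set \<Sigma>s) \<Longrightarrow> length (flat u) \<le> B \<Longrightarrow> width D u \<le> B \<Longrightarrow>
     cn 0 = 0 \<Longrightarrow> cn 1 = 0 \<Longrightarrow> cn 2 = D \<Longrightarrow> cn 3 = 0 \<Longrightarrow> (loop \<Longrightarrow> cn 4 = D \<and> cn 5 = 0) \<Longrightarrow>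
     runs (input u) c (0, cn, w) (0, cn, w @ h D u) (f B)"
  using assms unfolding emits_def by blast

lemma emits_const: "emits loop (emit_all xs) (\<lambda>D u. xs)"
  by (rule emitsI[OF polyfun_const]) (rule runs_emit_all)

lemma emits_Seq:
  assumes "emits loop a g" "emits loop b h"
  shows "emits loop (Seq a b) (\<lambda>D u. g D u @ h D u)"
proof -
  obtain f1 where f1: "polyfun f1" "\<And>B u D cn w. u \<in> words_over (set \<Sigma>s) \<Longrightarrow> length (flat u) \<le> B \<Longrightarrow> width D u \<le> B \<Longrightarrow>
     cn 0 = 0 \<Longrightarrow> cn 1 = 0 \<Longrightarrow> cn 2 = D \<Longrightarrow> cn 3 = 0 \<Longrightarrow> (loop \<Longrightarrow> cn 4 = D \<and> cn 5 = 0) \<Longrightarrow>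
     runs (input u) a (0, cn, w) (0, cn, w @ g D u) (f1 B)" using emitsE[OF assms(1)] by blast
  obtain f2 where f2: "polyfun f2" "\<And>B u D cn w. u \<in> words_over (set \<Sigma>s) \<Longrightarrow> length (flat u) \<le> B \<Longrightarrow> width D u \<le> B \<Longrightarrow>
     cn 0 = 0 \<Longrightarrow> cn 1 = 0 \<Longrightarrow> cn 2 = D \<Longrightarrow> cn 3 = 0 \<Longrightarrow> (loop \<Longrightarrow> cn 4 = D \<and> cn 5 = 0) \<Longrightarrow>
     runs (input u) b (0, cn, w) (0, cn, w @ h D u) (f2 B)" using emitsE[OF assms(2)] by blast
  show ?thesis
  proof (rule emitsI[OF polyfun_add[OF f1(1) f2(1)]])
    fix B u D w and cn :: "nat \<Rightarrow> nat"
    assume a: "u \<in> words_over (set \<Sigma>s)" "length (flat u) \<le> B" "width D u \<le> B"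
      "cn 0 = 0" "cn 1 = 0" "cn 2 = D" "cn 3 = 0" "loop \<Longrightarrow> cn 4 = D \<and> cn 5 = 0"
    from runs_Seq[OF f1(2)[OF a, of w] f2(2)[OF a, of "w @ g D u"]]
    show "runs (input u) (Seq a b) (0, cn, w) (0, cn, w @ g D u @ h D u) (f1 B + f2 B)" by simp
  qed
qed

lemma emits_list:
  assumes "\<And>x. x \<in> set xs \<Longrightarrow> emits loop (c x) (h x)"
  shows "emits loop (foldr (\<lambda>x. Seq (c x)) xs SKIP) (\<lambda>D u. concat (map (\<lambda>x. h x D u) xs))"
  using assms
proof (induction xs)
  case Nil
  show ?case by (rule emitsI[OF polyfun_const]) (simp add: runs_SKIP)
next
  case (Cons x xs)
  from emits_Seq[OF Cons.prems[of x] Cons.IH] Cons.prems show ?case by simp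
qed

lemma emits_row:
  assumes "\<And>D u. length (cells z D u segs) = width D u"
  shows "emits loop (row_com segs) (\<lambda>D u. row_str z D u segs)"
proof -
  obtain f where "polyfun f" "\<And>B u D cn w. u \<in> words_over (set \<Sigma>s) \<Longrightarrow> length (flat u) \<le> B \<Longrightarrow>
     cn 0 = 0 \<Longrightarrow> cn 1 = 0 \<Longrightarrow> cn 2 = D \<Longrightarrow> cn 3 = 0 \<Longrightarrow> length (cells z D u segs) \<le> B \<Longrightarrow>
     runs (input u) (row_com segs) (0, cn, w) (0, cn, w @ row_str z D u segs) (f B)"
    using runs_row[of segs] by blast
  then show ?thesis by (intro emitsI[of f]) (simp_all add: assms)
qed

lemma emits_For:
  assumes "emits False c h"
  shows "emits True (For 4 5 c) (\<lambda>D u. concat (replicate D (h D u)))"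
proof -
  obtain f where f: "polyfun f" "\<And>B u D cn w. u \<in> words_over (set \<Sigma>s) \<Longrightarrow> length (flat u) \<le> B \<Longrightarrow> width D u \<le> B \<Longrightarrow>
     cn 0 = 0 \<Longrightarrow> cn 1 = 0 \<Longrightarrow> cn 2 = D \<Longrightarrow> cn 3 = 0 \<Longrightarrow> runs (input u) c (0, cn, w) (0, cn, w @ h D u) (f B)"
    using emitsE[OF assms] by metis
  have "polyfun (\<lambda>B. B * (f B + 8) + 2)" by (intro polyfun_intros f(1))
  then show ?thesis
  proof (rule emitsI)
    fix B u D w and cn :: "nat \<Rightarrow> nat"
    assume a: "u \<in> words_over (set \<Sigma>s)" "length (flat u) \<le> B" "width D u \<le> B"
      "cn 0 = 0" "cn 1 = 0" "cn 2 = D" "cn 3 = 0" "True \<Longrightarrow> cn 4 = D \<and> cn 5 = 0"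
    have "runs (input u) (For 4 5 c) (0, cn, w) (0, cn, w @ concat (replicate D (h D u))) (D * (f B + 8) + 2)"
      by (rule runs_For_emit) (use a in \<open>auto intro!: f(2)\<close>)
    then show "runs (input u) (For 4 5 c) (0, cn, w) (0, cn, w @ concat (replicate D (h D u))) (B * (f B + 8) + 2)"
      by (rule runs_mono) (use a(3) in \<open>simp add: width_def\<close>)
  qed
qed

text \<open>
  The program is preceded by the computation of \<open>D\<close>, which goes to the counters \<open>2\<close> and \<open>4\<close>.
\<close>

lemma emits_runs:
  fixes r :: "nat poly"
  assumes "emits True c h"
  shows "\<exists>c' q. \<forall>u \<in> words_over (set \<Sigma>s). \<exists>cn.
     runs (input u) c' (0, (\<lambda>_. 0), []) (0, cn, h (poly r (length (flat u))) u) (poly q (length (flat u)))"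
proof -
  obtain f where f: "polyfun f" "\<And>B u D cn w. u \<in> words_over (set \<Sigma>s) \<Longrightarrow> length (flat u) \<le> B \<Longrightarrow> width D u \<le> B \<Longrightarrow>
     cn 0 = 0 \<Longrightarrow> cn 1 = 0 \<Longrightarrow> cn 2 = D \<Longrightarrow> cn 3 = 0 \<Longrightarrow> (cn 4 = D \<and> cn 5 = 0) \<Longrightarrow>
     runs (input u) c (0, cn, w) (0, cn, w @ h D u) (f B)"
    using emitsE[OF assms] by metis
  obtain d g where g: "polyfun g" "\<And>inp p cn w. cn 2 = 0 \<Longrightarrow> cn 3 = 0 \<Longrightarrow> cn 4 = 0 \<Longrightarrow> cn 7 = 0 \<Longrightarrow>
     runs inp d (p, cn, w) (p, cn(2 := poly r (cn 6)), w) (g (cn 6))" using runs_poly[of r] by blast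
  have r: "polyfun (poly r)" unfolding polyfun_def by blast
  have "polyfun (\<lambda>n. f (2 * poly r n + 2 + n))"
    by (rule polyfun_compose[OF f(1)]) (intro polyfun_intros r)
  then have "polyfun (\<lambda>n. (7 * n + 4) + (g n + ((poly r n * 9 + 2) + f (2 * poly r n + 2 + n))))"
    by (intro polyfun_intros g(1) r)
  then obtain q where q: "(\<lambda>n. (7 * n + 4) + (g n + ((poly r n * 9 + 2) + f (2 * poly r n + 2 + n)))) = poly q"
    unfolding polyfun_def by blast
  have "\<exists>cn. runs (input u) (Seq length_com (Seq d (Seq (For 2 3 (Inc 4)) c))) (0, (\<lambda>_. 0), [])
      (0, cn, h (poly r (length (flat u))) u) (poly q (length (flat u)))" if u: "u \<in> words_over (set \<Sigma>s)" for u
  proof -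
    define n where "n = length (flat u)"
    let ?o = "\<lambda>_ :: nat. 0 :: nat"
    have 1: "runs (input u) length_com (0, ?o, []) (0, ?o(6 := n), []) (7 * n + 4)"
      unfolding n_def using runs_length[OF u, of ?o "[]"] by simp
    have 2: "runs (input u) d (0, ?o(6 := n), []) (0, ?o(6 := n, 2 := poly r n), []) (g n)"
      using g(2)[of "?o(6 := n)" "input u" 0 "[]"] by simp
    have 3: "runs (input u) (For 2 3 (Inc 4)) (0, ?o(6 := n, 2 := poly r n), []) (0, ?o(6 := n, 2 := poly r n, 4 := poly r n), []) (poly r n * 9 + 2)"
      using runs_add[of 2 3 4 "?o(6 := n, 2 := poly r n)" "input u" 0 "[]"] by simp
    have "length u \<le> length (flat u)"
    proof (induction u)
      case (Cons x u)
      then show ?case by (cases x) (auto simp: block_def)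
    qed simp
    then have 4: "runs (input u) c (0, ?o(6 := n, 2 := poly r n, 4 := poly r n), [])
      (0, ?o(6 := n, 2 := poly r n, 4 := poly r n), [] @ h (poly r n) u) (f (2 * poly r n + 2 + n))"
      by (intro f(2) u) (auto simp: n_def width_def)
    from runs_Seq[OF 1 runs_Seq[OF 2 runs_Seq[OF 3 4]]] fun_cong[OF q, of n] show ?thesis
      unfolding n_def by auto
  qed
  then show ?thesis by blast
qed

end


section \<open>The program that writes the tableau formula\<close>

abbreviation tsym :: "token \<Rightarrow> sletter" where "tsym t \<equiv> Letter (letter t)"

lemma flat_tok [simp]: "flat (map tok bs) = map tsym bs"
  by (induction bs) simp_all

lemma flat_replicate [simp]: "flat (replicate n (Inl a)) = replicate n (Letter a)"
  by (induction n) simp_all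

lemma istr_Ch [simp]: "istr j v (map Ch xs) = xs"
  by (induction xs) simp_all

lemma istr_replicate [simp]: "istr j v (replicate n (Ch a)) = replicate n a"
  by (induction n) simp_all

lemma concat_map_concat: "concat (map f (concat xss)) = concat (map (\<lambda>xs. concat (map f xs)) xss)"
  by (induction xss) simp_all

text \<open>
  The name of the variable of copy \<open>b\<close>, kind \<open>k\<close> and index \<open>j + d\<close>, where \<open>j\<close> is the number of the cell.
\<close>

definition var_items :: "bool \<Rightarrow> nat \<Rightarrow> nat \<Rightarrow> item list" where
  "var_items b k d = map Ch (map tsym (VarTok # Bit1 # (if b then Bit1 else Bit0) # replicate k Bit1 @ [Bit0])) @
     Index # map Ch (map tsym (replicate d Bit1))"

lemma istr_var_items: "istr j v (var_items b k d) = flat (encode_var (vn b k (j + d)))"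
  by (simp add: var_items_def encode_var_def binary_vn replicate_add)

fun tmpl_items :: "tmpl \<Rightarrow> item list" where
  "tmpl_items (TLit s b k d) = map Ch (if s then [] else [tsym NegTok]) @ var_items b k d"
| "tmpl_items (TConst c) = map Ch (block c)"
| "tmpl_items TWeight = [Wt]"
| "tmpl_items (TPlus t u) = Ch (tsym LPar) # tmpl_items t @ Ch (tsym PlusTok) # tmpl_items u @ [Ch (tsym RPar)]"
| "tmpl_items (TTimes t u) = Ch (tsym LPar) # tmpl_items t @ Ch (tsym TimesTok) # tmpl_items u @ [Ch (tsym RPar)]"

lemma istr_tmpl_items: "istr j (block w) (tmpl_items t) = flat (encode (inst j w t))"
  by (induction t) (simp_all add: istr_var_items)

lemma cells_map: "cells z D u (map (map_seg f) segs) = map (\<lambda>(x, k). (f x, k)) (cells z D u segs)"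
proof -
  have "seg_cells z D u (map_seg f s) = map (\<lambda>(x, k). (f x, k)) (seg_cells z D u s)" for s
    by (cases s) (auto simp: o_def split: sum.split)
  then show ?thesis by (simp add: cells_def map_concat o_def)
qed

lemma length_cells_map: "length (cells z D u (map (map_seg f) segs)) = length (cells z D u segs)"
  by (simp add: cells_map)

lemma row_map: "row z D u h (map (map_seg f) segs) = row z D u (\<lambda>j k x. h j k (f x)) segs"
  unfolding row_def cells_map
  by (intro nth_equalityI) (simp_all add: nth_enumerate_eq case_prod_beta)

lemma row_str_map: "row_str z D u (map (map_seg f) segs) = concat (row z D u (\<lambda>j k x. istr j (block k) (f x)) segs)"
  by (simp add: row_str_def row_map)

lemma flat_encode_SumQs:
  "flat (encode (foldr SumQ vs \<phi>)) = concat (map (\<lambda>v. tsym SumTok # flat (encode_var v)) vs) @ flat (encode \<phi>)"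
  by (induction vs) simp_all

lemma replicate_snoc: "replicate n x @ x # xs = x # replicate n x @ xs"
  by (induction n) simp_all

lemma flat_encode_prods:
  "flat (encode (prods e fs)) = concat (map (\<lambda>\<phi>. tsym LPar # flat (encode \<phi>) @ [tsym TimesTok]) fs) @ block e @ replicate (length fs) (tsym RPar)"
  unfolding prods_def by (induction fs) (simp_all add: replicate_snoc)

lemma flat_encode_sums:
  "flat (encode (foldr Plus fs (Const e))) =
     concat (map (\<lambda>\<phi>. tsym LPar # flat (encode \<phi>) @ [tsym PlusTok]) fs) @ block e @ replicate (length fs) (tsym RPar)"
  by (induction fs) (simp_all add: replicate_snoc)

lemma length_cells_std: "length (cells z D u (std x c g e)) = width D u"
  by (simp add: cells_def std_def width_def)

lemma length_row: "length (row z D u f segs) = length (cells z D u segs)"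
  by (simp add: row_def)

lemma map_row: "map g (row z D u f segs) = row z D u (\<lambda>j k x. g (f j k x)) segs"
  by (simp add: row_def case_prod_beta)

text \<open>
  The index \<open>z\<close> of the cells without a semiring value is that of \<open>0\<close>.
\<close>

locale reduction = tableau M rs + emission \<Sigma>s bl z
  for M :: "'r::comm_semiring_1 srtm" and rs \<Sigma>s bl z +
  assumes z: "z = ci 0"
begin

text \<open>
  A product over the cells of a row: every factor is preceded by a parenthesis, which is closed behind
  the neutral element at the very end. The closing parentheses are counted by a second pass over the row.
\<close>

definition formula_com :: "tmpl seg list \<Rightarrow> com" where
  "formula_com segs =
     Seq (row_com (map (map_seg (\<lambda>t. Ch (tsym LPar) # tmpl_items t @ [Ch (tsym TimesTok)])) segs))
     (Seq (emit_all (block (ci 1))) (row_com (map (map_seg (\<lambda>_. [Ch (tsym RPar)])) segs)))"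

lemma emits_formula:
  assumes "\<And>D u. length (cells z D u segs) = width D u"
  shows "emits loop (formula_com segs) (\<lambda>D u. flat (encode (row_formula D u segs)))"
proof -
  have "concat (row z D u (\<lambda>j k x. [tsym RPar]) segs) = replicate (length (row z D u inst segs)) (tsym RPar)" for D u
    unfolding length_row row_def by (simp add: case_prod_beta' concat_map_singleton map_replicate_const)
  then have *: "flat (encode (row_formula D u segs)) = row_str z D u (map (map_seg (\<lambda>t. Ch (tsym LPar) # tmpl_items t @ [Ch (tsym TimesTok)])) segs)
      @ block (ci 1) @ row_str z D u (map (map_seg (\<lambda>_. [Ch (tsym RPar)])) segs)" for D u
    unfolding row_formula_def flat_encode_prods row_str_map map_row
    by (simp add: istr_tmpl_items z)
  show ?thesis
    unfolding formula_com_def *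
    by (intro emits_Seq emits_row emits_const) (simp_all add: length_cells_map assms)
qed

definition quantifier_items :: "bool \<Rightarrow> nat list \<Rightarrow> item list" where
  "quantifier_items b ks = concat (map (\<lambda>k. Ch (tsym SumTok) # var_items b k 1) ks)"

definition quantifier_com :: "bool \<Rightarrow> com" where
  "quantifier_com b = row_com (map (map_seg (quantifier_items b)) var_segs)"

definition quantifiers :: "nat \<Rightarrow> (nat + nat) list \<Rightarrow> bool \<Rightarrow> sletter list" where
  "quantifiers D u b = concat (map (\<lambda>v. tsym SumTok # flat (encode_var v)) (vars D u b))"

lemma emits_quantifiers: "emits loop (quantifier_com b) (\<lambda>D u. quantifiers D u b)"
proof -
  have "istr j v (quantifier_items b ks) = concat (map (\<lambda>k. tsym SumTok # flat (encode_var (vn b k (j + 1)))) ks)" for j v ks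
    unfolding quantifier_items_def by (induction ks) (simp_all add: istr_var_items)
  moreover have "quantifiers D u b = concat (row z D u (\<lambda>j w ks. concat (map (\<lambda>k. tsym SumTok # flat (encode_var (vn b k (j + 1)))) ks)) var_segs)"
    for D u
    unfolding quantifiers_def vars_def concat_map_concat map_row z by (simp add: o_def)
  ultimately have *: "quantifiers D u b = row_str z D u (map (map_seg (quantifier_items b)) var_segs)" for D u
    unfolding row_str_map by simp
  show ?thesis
    unfolding quantifier_com_def *
    by (rule emits_row) (simp add: length_cells_map var_segs_def length_cells_std)
qed

definition step_com :: "bool \<Rightarrow> com" where
  "step_com b = Seq (foldr (\<lambda>t. Seq (Seq (emit_all [tsym LPar]) (Seq (formula_com (step_segs b t)) (emit_all [tsym PlusTok])))) etrans SKIP)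
     (emit_all (block (ci 0) @ replicate (length etrans) (tsym RPar)))"

lemma emits_step: "emits loop (step_com b) (\<lambda>D u. flat (encode (step_formula D u b)))"
proof -
  have *: "flat (encode (step_formula D u b)) =
      concat (map (\<lambda>t. [tsym LPar] @ flat (encode (row_formula D u (step_segs b t))) @ [tsym PlusTok]) etrans) @
      (block (ci 0) @ replicate (length etrans) (tsym RPar))" for D u
    unfolding step_formula_def flat_encode_sums by (simp add: o_def)
  show ?thesis
    unfolding step_com_def *
    by (intro emits_Seq emits_list emits_const emits_formula) (simp add: step_segs_def length_cells_std)
qed

text \<open>
  The string of one stage of the run without the closing parenthesis.
\<close>

definition stage :: "nat \<Rightarrow> (nat + nat) list \<Rightarrow> bool \<Rightarrow> sletter list" where
  "stage D u b = quantifiers D u (\<not> b) @ [tsym LPar] @ flat (encode (step_formula D u b)) @ [tsym TimesTok]"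

definition stage_com :: "bool \<Rightarrow> com" where
  "stage_com b = Seq (quantifier_com (\<not> b)) (Seq (emit_all [tsym LPar]) (Seq (step_com b) (emit_all [tsym TimesTok])))"

lemma emits_stage: "emits loop (stage_com b) (\<lambda>D u. stage D u b)"
  unfolding stage_com_def stage_def by (intro emits_Seq emits_quantifiers emits_const emits_step)

text \<open>
  Two stages at a time, since the two copies of the variables alternate; this gives a loop of \<open>D\<close> rounds.
\<close>

lemma flat_encode_run:
  "flat (encode (run_formula D u (2 * n) b)) =
     concat (replicate n (stage D u b @ stage D u (\<not> b))) @ block (ci 1) @ concat (replicate n [tsym RPar, tsym RPar])"
proof (induction n)
  case (Suc n)
  have "concat (replicate n [tsym RPar, tsym RPar]) @ [tsym RPar, tsym RPar] = concat (replicate (Suc n) [tsym RPar, tsym RPar])"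
    by (induction n) simp_all
  with Suc show ?case
    by (simp add: flat_encode_SumQs stage_def quantifiers_def)
qed simp

definition machine_com :: com where
  "machine_com = Seq (quantifier_com False) (Seq (emit_all [tsym LPar]) (Seq (formula_com head_segs) (Seq (emit_all [tsym TimesTok, tsym LPar])
     (Seq (formula_com init_segs) (Seq (emit_all [tsym TimesTok]) (Seq (For 4 5 (Seq (stage_com False) (stage_com True)))
       (Seq (emit_all (block (ci 1))) (Seq (For 4 5 (emit_all [tsym RPar, tsym RPar])) (emit_all [tsym RPar, tsym RPar])))))))))"

lemma emits_machine: "emits True machine_com (\<lambda>D u. flat (encode (machine_formula D u)))"
proof -
  have *: "flat (encode (machine_formula D u)) = quantifiers D u False @ [tsym LPar] @ flat (encode (row_formula D u head_segs)) @
      [tsym TimesTok, tsym LPar] @ flat (encode (row_formula D u init_segs)) @ [tsym TimesTok] @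
      concat (replicate D (stage D u False @ stage D u True)) @ block (ci 1) @ concat (replicate D [tsym RPar, tsym RPar]) @ [tsym RPar, tsym RPar]"
    for D u
    unfolding machine_formula_def flat_encode_SumQs by (simp add: flat_encode_run quantifiers_def)
  have length_cells_head: "length (cells z D u head_segs) = width D u" for D u
    by (simp add: head_segs_def cells_def width_def)
  show ?thesis
    unfolding machine_com_def *
    by (intro emits_Seq emits_quantifiers emits_const emits_formula emits_For emits_stage)
       (simp_all add: length_cells_head init_segs_def length_cells_std)
qed

end


section \<open>Completeness\<close>

lemma poly_nat_mono: "m \<le> n \<Longrightarrow> poly p m \<le> poly (p :: nat poly) n"
  by (induction p) (auto intro: mult_le_mono)

lemma swords_eq: "swords \<Sigma> = flat ` words_over \<Sigma>"
proof -
  have "{[Letter a] | a. a \<in> \<Sigma>} \<union> {S_sym # replicate n V_sym @ [E_sym] | n. True} = tok_str ` (Inl ` \<Sigma> \<union> range Inr)"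
    by (auto simp: image_Un image_image block_def)
  then show ?thesis
    unfolding swords_def words_over_def flat_def by (simp only: lists_image image_image)
qed

lemma ssubst_flat: "ssubst \<sigma> (flat u) = map (map_sum id \<sigma>) u"
proof (induction u)
  case (Cons x u)
  then show ?case
    using ssubst_block[of \<sigma> _ "flat u"] by (cases x) (simp_all add: block_def del: ssubst.simps(3))
qed simp

lemma map_encode: "map (map_sum id \<sigma>) (encode \<phi>) = encode (map_wqbf \<sigma> \<phi>)"
proof -
  have "map (map_sum id \<sigma>) (encode_var v) = encode_var v" for v by (simp add: encode_var_def)
  then show ?thesis by (induction \<phi> rule: encode.induct) simp_all
qed

lemma encode_words: "encode \<phi> \<in> words_over sat_alphabet"
proof -
  have v: "encode_var v \<in> words_over sat_alphabet" for v by (auto simp: encode_var_def words_over_def sat_alphabet_def simp del: letter.simps)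
  show ?thesis
    by (induction \<phi> rule: encode.induct) (use v in \<open>auto simp: words_over_def sat_alphabet_def simp del: letter.simps\<close>)
qed

lemma set_flat: "u \<in> words_over \<Sigma> \<Longrightarrow> set (flat u) \<subseteq> salphabet \<Sigma>"
proof (induction u)
  case (Cons x u)
  then show ?case by (cases x) (auto simp: words_over_def salphabet_def block_def)
qed simp

lemma finite_counters: "finite (counters c)"
  by (induction c) (auto split: test.split)

lemma finite_symbols: "finite (symbols c)"
  by (induction c) auto

text \<open>
  The alphabet also contains the letters that the program emits outside \<open>A \<union> B\<close>.
\<close>

lemma compile_polytime:
  assumes fin: "finite A" "finite B" and bl: "bl \<notin> A \<union> B" "bl \<noteq> S_sym" and D: "\<And>xs. xs \<in> D \<Longrightarrow> set xs \<subseteq> A"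
    and runs: "\<And>xs. xs \<in> D \<Longrightarrow> \<exists>cn. runs (tape_of bl xs) c (0, (\<lambda>_. 0), []) (0, cn, F xs) (poly q (length xs))"
  shows "polytime_computable A B D F"
proof -
  let ?Al = "A \<union> B \<union> symbols c \<union> {bl, S_sym}"
  obtain K where K: "counters c \<subseteq> {..<K}"
    using finite_counters[of c] finite_nat_iff_bounded by blast
  let ?M = "compile bl ?Al K c"
  have M: "tm_alphabet ?M = ?Al" "tm_blank ?M = bl" by (simp_all add: compile_def Let_def)
  have "tm ?M" by (rule tm_compile) (use fin finite_symbols in auto)
  moreover have "tm_computes_within ?M (poly (q + [:1:]) (length xs)) xs (F xs)" if xs: "xs \<in> D" for xs
  proof -
    interpret compiled bl ?Al K c xs
      by unfold_locales (use D[OF xs] K bl in auto)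
    obtain cn t where "t \<le> poly q (length xs)" "big inp c (0, (\<lambda>_. 0), []) t (0, cn, F xs)"
      using runs[OF xs] unfolding inp_def runs_def by blast
    with compiled_computes[of t 0 cn "F xs"] show ?thesis
      unfolding tm_computes_within_def by (auto intro: le_trans)
  qed
  ultimately show ?thesis
    unfolding polytime_computable_def using bl M by (intro exI[of _ ?M] exI[of _ "q + [:1:]"]) auto
qed

text \<open>
  The input is the string of a word with indices in place of values. It is mapped to the string of the
  tableau formula of this word. The indices below \<open>length rs\<close> are reserved for the
  constants of the formula.
\<close>

theorem NP_inf_reducible:
  fixes f :: "'r::comm_semiring_1 word \<Rightarrow> 'r"
  assumes "NP_inf \<Sigma> f"
  shows "karp_s_reducible \<Sigma> f sat_alphabet (SAT :: 'r word \<Rightarrow> 'r)"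
proof -
  obtain M :: "'r srtm" and L and p :: "nat poly" where M: "srtm M" "input_alphabet M = \<Sigma>" "path_bound M L"
    and L: "\<And>s. s \<in> words_over \<Sigma> \<Longrightarrow> L s \<le> poly p (length s)"
    and f: "\<And>s. s \<in> words_over \<Sigma> \<Longrightarrow> f s = machine_output M s"
    using assms unfolding NP_inf_def by blast
  have fin: "finite \<Sigma>" "finite sat_alphabet"
  proof -
    show "finite \<Sigma>" using M(1,2) finite_subset unfolding srtm_def by blast
    have "range letter = letter ` {LPar, RPar, PlusTok, TimesTok, SumTok, ProdTok, NegTok, VarTok, Bit0, Bit1}"
    proof -
      have "t \<in> {LPar, RPar, PlusTok, TimesTok, SumTok, ProdTok, NegTok, VarTok, Bit0, Bit1}" for t by (cases t) simp_all
      then show ?thesis by blast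
    qed
    then show "finite sat_alphabet" by (simp add: sat_alphabet_def)
  qed
  obtain rs where rs': "set rs = insert 0 (insert 1 (weights M))" "distinct rs"
    using M(1) finite_distinct_list[of "insert 0 (insert 1 (weights M))"] unfolding srtm_def by auto
  obtain b where b: "b \<notin> \<Sigma> \<union> sat_alphabet"
    using fin ex_new_if_finite[of "\<Sigma> \<union> sat_alphabet"] by auto
  interpret tableau M rs by unfold_locales (use M rs' in auto)
  interpret reduction M rs "sorted_list_of_set \<Sigma>" "Letter b" "ci 0"
    by unfold_locales (use b fin in auto)
  have \<Sigma>s: "set (sorted_list_of_set \<Sigma>) = \<Sigma>" using fin by simp
  let ?r = "p + [:1:]"
  let ?D = "\<lambda>x. poly ?r (length x)"
  \<comment> \<open>A string of \<open>swords \<Sigma>\<close> read as a word, with indices in place of semiring values.\<close>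
  define U where "U x = (SOME u. u \<in> words_over \<Sigma> \<and> flat u = x)" for x
  have U: "U x \<in> words_over \<Sigma>" "flat (U x) = x" if "x \<in> swords \<Sigma>" for x
  proof -
    have "\<exists>u. u \<in> words_over \<Sigma> \<and> flat u = x" using that by (auto simp: swords_eq)
    then have "U x \<in> words_over \<Sigma> \<and> flat (U x) = x" unfolding U_def by (rule someI_ex)
    then show "U x \<in> words_over \<Sigma>" "flat (U x) = x" by auto
  qed
  define T where "T x = flat (encode (machine_formula (?D x) (U x)))" for x
  obtain c q where c: "\<forall>u \<in> words_over \<Sigma>. \<exists>cn. runs (input u) c (0, (\<lambda>_. 0), [])
      (0, cn, flat (encode (machine_formula (poly ?r (length (flat u))) u))) (poly q (length (flat u)))"
    using emits_runs[OF emits_machine, of ?r] unfolding \<Sigma>s by blast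
  have "polytime_computable (salphabet \<Sigma>) (salphabet sat_alphabet) (swords \<Sigma>) T"
  proof (rule compile_polytime)
    show "finite (salphabet \<Sigma>)" "finite (salphabet sat_alphabet)" using fin by (auto simp: salphabet_def)
    show "Letter b \<notin> salphabet \<Sigma> \<union> salphabet sat_alphabet" "Letter b \<noteq> S_sym" using b by (auto simp: salphabet_def)
    show "set xs \<subseteq> salphabet \<Sigma>" if "xs \<in> swords \<Sigma>" for xs using set_flat U[OF that] by metis
    show "\<exists>cn. runs (tape_of (Letter b) xs) c (0, (\<lambda>_. 0), []) (0, cn, T xs) (poly q (length xs))" if "xs \<in> swords \<Sigma>" for xs
      using c U[OF that] unfolding T_def input_def by metis
  qed
  moreover have "T ` swords \<Sigma> \<subseteq> swords sat_alphabet"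
    unfolding swords_eq[of sat_alphabet] T_def using encode_words by blast
  moreover have "f (ssubst \<sigma> x) = SAT (ssubst \<sigma> (T x))"
    if x: "x \<in> swords \<Sigma>" and \<sigma>: "\<forall>i<length rs. \<sigma> i = rs ! i" for x \<sigma>
  proof -
    interpret tableau_sem M rs \<sigma> "U x" "?D x"
      by unfold_locales (use \<sigma> U[OF x] M(2) in auto)
    let ?s = "ssubst \<sigma> x" and ?\<phi> = "map_wqbf \<sigma> (machine_formula (?D x) (U x))"
    have s: "?s = input_word" unfolding input_word_def using ssubst_flat[of \<sigma> "U x"] U(2)[OF x] by simp
    have sw: "?s \<in> words_over \<Sigma>"
      using U(1)[OF x] unfolding s input_word_def words_over_def by (force simp: lists_eq_set)
    have "length ?s \<le> length x"
    proof -
      have "length u \<le> length (flat u)" for u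
      proof (induction u)
        case (Cons y u)
        then show ?case by (cases y) (auto simp: block_def)
      qed simp
      then show ?thesis using U(2)[OF x] unfolding s input_word_def by (metis length_map)
    qed
    then have "L ?s < ?D x"
      using L[OF sw] poly_nat_mono[of "length ?s" "length x" p] by simp
    have "\<exists>v. evals M (L ?s) (initial_config M ?s) v"
      proof (rule evals_exists)
      fix j c' assume "(initial_config M ?s, c') \<in> Defs.step M ^^ j"
      with M(3) sw show "j \<le> L ?s" unfolding path_bound_def M(2) by blast
    qed
    then obtain v where v: "evals M (L ?s) (initial_config M ?s) v" ..
    with \<open>L ?s < ?D x\<close> have "esem ?\<phi> (\<lambda>_. False) = v" by (intro machine_formula_sem[of "L ?s"]) (simp_all only: s)
    moreover have "f ?s = v" unfolding f[OF sw] machine_output_def by (rule evals_val[OF v])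
    moreover have "SAT (ssubst \<sigma> (T x)) = sem ?\<phi> {}"
      unfolding T_def ssubst_flat map_encode by (rule SAT_encode[OF sum_BF_machine_formula])
    moreover have "sem ?\<phi> {} = esem ?\<phi> (\<lambda>_. False)"
      by (rule sem_closed[OF conjunct1[OF sum_BF_machine_formula[unfolded sum_BF_def]]])
    ultimately show ?thesis by simp
  qed
  ultimately show ?thesis
    unfolding karp_s_reducible_def by (intro exI[of _ T] exI[of _ rs] conjI ballI allI impI) (use rs' in simp_all)
qed

theorem theorem20:
  shows "NP_inf sat_alphabet (SAT :: 'r::comm_semiring_1 word \<Rightarrow> 'r) \<and>
         (\<forall>\<Sigma> (f :: 'r word \<Rightarrow> 'r).
            NP_inf \<Sigma> f \<longrightarrow> karp_s_reducible \<Sigma> f sat_alphabet (SAT :: 'r word \<Rightarrow> 'r))"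
  using SAT_in_NP_inf NP_inf_reducible by blast

end
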